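(* Let $q,a,x,y,z,h$ be non-zero complex numbers with $|q|<1$ and $|q^3a^4|<|xyz|^3$, let $\omega=\mathrm e^{\frac23\pi i}$, and assume there are no vanishing denominator factors. Then $${}_{12}W_{11}\!\left(a;x,qx,q^2x,y,qy,q^2y,z,qz,q^2z;q^3,\frac{q^3a^4}{(xyz)^3}\right)=\frac{(qa,x,y,z,\frac{qa}{xy},\frac{qa}{xz},\frac{qa}{yz},a^{1/3},\omega a^{1/3},\omega^2a^{1/3};q)_\infty}{\vartheta(h,h\frac{xyz}{qa};q)\,(\frac{qa}x,\frac{qa}y,\frac{qa}z,a;q)_\infty}$$ $$\times\Bigg(F(x;y,z)+F(y;x,z)+F(z;y,x)+\frac1{(\omega,\omega^2;q)_\infty}\sum_{\zeta\in\{1,\omega,\omega^2\}}E(\zeta)\Bigg),$$ where $$F(x;y,z)=\frac{\vartheta(hx,h\frac{yz}{qa};q)\,(\frac a{x^2};q)_\infty}{(x,\frac yx,\frac zx,\frac{qa}{yz},\frac{a^{1/3}}x,\frac{\omega a^{1/3}}x,\frac{\omega^2a^{1/3}}x;q)_\infty}\,{}_6\phi_5\!\left(x,\tfrac{qa}{yz},\pm\tfrac{q^{1/2}x}{\sqrt a},\pm\tfrac{qx}{\sqrt a};\tfrac{qx}y,\tfrac{qx}z,\tfrac{qx}{a^{1/3}},\tfrac{\omega qx}{a^{1/3}},\tfrac{\omega^2qx}{a^{1/3}};q,q\right),$$ $$E(\zeta)=\frac{\vartheta(h\zeta a^{1/3},h\frac{\zeta^2xyz}{qa^{4/3}};q)}{(\frac{q\zeta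 a^{4/3}}{xyz},\frac{\zeta^2x}{a^{1/3}},\frac{\zeta^2y}{a^{1/3}},\frac{\zeta^2z}{a^{1/3}};q)_\infty}\,{}_6\phi_5\!\left(\zeta a^{1/3},\tfrac{q\zeta a^{4/3}}{xyz},\pm\tfrac{\zeta q^{1/2}}{a^{1/6}},\pm\tfrac{\zeta q}{a^{1/6}};q\omega,q\omega^2,\tfrac{q\zeta a^{1/3}}x,\tfrac{q\zeta a^{1/3}}y,\tfrac{q\zeta a^{1/3}}z;q,q\right).$$
   Context: Notation. $(a;q)_k=\prod_{j=0}^{k-1}(1-aq^j)$, $(a;q)_\infty=\prod_{j\ge0}(1-aq^j)$, $(a_1,\dots,a_r;q)_k=\prod_j(a_j;q)_k$ for $k\in\mathbb N_0\cup\{\infty\}$. In a list, $\pm t$ stands for the two entries $t,-t$. $\vartheta(t;q)=(t,q/t;q)_\infty$ for $t\ne0$, $\vartheta(t_1,\dots,t_k;q)=\prod_j\vartheta(t_j;q)$. ${}_{r+1}\phi_r(a_1,\dots,a_{r+1};b_1,\dots,b_r;p,t)=\sum_{k\ge0}\frac{(a_1,\dots,a_{r+1};p)_k}{(p,b_1,\dots,b_r;p)_k}t^k$ for $|t|<1$. The very-well-poised series in base $p$ is $${}_{12}W_{11}(a;a_4,\dots,a_{12};p,t)={}_{12}\phi_{11}\!\left(a,\pm p\sqrt a,a_4,\dots,a_{12};\pm\sqrt a,\tfrac{pa}{a_4},\dots,\tfrac{pa}{a_{12}};p,t\right),$$ used here with $p=q^3$. A sixth root $a^{1/6}$ of $a$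 and a square root $q^{1/2}$ are fixed; fractional powers of $a$ are powers of $a^{1/6}$, $\sqrt a=(a^{1/6})^3$. $F(y;x,z)$ and $F(z;y,x)$ are obtained from $F(x;y,z)$ by interchanging $x$ with $y$, respectively $x$ with $z$. Convention "no vanishing denominator factors": every infinite $q$-shifted factorial and every theta function appearing in a denominator is non-zero, and no denominator parameter of any series makes a denominator factor vanish. *)

theory Defs
  imports "HOL-Analysis.Analysis"
begin

definition qpoch :: "complex \<Rightarrow> complex \<Rightarrow> nat \<Rightarrow> complex" where
  "qpoch a q k = (\<Prod>j<k. 1 - a * q ^ j)"

definition qpoch_inf :: "complex \<Rightarrow> complex \<Rightarrow> complex" where
  "qpoch_inf a q = (\<Prod>j. 1 - a * q ^ j)"

definition qpochs :: "complex list \<Rightarrow> complex \<Rightarrow> nat \<Rightarrow> complex" where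
  "qpochs as q k = (\<Prod>a\<leftarrow>as. qpoch a q k)"

definition qpochs_inf :: "complex list \<Rightarrow> complex \<Rightarrow> complex" where
  "qpochs_inf as q = (\<Prod>a\<leftarrow>as. qpoch_inf a q)"

definition theta :: "complex \<Rightarrow> complex \<Rightarrow> complex" where
  "theta t q = qpochs_inf [t, q / t] q"

definition thetas :: "complex list \<Rightarrow> complex \<Rightarrow> complex" where
  "thetas ts q = (\<Prod>t\<leftarrow>ts. theta t q)"

(* The series r+1 phi r; it is used with length as = length bs + 1 and |t| < 1. *)
definition qhyp :: "complex list \<Rightarrow> complex list \<Rightarrow> complex \<Rightarrow> complex \<Rightarrow> complex" where
  "qhyp as bs p t = (\<Sum>k. qpochs as p k / qpochs (p # bs) p k * t ^ k)"

definition lower_ok :: "complex list \<Rightarrow> complex \<Rightarrow> bool" where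
  "lower_ok bs p \<longleftrightarrow> (\<forall>b\<in>set bs. \<forall>j::nat. 1 - b * p ^ j \<noteq> 0)"

(* In the very-well-poised series, sa is the chosen square root of a and cs is the
   list a_4, a_5, ... of free parameters; nine of them give 12 W 11. *)
definition vwp_lower :: "complex \<Rightarrow> complex \<Rightarrow> complex list \<Rightarrow> complex \<Rightarrow> complex list" where
  "vwp_lower a sa cs p = [sa, - sa] @ map (\<lambda>c. p * a / c) cs"

definition vwp :: "complex \<Rightarrow> complex \<Rightarrow> complex list \<Rightarrow> complex \<Rightarrow> complex \<Rightarrow> complex" where
  "vwp a sa cs p t = qhyp ([a, p * sa, - (p * sa)] @ cs) (vwp_lower a sa cs p) p t"

definition \<omega> :: complex where
  "\<omega> = exp (2 / 3 * complex_of_real pi * \<i>)"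

(* Below, s is the chosen sixth root of a and r the chosen square root of q. Thus the powers
   of a with exponents 1/6, 1/3, 1/2, 4/3 are s, s^2, s^3, s^8. The lists are kept separate
   from the terms so that the condition on denominators refers to exactly the same lists. *)

definition W_params :: "complex \<Rightarrow> complex \<Rightarrow> complex \<Rightarrow> complex \<Rightarrow> complex list" where
  "W_params q x y z =
     [x, q * x, q ^ 2 * x, y, q * y, q ^ 2 * y, z, q * z, q ^ 2 * z]"

definition F_denom ::
  "complex \<Rightarrow> complex \<Rightarrow> complex \<Rightarrow> complex \<Rightarrow> complex \<Rightarrow> complex \<Rightarrow> complex list" where
  "F_denom q a s x y z =
     [x, y / x, z / x, q * a / (y * z), s ^ 2 / x, \<omega> * s ^ 2 / x, \<omega> ^ 2 * s ^ 2 / x]"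

definition F_lower ::
  "complex \<Rightarrow> complex \<Rightarrow> complex \<Rightarrow> complex \<Rightarrow> complex \<Rightarrow> complex list" where
  "F_lower q s x y z =
     [q * x / y, q * x / z, q * x / s ^ 2, \<omega> * q * x / s ^ 2, \<omega> ^ 2 * q * x / s ^ 2]"

definition F_term ::
  "complex \<Rightarrow> complex \<Rightarrow> complex \<Rightarrow> complex \<Rightarrow> complex \<Rightarrow> complex \<Rightarrow> complex \<Rightarrow> complex \<Rightarrow> complex"
  where
  "F_term q r a s h x y z =
     thetas [h * x, h * (y * z / (q * a))] q * qpoch_inf (a / x ^ 2) q
       / qpochs_inf (F_denom q a s x y z) q
     * qhyp [x, q * a / (y * z), r * x / s ^ 3, - (r * x / s ^ 3), q * x / s ^ 3, - (q * x / s ^ 3)]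
         (F_lower q s x y z) q q"

definition E_denom ::
  "complex \<Rightarrow> complex \<Rightarrow> complex \<Rightarrow> complex \<Rightarrow> complex \<Rightarrow> complex \<Rightarrow> complex list" where
  "E_denom q s x y z \<zeta> =
     [q * \<zeta> * s ^ 8 / (x * y * z), \<zeta> ^ 2 * x / s ^ 2, \<zeta> ^ 2 * y / s ^ 2, \<zeta> ^ 2 * z / s ^ 2]"

definition E_lower ::
  "complex \<Rightarrow> complex \<Rightarrow> complex \<Rightarrow> complex \<Rightarrow> complex \<Rightarrow> complex \<Rightarrow> complex list" where
  "E_lower q s x y z \<zeta> =
     [q * \<omega>, q * \<omega> ^ 2, q * \<zeta> * s ^ 2 / x, q * \<zeta> * s ^ 2 / y, q * \<zeta> * s ^ 2 / z]"

definition E_term ::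
  "complex \<Rightarrow> complex \<Rightarrow> complex \<Rightarrow> complex \<Rightarrow> complex \<Rightarrow> complex \<Rightarrow> complex \<Rightarrow> complex \<Rightarrow> complex"
  where
  "E_term q r s h x y z \<zeta> =
     thetas [h * \<zeta> * s ^ 2, h * (\<zeta> ^ 2 * x * y * z / (q * s ^ 8))] q
       / qpochs_inf (E_denom q s x y z \<zeta>) q
     * qhyp [\<zeta> * s ^ 2, q * \<zeta> * s ^ 8 / (x * y * z),
             \<zeta> * r / s, - (\<zeta> * r / s), \<zeta> * q / s, - (\<zeta> * q / s)]
         (E_lower q s x y z \<zeta>) q q"

definition no_vanishing_denominators ::
  "complex \<Rightarrow> complex \<Rightarrow> complex \<Rightarrow> complex \<Rightarrow> complex \<Rightarrow> complex \<Rightarrow> complex \<Rightarrow> bool"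
  where
  "no_vanishing_denominators q a s h x y z \<longleftrightarrow>
     lower_ok (vwp_lower a (s ^ 3) (W_params q x y z) (q ^ 3)) (q ^ 3) \<and>
     thetas [h, h * (x * y * z / (q * a))] q \<noteq> 0 \<and>
     qpochs_inf [q * a / x, q * a / y, q * a / z, a] q \<noteq> 0 \<and>
     (\<forall>(u, v, w) \<in> {(x, y, z), (y, x, z), (z, y, x)}.
        qpochs_inf (F_denom q a s u v w) q \<noteq> 0 \<and> lower_ok (F_lower q s u v w) q) \<and>
     qpochs_inf [\<omega>, \<omega> ^ 2] q \<noteq> 0 \<and>
     (\<forall>\<zeta> \<in> {1, \<omega>, \<omega> ^ 2}.
        qpochs_inf (E_denom q s x y z \<zeta>) q \<noteq> 0 \<and> lower_ok (E_lower q s x y z \<zeta>) q)"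

end

theory Submission
  imports Defs "HOL-Complex_Analysis.Complex_Analysis"
begin

text \<open>
  The identity is an interchange of two summations, carried out under a contour integral. Write
  \<open>c = q a / (x y z)\<close> and \<open>(b)\<^sub>\<infinity>\<close> for the infinite shifted factorial in base \<open>q\<close>. Because
  \<open>(x, q x, q\<^sup>2 x; q\<^sup>3)\<^sub>n = (x; q)\<^bsub>3 n\<^esub>\<close>, the three triples of parameters of the very-well-poised series
  merge, and its \<open>n\<close>-th term is an elementary factor times
  \<open>(x, y, z; q)\<^bsub>3 n\<^esub> / (q a / x, q a / y, q a / z; q)\<^bsub>3 n\<^esub>\<close>.

  Such a product is, up to simple factors, the value of a nonterminating \<open>q\<close>-Saalschuetz sum, in the form with a free parameter
  \<open>h\<close> (theorem \<open>nonterminating_saalschuetz\<close>). That sum is the sum of the residues, with respect to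
  \<open>dt / t\<close>, of
  \[ \frac{\vartheta(h t)\,\vartheta(h / (c t))}{(t, c t)_\infty} \cdot
  \frac{(x y z c / t)_\infty}{(x / t, y / t, z / t)_\infty} \]
  at the poles \<open>x q\<^sup>k, y q\<^sup>k, z q\<^sup>k\<close>, which accumulate at the origin. The two theta functions multiply by a
  monomial under \<open>t \<mapsto> q t\<close>, so \<open>h\<close> is inert in all ratios of residues and survives only in a
  prefactor. After scaling \<open>t\<close> by \<open>q\<^bsup>3 n\<^esup>\<close>, the \<open>n\<close>-th term of the series becomes, up to a
  constant, the sum of the residues of
  \<open>\<kappa>(t) V\<^sub>n(1 / t) / (x / t, y / t, z / t)\<^sub>\<infinity>\<close>, where the kernel \<open>\<kappa>(t) = \<vartheta>(h t) \<vartheta>(h / (c t)) / (t, c t)\<^sub>\<infinity>\<close> is the same for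
  every \<open>n\<close> (lemma \<open>kernel_vwp_sum\<close>).

  Now sum over \<open>n\<close> first. The functions \<open>V\<^sub>n(1 / t)\<close> are, up to the factor \<open>(q a / t)\<^sub>\<infinity>\<close>, the terms of the
  very-well-poised \<open>6W5(a; t, q t, q\<^sup>2 t; q\<^sup>3, a / t\<^sup>3)\<close>, which has the closed form
  \[ \sum_n V_n(1 / t) = \frac{(q^3 a; q^3)_\infty\, (a / t^2; q)_\infty}{(a / t^3; q^3)_\infty} \]
  (theorem \<open>vwp6_sums\<close>). Its denominator splits over the three cube roots of \<open>a\<close>, so the resulting function
  has the six geometric progressions of poles starting at \<open>x, y, z, a\<^bsup>1/3\<^esup>, \<omega> a\<^bsup>1/3\<^esup>, \<omega>\<^sup>2 a\<^bsup>1/3\<^esup>\<close>. The residues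
  along each of them have a common term ratio and form one of the six \<open>6\<phi>5\<close> series: the first three give
  the terms \<open>F\<close> and the last three the terms \<open>E\<close> (lemmas \<open>F_pole_sum\<close> and \<open>E_pole_sum\<close>).

  The interchange is legitimate on a circle \<open>|t| = R\<close> with \<open>|a|\<^bsup>1/3\<^esup> < R < 1 / |c|\<close>: the lower bound makes the
  series in \<open>n\<close> converge uniformly on the circle, and the upper bound keeps the poles of \<open>1 / (c t)\<^sub>\<infinity>\<close> outside. Such an
  \<open>R\<close> exists exactly if \<open>|q\<^sup>3 a\<^sup>4| < |x y z|\<^sup>3\<close>. The circle may have finitely many of the points \<open>x q\<^sup>k, y q\<^sup>k, z q\<^sup>k\<close>
  outside and finitely many poles \<open>q\<^bsup>-k\<^esup>\<close> of \<open>1 / (t)\<^sub>\<infinity>\<close> inside. Both enter the residue theorem as finite sums that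
  depend linearly on \<open>V\<^sub>n\<close>, and the series in \<open>n\<close> converges at these points too; at \<open>t = q\<^bsup>-k\<^esup>\<close> it even
  terminates. Hence the two applications of the residue theorem, before and after the summation over \<open>n\<close>, differ
  only by that summation (lemma \<open>cubic_main_sum\<close>).

  Both summation formulas are derived by the same mechanism: a telescoping first-order \<open>q\<close>-difference equation is
  iterated until the variables reach \<open>0\<close>, and the limit is evaluated at an argument where a single term or residue is left.
\<close>

section \<open>Shifted factorials and theta functions\<close>

lemma qpoch_0 [simp]: "qpoch a q 0 = 1"
  by (simp add: qpoch_def)

lemma qpoch_Suc: "qpoch a q (Suc n) = qpoch a q n * (1 - a * q ^ n)"
  by (simp add: qpoch_def)

lemma qpoch_add: "qpoch a q (m + n) = qpoch a q m * qpoch (a * q ^ m) q n"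
  by (induction n) (simp_all add: qpoch_Suc power_add mult_ac)

lemma qpoch_Suc_left: "qpoch a q (Suc n) = (1 - a) * qpoch (a * q) q n"
  using qpoch_add[of a q 1 n] by (simp add: qpoch_Suc)

lemma qpoch_mult3: "qpoch a q (3 * n) = qpoch a (q^3) n * qpoch (q * a) (q^3) n * qpoch (q^2 * a) (q^3) n"
proof (induction n)
  case (Suc n)
  have 1: "3 * Suc n = Suc (Suc (Suc (3 * n)))" by simp
  have 2: "(q ^ 3) ^ n = q ^ (3 * n)" by (simp add: power_mult)
  show ?case
    unfolding 1 qpoch_Suc Suc 2 by (simp add: power2_eq_square mult_ac)
qed simp

lemma qpoch_eq_0_iff: "qpoch a q n = 0 \<longleftrightarrow> (\<exists>j<n. a * q ^ j = 1)"
  by (simp add: qpoch_def Bex_def)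

context
  fixes q :: complex
  assumes q: "norm q < 1"
begin

lemma qpoch_summable: "summable (\<lambda>j. norm (a * q ^ j))" for a :: complex
  using q by (simp add: norm_mult norm_power summable_mult summable_geometric)

lemma convergent_prod_qpoch: "convergent_prod (\<lambda>j. 1 - a * q ^ j)"
  by (rule abs_convergent_prod_imp_convergent_prod)
     (rule summable_imp_abs_convergent_prod, use qpoch_summable[of a] in simp)

lemma qpoch_tendsto: "(\<lambda>n. qpoch a q n) \<longlonglongrightarrow> qpoch_inf a q"
  using convergent_prod_LIMSEQ[OF convergent_prod_qpoch[of a]]
  unfolding qpoch_def qpoch_inf_def by (simp add: LIMSEQ_lessThan_iff_atMost)

lemma qpoch_inf_split: "qpoch_inf a q = qpoch a q n * qpoch_inf (a * q ^ n) q"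
proof (rule LIMSEQ_unique)
  show "(\<lambda>m. qpoch a q (m + n)) \<longlonglongrightarrow> qpoch_inf a q"
    using qpoch_tendsto by (rule LIMSEQ_ignore_initial_segment)
  show "(\<lambda>m. qpoch a q (m + n)) \<longlonglongrightarrow> qpoch a q n * qpoch_inf (a * q ^ n) q"
    by (simp only: add.commute[of _ n] qpoch_add) (intro tendsto_intros qpoch_tendsto)
qed

lemma qpoch_inf_Suc: "qpoch_inf a q = (1 - a) * qpoch_inf (a * q) q"
  using qpoch_inf_split[of a 1] by (simp add: qpoch_Suc)

lemma qpoch_inf_eq_0_iff: "qpoch_inf a q = 0 \<longleftrightarrow> (\<exists>j. a * q ^ j = 1)"
proof
  assume "qpoch_inf a q = 0"
  then show "\<exists>j. a * q ^ j = 1"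
    using prodinf_nonzero[OF convergent_prod_qpoch[of a]] unfolding qpoch_inf_def by force
next
  assume "\<exists>j. a * q ^ j = 1"
  then obtain j where "a * q ^ j = 1" by blast
  then show "qpoch_inf a q = 0"
    using qpoch_inf_split[of a "Suc j"] by (simp add: qpoch_Suc)
qed

lemma qpoch_inf_nz: "qpoch_inf a q \<noteq> 0 \<Longrightarrow> a * q ^ j \<noteq> 1"
  by (auto simp: qpoch_inf_eq_0_iff)

lemma qpoch_inf_shift_nz: "qpoch_inf a q \<noteq> 0 \<Longrightarrow> qpoch_inf (a * q ^ n) q \<noteq> 0"
  by (metis qpoch_inf_split mult_zero_right)

lemma qpoch_nz: "qpoch_inf a q \<noteq> 0 \<Longrightarrow> qpoch a q n \<noteq> 0"
  by (metis qpoch_inf_split mult_zero_left)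

lemma qpoch_inf_small_nz:
  assumes "norm a < 1" shows "qpoch_inf a q \<noteq> 0"
proof -
  have "a * q ^ j \<noteq> 1" for j
  proof -
    have "norm (a * q ^ j) \<le> norm a * 1"
      unfolding norm_mult norm_power using q by (intro mult_left_mono power_le_one) auto
    with assms show ?thesis by auto
  qed
  then show ?thesis by (auto simp: qpoch_inf_eq_0_iff)
qed

lemma qpoch_inf_q_nz: "qpoch_inf q q \<noteq> 0"
  by (rule qpoch_inf_small_nz[OF q])

text \<open>
  The finite products converge locally uniformly, by comparison with a geometric series.
\<close>
lemma qpoch_inf_holomorphic [holomorphic_intros]:
  assumes "f holomorphic_on A"
  shows "(\<lambda>t. qpoch_inf (f t) q) holomorphic_on A"
proof -
  have "(\<lambda>a. qpoch_inf a q) holomorphic_on UNIV"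
  proof (rule holomorphic_uniform_sequence)
    show "(\<lambda>a. qpoch a q n) holomorphic_on UNIV" for n
      unfolding qpoch_def by (intro holomorphic_intros)
    fix x :: complex
    have "uniformly_convergent_on (cball x 1) (\<lambda>n a. \<Prod>j<n. 1 + (- (a * q ^ j)))"
    proof (rule uniformly_convergent_on_prod)
      show "uniformly_convergent_on (cball x 1) (\<lambda>N a. \<Sum>n<N. norm (- (a * q ^ n)))"
      proof (rule Weierstrass_m_test')
        show "norm (norm (- (a * q ^ n))) \<le> (norm x + 1) * norm q ^ n" if "a \<in> cball x 1" for n a
        proof -
          have "norm a \<le> norm x + 1"
            using that norm_triangle_sub[of a x] by (auto simp: dist_norm norm_minus_commute)
          then show ?thesis by (auto simp: norm_mult norm_power intro!: mult_right_mono)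
        qed
        show "summable (\<lambda>n. (norm x + 1) * norm q ^ n)"
          using q by (intro summable_mult summable_geometric) auto
      qed
    qed (auto intro!: continuous_intros)
    then have "uniformly_convergent_on (cball x 1) (\<lambda>n a. qpoch a q n)"
      by (simp add: qpoch_def)
    then obtain l where l: "uniform_limit (cball x 1) (\<lambda>n a. qpoch a q n) l sequentially"
      by (auto simp: uniformly_convergent_on_def)
    have "l a = qpoch_inf a q" if "a \<in> cball x 1" for a
      using tendsto_uniform_limitI[OF l that] qpoch_tendsto[of a] LIMSEQ_unique by blast
    then have "uniform_limit (cball x 1) (\<lambda>n a. qpoch a q n) (\<lambda>a. qpoch_inf a q) sequentially"
      using l by (metis (no_types, lifting) uniform_limit_cong')
    then show "\<exists>d>0. cball x d \<subseteq> UNIV \<and>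
        uniform_limit (cball x d) (\<lambda>n a. qpoch a q n) (\<lambda>a. qpoch_inf a q) sequentially"
      by (intro exI[of _ 1]) auto
  qed auto
  from holomorphic_on_compose_gen[OF assms this] show ?thesis
    by (simp add: o_def)
qed

lemma qpoch_inf_continuous [continuous_intros]:
  assumes "continuous_on A f"
  shows "continuous_on A (\<lambda>t. qpoch_inf (f t) q)"
proof -
  have "continuous_on UNIV (\<lambda>a. qpoch_inf a q)"
    by (intro holomorphic_on_imp_continuous_on holomorphic_intros)
  from continuous_on_compose2[OF this assms] show ?thesis by auto
qed

lemma qpoch_inf_tendsto [tendsto_intros]:
  assumes "(f \<longlongrightarrow> l) F"
  shows "((\<lambda>t. qpoch_inf (f t) q) \<longlongrightarrow> qpoch_inf l q) F"
proof -
  have "continuous_on UNIV (\<lambda>a. qpoch_inf a q)"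
    by (intro holomorphic_on_imp_continuous_on holomorphic_intros)
  then have "isCont (\<lambda>a. qpoch_inf a q) l"
    by (simp add: continuous_on_eq_continuous_at)
  with assms show ?thesis by (rule isCont_tendsto_compose[rotated])
qed

lemma qpoch_inf_0 [simp]: "qpoch_inf 0 q = 1"
  by (simp add: qpoch_inf_def)

lemma theta_eq: "theta t q = qpoch_inf t q * qpoch_inf (q / t) q"
  by (simp add: theta_def qpochs_inf_def)

lemma theta_holomorphic [holomorphic_intros]:
  assumes "f holomorphic_on A" "\<And>t. t \<in> A \<Longrightarrow> f t \<noteq> 0"
  shows "(\<lambda>t. theta (f t) q) holomorphic_on A"
  unfolding theta_eq using assms by (intro holomorphic_intros) auto

text \<open>
  Both sides equal \<open>(t)\<^sub>\<infinity> (1/t)\<^sub>\<infinity>\<close> up to a factor \<open>1 - t\<close>. Cancelling this factor loses only \<open>t = 1\<close>, where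
  both sides vanish.
\<close>
lemma theta_mult_q:
  assumes "q \<noteq> 0" "t \<noteq> 0"
  shows "theta (q * t) q = - theta t q / t"
proof -
  have "theta (q * t) q * (1 - t) = qpoch_inf t q * qpoch_inf (1 / t) q"
    using assms qpoch_inf_Suc[of t] by (simp add: theta_eq mult_ac)
  also have "\<dots> = qpoch_inf t q * ((1 - 1 / t) * qpoch_inf (q / t) q)"
    using qpoch_inf_Suc[of "1/t"] by simp
  also have "\<dots> = (1 - t) * (- theta t q / t)"
    using assms by (simp add: theta_eq field_simps)
  finally have *: "theta (q * t) q * (1 - t) = (1 - t) * (- theta t q / t)" .
  show ?thesis
  proof (cases "t = 1")
    case True
    have "qpoch_inf 1 q = 0" by (subst qpoch_inf_eq_0_iff) (auto intro: exI[of _ 0])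
    then show ?thesis using True assms by (simp add: theta_eq)
  next
    case False
    moreover have "(1 - t) * theta (q * t) q = (1 - t) * (- theta t q / t)"
      using * by (simp only: mult.commute)
    ultimately show ?thesis by (metis mult_left_cancel right_minus_eq)
  qed
qed

lemma theta_div_q:
  assumes "q \<noteq> 0" "t \<noteq> 0"
  shows "theta (t / q) q = - (t / q) * theta t q"
  using theta_mult_q[of "t / q"] assms by simp

lemma theta_mult_power:
  assumes "q \<noteq> 0" "t \<noteq> 0"
  shows "theta (q ^ m * t) q = theta t q / ((- t) ^ m * q ^ (m * (m - 1) div 2))"
proof (induction m)
  case (Suc m)
  have "Suc m * (Suc m - 1) div 2 = m * (m - 1) div 2 + m"
  proof (cases m)
    case (Suc k)
    have "even (k * (k+1))" by simp
    then show ?thesis using Suc by (simp add: algebra_simps)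
  qed simp
  then have e: "q ^ (Suc m * (Suc m - 1) div 2) = q ^ (m * (m - 1) div 2) * q ^ m"
    by (simp only: power_add)
  have "theta (q ^ Suc m * t) q = - theta (q ^ m * t) q / (q ^ m * t)"
    using theta_mult_q[of "q ^ m * t"] assms by (simp add: mult_ac)
  then show ?case unfolding e Suc using assms by (simp add: field_simps)
qed simp

lemma norm_cube_lt_1: "norm (q ^ 3) < 1"
  using q by (simp add: norm_power power_less_one_iff)

text \<open>
  The bound is uniform in the length and in the argument, so that the very-well-poised series can be dominated by a geometric one.
\<close>
lemma qpoch_bounded: "\<exists>M>0. \<forall>a n. norm a \<le> R \<longrightarrow> norm (qpoch a q n) \<le> M"
proof -
  define M where "M = exp (\<Sum>j. \<bar>R\<bar> * norm q ^ j)"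
  have s: "summable (\<lambda>j. \<bar>R\<bar> * norm q ^ j)"
    using q by (intro summable_mult summable_geometric) auto
  have "norm (qpoch a q n) \<le> M" if "norm a \<le> R" for a n
  proof -
    have "norm (qpoch a q n) = (\<Prod>j<n. norm (1 - a * q ^ j))"
      by (simp add: qpoch_def prod_norm)
    also have "\<dots> \<le> (\<Prod>j<n. exp (\<bar>R\<bar> * norm q ^ j))"
    proof (intro prod_mono conjI)
      fix j
      have "norm (1 - a * q ^ j) \<le> 1 + norm (a * q ^ j)"
        by (metis norm_one norm_triangle_ineq4)
      also have "norm (a * q ^ j) \<le> \<bar>R\<bar> * norm q ^ j"
        using that by (auto simp: norm_mult norm_power intro!: mult_right_mono)
      finally show "norm (1 - a * q ^ j) \<le> exp (\<bar>R\<bar> * norm q ^ j)"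
        using exp_ge_add_one_self[of "\<bar>R\<bar> * norm q ^ j"] by linarith
    qed auto
    also have "\<dots> = exp (\<Sum>j<n. \<bar>R\<bar> * norm q ^ j)"
      by (simp add: exp_sum)
    also have "\<dots> \<le> M"
      unfolding M_def by (subst exp_le_cancel_iff, rule sum_le_suminf[OF s]) auto
    finally show ?thesis .
  qed
  then show ?thesis by (intro exI[of _ M]) (auto simp: M_def)
qed

lemma qpoch_inf_bounded: "\<exists>M>0. \<forall>a. norm a \<le> R \<longrightarrow> norm (qpoch_inf a q) \<le> M"
proof -
  obtain M where M: "M > 0" "\<And>a n. norm a \<le> R \<Longrightarrow> norm (qpoch a q n) \<le> M"
    using qpoch_bounded[of R] by blast
  have "norm (qpoch_inf a q) \<le> M" if "norm a \<le> R" for a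
    by (rule LIMSEQ_le_const2[OF tendsto_norm[OF qpoch_tendsto]]) (use M that in auto)
  with M show ?thesis by blast
qed

end

lemma omega_cube: "\<omega> ^ 3 = 1"
  unfolding \<omega>_def using exp_two_pi_i by (simp add: exp_of_nat_mult [symmetric] mult_ac)

lemma omega_neq_1: "\<omega> \<noteq> 1"
proof
  assume "\<omega> = 1"
  then have "Re (exp (2 / 3 * complex_of_real pi * \<i>)) = 1"
    by (simp add: \<omega>_def)
  then have "cos (2 / 3 * pi) = 1"
    by (simp add: Re_exp)
  then show False
    using cos_120 by (simp add: mult.commute)
qed

lemma omega_sum: "1 + \<omega> + \<omega> ^ 2 = 0"
  using omega_cube omega_neq_1 by algebra

text \<open>
  The factorisation \<open>1 - b\<^sup>3 = (1 - b) (1 - \<omega> b) (1 - \<omega>\<^sup>2 b)\<close>, applied to each factor, passes to the limit.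
\<close>
lemma qpoch_inf_cube:
  assumes "norm q < 1"
  shows "qpoch_inf a q * qpoch_inf (\<omega> * a) q * qpoch_inf (\<omega> ^ 2 * a) q = qpoch_inf (a ^ 3) (q ^ 3)"
proof (rule LIMSEQ_unique)
  note w3 = omega_cube and s = omega_sum
  have "qpoch a q n * qpoch (\<omega> * a) q n * qpoch (\<omega> ^ 2 * a) q n = qpoch (a ^ 3) (q ^ 3) n" for n
  proof (induction n)
    case (Suc n)
    have "(1 - t) * (1 - \<omega> * t) * (1 - \<omega> ^ 2 * t) = 1 - t ^ 3" for t
      using w3 s by algebra
    from this[of "a * q ^ n"]
    have e: "(1 - a * q ^ n) * (1 - \<omega> * a * q ^ n) * (1 - \<omega> ^ 2 * a * q ^ n) = 1 - a ^ 3 * (q ^ 3) ^ n"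
      by (simp add: mult_ac power_mult_distrib power_mult [symmetric])
    show ?case
      unfolding qpoch_Suc e [symmetric] Suc [symmetric] by (simp only: mult_ac)
  qed simp
  moreover have "(\<lambda>n. qpoch a q n * qpoch (\<omega> * a) q n * qpoch (\<omega> ^ 2 * a) q n) \<longlonglongrightarrow>
     qpoch_inf a q * qpoch_inf (\<omega> * a) q * qpoch_inf (\<omega> ^ 2 * a) q"
    by (intro tendsto_mult qpoch_tendsto assms)
  ultimately show "(\<lambda>n. qpoch (a ^ 3) (q ^ 3) n) \<longlonglongrightarrow>
     qpoch_inf a q * qpoch_inf (\<omega> * a) q * qpoch_inf (\<omega> ^ 2 * a) q"
    by simp
  show "(\<lambda>n. qpoch (a ^ 3) (q ^ 3) n) \<longlonglongrightarrow> qpoch_inf (a ^ 3) (q ^ 3)"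
    by (rule qpoch_tendsto[OF norm_cube_lt_1[OF assms]])
qed

section \<open>A very-well-poised sum in base \<open>q\<^sup>3\<close>\<close>

text \<open>
  In the variable \<open>u = 1 / t\<close> the products \<open>u\<^sup>m (1/u; q)\<^sub>m\<close> are polynomials. This makes the series below meaningful and
  continuous at \<open>u = 0\<close>, which is where its functional equation leads.
\<close>
definition rpoch :: "complex \<Rightarrow> complex \<Rightarrow> nat \<Rightarrow> complex" where
  "rpoch u q m = (\<Prod>j<m. u - q ^ j)"

text \<open>
  The \<open>n\<close>-th term of the very-well-poised series \<open>6W5(a; t, q t, q\<^sup>2 t; q\<^sup>3, a / t\<^sup>3)\<close> at \<open>t = 1 / u\<close>, multiplied by
  \<open>(q a u; q)\<^sub>\<infinity>\<close>. This factor absorbs the denominator \<open>(q a / t; q)\<^bsub>3 n\<^esub>\<close>, so that each term is entire in \<open>u\<close>.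
\<close>
definition vwp6 :: "complex \<Rightarrow> complex \<Rightarrow> nat \<Rightarrow> complex \<Rightarrow> complex" where
  "vwp6 a q n u = (1 - a * q ^ (6 * n)) / (1 - a) * qpoch a (q^3) n / qpoch (q^3) (q^3) n
     * a ^ n * rpoch u q (3 * n) * qpoch_inf (a * q ^ (3 * n + 1) * u) q"

lemma rpoch_0 [simp]: "rpoch u q 0 = 1"
  by (simp add: rpoch_def)

lemma rpoch_Suc: "rpoch u q (Suc m) = rpoch u q m * (u - q ^ m)"
  by (simp add: rpoch_def)

lemma rpoch_mult_q: "rpoch (q * u) q (Suc m) = q ^ m * (q * u - 1) * rpoch u q m"
proof (induction m)
  case (Suc m)
  show ?case
    unfolding rpoch_Suc[of "q * u" q "Suc m"] Suc rpoch_Suc[of u q m] by (simp add: algebra_simps)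
qed (simp add: rpoch_Suc)

lemma qpoch_eq_rpoch: "u \<noteq> 0 \<Longrightarrow> rpoch u q m = u ^ m * qpoch (1 / u) q m"
  by (induction m) (simp_all add: rpoch_Suc qpoch_Suc field_simps)

lemma rpoch_power_eq_0: "k < m \<Longrightarrow> rpoch (q ^ k) q m = 0"
  by (auto simp: rpoch_def)

context
  fixes q a :: complex
  assumes q: "norm q < 1" and a1: "a \<noteq> 1"
begin

lemma qpoch_inf_Suc3: "qpoch_inf b q = (1 - b) * (1 - b * q) * (1 - b * q^2) * qpoch_inf (b * q^3) q"
  using qpoch_inf_split[OF q, of b 3] by (simp add: qpoch_def eval_nat_numeral mult_ac)

text \<open>
  Replacing \<open>t\<close> by \<open>t / q\<close> turns the parameter triple \<open>t, q t, q\<^sup>2 t\<close> into \<open>t / q, t, q t\<close>, which shifts only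
  the single parameter \<open>q\<^sup>2 t\<close>, by the base \<open>q\<^sup>3\<close>. This is a contiguous relation of the \<open>6W5\<close> series, and the right-hand
  side is its telescoping certificate.
\<close>
lemma vwp6_telescope:
  assumes q0: "q \<noteq> 0"
  shows "(\<Sum>n<Suc m. (1 - a * u^3) * vwp6 a q n u - (1 - a * u^2) * (1 - a * q * u^2) * vwp6 a q n (q * u))
    = - (a ^ (m + 1) * qpoch (a * q^3) (q^3) m / qpoch (q^3) (q^3) m * u * rpoch u q (3 * m + 2)
        * qpoch_inf (a * q ^ (3 * m + 2) * u) q)" (is "sum ?D _ = ?U m")
proof -
  have pn: "qpoch (q^3) (q^3) m \<noteq> 0" for m
    by (rule qpoch_nz[OF norm_cube_lt_1 qpoch_inf_small_nz]) (use norm_cube_lt_1 q in auto)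
  \<comment> \<open>The increment of the certificate, divided by all common factors; \<open>T\<close> stands for \<open>q\<^bsup>3 m + 2\<^esup>\<close>.\<close>
  have key: "(1 - a * u^3) * (1 - a * (q*T)^2) * (u - T) * (1 - a * q * (q*T) * u)
      - (1 - a * u^2) * (1 - a * q * u^2) * (1 - a * (q*T)^2) * T * (q * u - 1)
      = - (a * (1 - a * (q*T)) * u * (u - T) * (u - q*T) * (u - q^2*T))
        + (1 - q*T) * u * (1 - a * T * u) * (1 - a * (q * T) * u) * (1 - a * q * (q * T) * u)" for T
    by algebra
  show ?thesis
  proof (induction m)
    case 0
    define X where "X = qpoch_inf (a * q^2 * u) q"
    have "qpoch_inf (a * q * u) q = (1 - a * q * u) * X"
      using qpoch_inf_Suc[OF q, of "a * q * u"] by (simp add: X_def power2_eq_square mult_ac)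
    then have w1: "vwp6 a q 0 u = (1 - a * q * u) * X"
      using a1 by (simp add: vwp6_def mult_ac)
    have w2: "vwp6 a q 0 (q * u) = X"
      using a1 by (simp add: vwp6_def X_def power2_eq_square mult_ac)
    have S: "rpoch u q (3 * 0 + 2) = (u - 1) * (u - q)"
      by (simp add: rpoch_def eval_nat_numeral)
    have "(1 - a * u^3) * ((1 - a * q * u) * X) - (1 - a * u^2) * (1 - a * q * u^2) * X
        = - (a * u * ((u - 1) * (u - q)) * X)"
      by algebra
    then show ?case
      unfolding S by (simp add: w1 w2) (simp add: X_def flip: power2_eq_square)
  next
    case (Suc m)
    define T where "T = q ^ (3 * m + 2)"
    define A where "A = qpoch (a * q^3) (q^3) m"
    define P where "P = qpoch (q^3) (q^3) m"
    define S where "S = rpoch u q (3 * m + 2)"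
    define X where "X = qpoch_inf (a * q ^ (3 * m + 5) * u) q"
    have e3: "3 * Suc m = Suc (3 * m + 2)" "3 * Suc m + 2 = Suc (Suc (Suc (3 * m + 2)))" by auto
    have pT: "q ^ (3 * m + 3) = q * T" "q^3 * (q^3) ^ m = q * T" "q ^ (6 * Suc m) = (q * T) ^ 2"
      "q ^ Suc (3 * m + 2) = q * T" "q ^ Suc (Suc (3 * m + 2)) = q^2 * T"
      by (simp_all add: T_def power_add [symmetric] power_mult [symmetric] power_mult_distrib
           flip: power_Suc power_add) (simp_all add: eval_nat_numeral)
    have P0: "P \<noteq> 0" "1 - q * T \<noteq> 0"
      using pn[of m] pn[of "Suc m"] pT(2) by (auto simp: P_def qpoch_Suc)
    have co: "(1 - a * q ^ (6 * Suc m)) / (1 - a) * qpoch a (q^3) (Suc m) / qpoch (q^3) (q^3) (Suc m) * a ^ Suc m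
        = (1 - a * (q * T)^2) * A * a ^ Suc m / (P * (1 - q * T))"
      using a1 unfolding pT qpoch_Suc[of "q^3"] qpoch_Suc_left[of a] A_def P_def by simp
    have s1: "rpoch u q (3 * Suc m) = S * (u - T)"
      unfolding e3 rpoch_Suc S_def T_def ..
    have s2: "rpoch (q * u) q (3 * Suc m) = T * (q * u - 1) * S"
      unfolding e3 rpoch_mult_q S_def T_def ..
    have s3: "rpoch u q (3 * Suc m + 2) = S * (u - T) * (u - q * T) * (u - q^2 * T)"
      unfolding e3(2) rpoch_Suc pT unfolding S_def T_def ..
    have x1: "qpoch_inf (a * q ^ (3 * Suc m + 1) * u) q = (1 - a * q * (q * T) * u) * X"
      using qpoch_inf_Suc[OF q, of "a * q ^ (3 * m + 4) * u"]
      by (simp add: X_def T_def eval_nat_numeral mult_ac)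
    have x2: "qpoch_inf (a * q ^ (3 * Suc m + 1) * (q * u)) q = X"
      by (simp add: X_def eval_nat_numeral mult_ac)
    have x3: "qpoch_inf (a * q ^ (3 * m + 2) * u) q = (1 - a * T * u) * (1 - a * (q * T) * u) * (1 - a * q * (q * T) * u) * X"
      using qpoch_inf_Suc3[of "a * q ^ (3 * m + 2) * u"]
      by (simp add: X_def T_def eval_nat_numeral mult_ac)
    have x4: "qpoch_inf (a * q ^ (3 * Suc m + 2) * u) q = X"
      by (simp add: X_def eval_nat_numeral)
    define C where "C = A * a ^ Suc m * S * X / (P * (1 - q * T))"
    have w1: "vwp6 a q (Suc m) u = C * ((1 - a * (q*T)^2) * (u - T) * (1 - a * q * (q*T) * u))"
      unfolding vwp6_def co s1 x1 C_def by simp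
    have w2: "vwp6 a q (Suc m) (q * u) = C * ((1 - a * (q*T)^2) * T * (q * u - 1))"
      unfolding vwp6_def co s2 x2 C_def by simp
    have C: "C * (1 - q * T) = A * a ^ Suc m * S * X / P"
      using P0 by (simp add: C_def)
    have "?D (Suc m) = C *
       ((1 - a * u^3) * (1 - a * (q*T)^2) * (u - T) * (1 - a * q * (q*T) * u)
      - (1 - a * u^2) * (1 - a * q * u^2) * (1 - a * (q*T)^2) * T * (q * u - 1))"
      unfolding w1 w2 by algebra
    also have "\<dots> = - (C * (a * (1 - a * (q*T)) * u * (u - T) * (u - q*T) * (u - q^2*T)))
        + C * (1 - q * T) * (u * ((1 - a * T * u) * (1 - a * (q * T) * u) * (1 - a * q * (q * T) * u)))"
      unfolding key by (simp only: distrib_left mult_minus_right mult.assoc)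
    also have "\<dots> = ?U (Suc m) - ?U m"
      unfolding C unfolding C_def qpoch_Suc[of "q^3"] qpoch_Suc[of "a * q^3"] s3 x3 x4
      unfolding A_def [symmetric] P_def [symmetric] S_def [symmetric]
      using pT(2) by (simp add: mult_ac)
    finally have "?D (Suc m) = ?U (Suc m) - ?U m" .
    then show ?case
      unfolding sum.lessThan_Suc[of ?D "Suc m"] Suc.IH by simp
  qed
qed

text \<open>
  Each factor is largest in modulus at \<open>u = - R\<close> with \<open>q\<close> replaced by its modulus, and there the product is again a shifted factorial.
\<close>
lemma norm_rpoch_le:
  assumes "norm u \<le> R" "R > 0"
  shows "norm (rpoch u q m) \<le> R ^ m * norm (qpoch (- 1 / of_real R) (of_real (norm q)) m)"
proof (induction m)
  case (Suc m)
  have "norm (u - q ^ m) \<le> R + norm q ^ m"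
    using norm_triangle_ineq4[of u "q ^ m"] assms by (simp add: norm_power)
  also have "\<dots> = R * norm (1 - (- 1 / complex_of_real R) * of_real (norm q) ^ m)"
  proof -
    have "1 - (- 1 / complex_of_real R) * of_real (norm q) ^ m = of_real (1 + norm q ^ m / R)"
      by simp
    then have "norm (1 - (- 1 / complex_of_real R) * of_real (norm q) ^ m) = 1 + norm q ^ m / R"
      using assms by (metis abs_of_nonneg add_nonneg_nonneg divide_nonneg_nonneg less_imp_le
          norm_ge_zero norm_of_real zero_le_one zero_le_power)
    then show ?thesis using assms by (simp add: field_simps)
  qed
  finally have "norm (rpoch u q m) * norm (u - q ^ m)
      \<le> (R ^ m * norm (qpoch (- 1 / of_real R) (of_real (norm q)) m))
        * (R * norm (1 - (- 1 / complex_of_real R) * of_real (norm q) ^ m))"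
    using Suc assms by (intro mult_mono) auto
  then show ?case
    unfolding rpoch_Suc qpoch_Suc norm_mult by (simp only: power_Suc mult_ac)
qed simp

lemma inverse_qpoch_bounded: "\<exists>M>0. \<forall>n. norm (1 / qpoch (q^3) (q^3) n) \<le> M"
proof -
  have nz: "qpoch_inf (q^3) (q^3) \<noteq> 0"
    by (rule qpoch_inf_q_nz[OF norm_cube_lt_1[OF q]])
  have "(\<lambda>n. 1 / qpoch (q^3) (q^3) n) \<longlonglongrightarrow> 1 / qpoch_inf (q^3) (q^3)"
    by (intro tendsto_intros qpoch_tendsto norm_cube_lt_1 q nz)
  then have "Bseq (\<lambda>n. 1 / qpoch (q^3) (q^3) n)"
    by (meson convergentI Bseq_conv_Bfun convergent_imp_Bseq)
  then show ?thesis by (auto simp: Bseq_def)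
qed

text \<open>
  All factors are bounded except \<open>a\<^sup>n\<close> and the polynomial of degree \<open>3 n\<close> in \<open>u\<close>, which together grow like
  \<open>(|a| R\<^sup>3)\<^sup>n\<close>.
\<close>
lemma vwp6_bound:
  assumes "R > 0"
  shows "\<exists>M>0. \<forall>n u. norm u \<le> R \<longrightarrow> norm (vwp6 a q n u) \<le> M * (norm a * R ^ 3) ^ n"
proof -
  obtain M1 where M1: "M1 > 0" "\<And>n. norm (qpoch a (q^3) n) \<le> M1"
    using qpoch_bounded[OF norm_cube_lt_1[OF q], of "norm a"] by blast
  obtain M2 where M2: "M2 > 0" "\<And>n. norm (1 / qpoch (q^3) (q^3) n) \<le> M2"
    using inverse_qpoch_bounded by blast
  have "norm (complex_of_real (norm q)) < 1" using q by simp
  from qpoch_bounded[OF this, of "norm (- 1 / complex_of_real R)"]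
  obtain M3 where M3: "M3 > 0" "\<And>n. norm (qpoch (- 1 / of_real R) (of_real (norm q)) n) \<le> M3"
    by blast
  obtain M4 where M4: "M4 > 0" "\<And>b. norm b \<le> norm a * R \<Longrightarrow> norm (qpoch_inf b q) \<le> M4"
    using qpoch_inf_bounded[OF q, of "norm a * R"] by blast
  define M0 where "M0 = (1 + norm a) / norm (1 - a)"
  have M0: "M0 > 0" using a1 by (simp add: M0_def add_pos_nonneg)
  have "norm (vwp6 a q n u) \<le> M0 * M1 * M2 * M3 * M4 * (norm a * R ^ 3) ^ n" if u: "norm u \<le> R" for n u
  proof -
    have q1: "norm q ^ k \<le> 1" for k using q by (intro power_le_one) auto
    have b0: "norm ((1 - a * q ^ (6 * n)) / (1 - a)) \<le> M0"
    proof -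
      have "norm (1 - a * q ^ (6 * n)) \<le> 1 + norm a * norm q ^ (6 * n)"
        by (metis norm_mult norm_one norm_power norm_triangle_ineq4)
      also have "\<dots> \<le> 1 + norm a * 1" by (intro add_left_mono mult_left_mono q1) auto
      finally show ?thesis by (simp add: M0_def norm_divide divide_right_mono)
    qed
    have b3: "norm (rpoch u q (3 * n)) \<le> R ^ (3 * n) * M3"
      using norm_rpoch_le[OF u \<open>R > 0\<close>, of "3 * n"] M3(2)[of "3 * n"] \<open>R > 0\<close>
      by (meson mult_left_mono order_trans zero_le_power less_imp_le)
    have b4: "norm (qpoch_inf (a * q ^ (3 * n + 1) * u) q) \<le> M4"
    proof (rule M4(2))
      have "norm (a * q ^ (3 * n + 1) * u) = norm a * norm q ^ (3 * n + 1) * norm u"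
        by (simp add: norm_mult norm_power)
      also have "\<dots> \<le> norm a * 1 * R" using u q1[of "3 * n + 1"] by (intro mult_mono) (simp_all del: power_Suc)
      finally show "norm (a * q ^ (3 * n + 1) * u) \<le> norm a * R" by simp
    qed
    have e: "norm (vwp6 a q n u) = norm ((1 - a * q ^ (6 * n)) / (1 - a)) * norm (qpoch a (q^3) n)
        * norm (1 / qpoch (q^3) (q^3) n) * norm a ^ n * norm (rpoch u q (3 * n))
        * norm (qpoch_inf (a * q ^ (3 * n + 1) * u) q)"
      by (simp add: vwp6_def norm_mult norm_divide norm_power)
    also have "\<dots> \<le> M0 * M1 * M2 * norm a ^ n * (R ^ (3 * n) * M3) * M4"
      using M0 M1 M2 M3 M4 b0 b3 b4 \<open>R > 0\<close> by (intro mult_mono) auto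
    also have "\<dots> = M0 * M1 * M2 * M3 * M4 * (norm a * R ^ 3) ^ n"
      unfolding power_mult_distrib power_mult[of R 3 n] by (simp add: mult_ac)
    finally show ?thesis .
  qed
  then show ?thesis
    using M0 M1 M2 M3 M4 by (intro exI[of _ "M0 * M1 * M2 * M3 * M4"]) auto
qed

lemma vwp6_uniform:
  assumes "R > 0" "norm a * R ^ 3 < 1"
  shows "uniform_limit (cball 0 R) (\<lambda>N u. \<Sum>n<N. vwp6 a q n u) (\<lambda>u. \<Sum>n. vwp6 a q n u) sequentially"
    and "norm u \<le> R \<Longrightarrow> summable (\<lambda>n. vwp6 a q n u)"
proof -
  obtain M where M: "\<And>n u. norm u \<le> R \<Longrightarrow> norm (vwp6 a q n u) \<le> M * (norm a * R ^ 3) ^ n"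
    using vwp6_bound[OF assms(1)] by blast
  have s: "summable (\<lambda>n. M * (norm a * R ^ 3) ^ n)"
    using assms by (intro summable_mult summable_geometric) auto
  show "uniform_limit (cball 0 R) (\<lambda>N u. \<Sum>n<N. vwp6 a q n u) (\<lambda>u. \<Sum>n. vwp6 a q n u) sequentially"
    by (rule Weierstrass_m_test[OF _ s]) (use M in auto)
  show "norm u \<le> R \<Longrightarrow> summable (\<lambda>n. vwp6 a q n u)"
    by (rule summable_comparison_test'[OF s]) (use M in auto)
qed

lemma vwp6_continuous [continuous_intros]: "continuous_on A (vwp6 a q n)"
  unfolding vwp6_def rpoch_def by (intro continuous_intros q)

text \<open>
  The condition is preserved by \<open>u \<mapsto> q u\<close>, so the functional equation can be iterated. The second
  alternative, where the series terminates, covers the points \<open>t = q\<^bsup>-k\<^esup>\<close>, at which the first one can fail.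
\<close>
definition vwp6_convergent :: "complex \<Rightarrow> bool" where
  "vwp6_convergent u \<longleftrightarrow> norm a * norm u ^ 3 < 1 \<or> (\<exists>k. u = q ^ k)"

lemma vwp6_convergent_mult_q: "vwp6_convergent u \<Longrightarrow> vwp6_convergent (q * u)"
proof -
  have "norm a * norm (q * u) ^ 3 < 1" if "norm a * norm u ^ 3 < 1"
  proof -
    have "norm (q * u) \<le> 1 * norm u"
      unfolding norm_mult using q by (intro mult_right_mono) auto
    then have "norm a * norm (q * u) ^ 3 \<le> norm a * norm u ^ 3"
      by (intro mult_left_mono power_mono) auto
    with that show ?thesis by linarith
  qed
  moreover have "q * q ^ k = q ^ Suc k" for k by simp
  ultimately show "vwp6_convergent u \<Longrightarrow> vwp6_convergent (q * u)"
    unfolding vwp6_convergent_def by metis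
qed

lemma exists_radius:
  assumes "norm a * norm u ^ 3 < 1"
  obtains R where "R > 0" "norm u < R" "norm a * R ^ 3 < 1"
proof -
  have "((\<lambda>R. norm a * R ^ 3) \<longlongrightarrow> norm a * norm u ^ 3) (at_right (norm u))"
    by (intro tendsto_intros)
  then have "eventually (\<lambda>R. norm a * R ^ 3 < 1) (at_right (norm u))"
    using assms by (rule order_tendstoD)
  moreover have "eventually (\<lambda>R. R > norm u) (at_right (norm u))"
    by (rule eventually_at_right_less)
  ultimately have "eventually (\<lambda>R. norm a * R ^ 3 < 1 \<and> R > norm u) (at_right (norm u))"
    by eventually_elim auto
  then obtain R where "norm a * R ^ 3 < 1" "R > norm u"
    using eventually_happens trivial_limit_at_right_real by blast
  with that[of R] show thesis by (smt (verit) norm_ge_zero)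
qed

lemma vwp6_summable: "vwp6_convergent u \<Longrightarrow> summable (\<lambda>n. vwp6 a q n u)"
proof (cases "norm a * norm u ^ 3 < 1")
  case True
  then obtain R where "R > 0" "norm u < R" "norm a * R ^ 3 < 1" by (rule exists_radius)
  then show ?thesis using vwp6_uniform(2)[of R u] by simp
next
  case False
  assume "vwp6_convergent u"
  with False obtain k where k: "u = q ^ k" by (auto simp: vwp6_convergent_def)
  have "vwp6 a q n u = 0" if "n \<notin> {..k}" for n
    using that rpoch_power_eq_0[of k "3 * n" q] by (simp add: vwp6_def k)
  then show ?thesis by (intro summable_finite[of "{..k}"]) auto
qed

text \<open>
  The certificate of \<open>vwp6_telescope\<close> tends to \<open>0\<close>: it vanishes eventually if the series terminates, and decays geometrically otherwise.
\<close>
lemma vwp6_step: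
  assumes "q \<noteq> 0" "vwp6_convergent u"
  shows "(1 - a * u^3) * (\<Sum>n. vwp6 a q n u) = (1 - a * u^2) * (1 - a * q * u^2) * (\<Sum>n. vwp6 a q n (q * u))"
proof -
  define U where "U m = - (a ^ (m + 1) * qpoch (a * q^3) (q^3) m / qpoch (q^3) (q^3) m * u * rpoch u q (3 * m + 2)
        * qpoch_inf (a * q ^ (3 * m + 2) * u) q)" for m
  let ?D = "\<lambda>n. (1 - a * u^3) * vwp6 a q n u - (1 - a * u^2) * (1 - a * q * u^2) * vwp6 a q n (q * u)"
  have U0: "U \<longlonglongrightarrow> 0"
  proof (cases "norm a * norm u ^ 3 < 1")
    case False
    with assms obtain k where k: "u = q ^ k" by (auto simp: vwp6_convergent_def)
    have "U m = 0" if "m \<ge> k" for m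
      using that rpoch_power_eq_0[of k "3 * m + 2" q] by (simp add: U_def k)
    then have "eventually (\<lambda>m. U m = 0) sequentially"
      by (rule eventually_sequentiallyI)
    then show ?thesis by (rule tendsto_eventually)
  next
    case True
    then obtain R where R: "R > 0" "norm u < R" "norm a * R ^ 3 < 1" by (rule exists_radius)
    have "norm (complex_of_real (norm q)) < 1" using q by simp
    from qpoch_bounded[OF this, of "norm (- 1 / complex_of_real R)"]
    obtain M3 where M3: "M3 > 0" "\<And>n. norm (qpoch (- 1 / of_real R) (of_real (norm q)) n) \<le> M3"
      by blast
    have p: "norm (q^3) < 1" by (rule norm_cube_lt_1[OF q])
    have l1: "(\<lambda>m. qpoch (a * q^3) (q^3) m / qpoch (q^3) (q^3) m * u) \<longlonglongrightarrow>
       qpoch_inf (a * q^3) (q^3) / qpoch_inf (q^3) (q^3) * u"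
      by (intro tendsto_intros qpoch_tendsto p qpoch_inf_q_nz)
    have "(\<lambda>m. a * (q ^ 2 * (q^3) ^ m) * u) \<longlonglongrightarrow> a * (q ^ 2 * 0) * u"
      using p by (intro tendsto_intros LIMSEQ_power_zero) auto
    moreover have "q ^ 2 * (q^3) ^ m = q ^ (3 * m + 2)" for m
      unfolding power_add power_mult by (rule mult.commute)
    ultimately have "(\<lambda>m. a * q ^ (3 * m + 2) * u) \<longlonglongrightarrow> 0"
      by simp
    from qpoch_inf_tendsto[OF q this]
    have l2: "(\<lambda>m. qpoch_inf (a * q ^ (3 * m + 2) * u) q) \<longlonglongrightarrow> qpoch_inf 0 q" .
    have l3: "(\<lambda>m. a ^ (m + 1) * rpoch u q (3 * m + 2)) \<longlonglongrightarrow> 0"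
    proof (rule Lim_null_comparison)
      show "\<forall>\<^sub>F m in sequentially. norm (a ^ (m + 1) * rpoch u q (3 * m + 2)) \<le> norm a * R ^ 2 * M3 * (norm a * R ^ 3) ^ m"
      proof (rule always_eventually, rule allI)
        fix m
        have "norm (rpoch u q (3 * m + 2)) \<le> R ^ (3 * m + 2) * M3"
          using norm_rpoch_le[of u R "3 * m + 2"] M3(2)[of "3 * m + 2"] R
          by (meson mult_left_mono order_trans zero_le_power less_imp_le)
        then have "norm (a ^ (m + 1) * rpoch u q (3 * m + 2)) \<le> norm a ^ (m + 1) * (R ^ (3 * m + 2) * M3)"
          unfolding norm_mult norm_power by (intro mult_left_mono) auto
        also have "\<dots> = norm a * R ^ 2 * M3 * (norm a * R ^ 3) ^ m"
          unfolding power_add power_mult power_mult_distrib by (simp add: mult_ac)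
        finally show "norm (a ^ (m + 1) * rpoch u q (3 * m + 2)) \<le> norm a * R ^ 2 * M3 * (norm a * R ^ 3) ^ m" .
      qed
      show "(\<lambda>m. norm a * R ^ 2 * M3 * (norm a * R ^ 3) ^ m) \<longlonglongrightarrow> 0"
        using R by (intro tendsto_mult_right_zero LIMSEQ_power_zero) auto
    qed
    from tendsto_minus[OF tendsto_mult[OF tendsto_mult[OF l1 l3] l2]] show ?thesis
      unfolding U_def by (simp add: mult_ac)
  qed
  have "(\<lambda>m. \<Sum>n<Suc m. ?D n) \<longlonglongrightarrow> 0"
    using U0 unfolding vwp6_telescope[OF assms(1)] U_def .
  then have "?D sums 0"
    unfolding sums_def by (rule LIMSEQ_imp_Suc)
  moreover have "?D sums ((1 - a * u^3) * (\<Sum>n. vwp6 a q n u)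
     - (1 - a * u^2) * (1 - a * q * u^2) * (\<Sum>n. vwp6 a q n (q * u)))"
    by (intro sums_diff sums_mult summable_sums vwp6_summable vwp6_convergent_mult_q assms)
  ultimately show ?thesis
    using sums_unique2 by fastforce
qed

lemma vwp6_iterate:
  assumes "q \<noteq> 0" "vwp6_convergent u"
  shows "qpoch (a * u^3) (q^3) N * (\<Sum>n. vwp6 a q n u)
    = qpoch (a * u^2) q (2 * N) * (\<Sum>n. vwp6 a q n (q ^ N * u))"
  using assms(2)
proof (induction N arbitrary: u)
  case (Suc N)
  have "qpoch (a * u^3) (q^3) (Suc N) * (\<Sum>n. vwp6 a q n u)
    = qpoch (a * (q * u)^3) (q^3) N * ((1 - a * u^3) * (\<Sum>n. vwp6 a q n u))"
    by (simp add: qpoch_Suc_left power_mult_distrib mult_ac)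
  also have "\<dots> = (1 - a * u^2) * (1 - a * q * u^2) * (qpoch (a * (q * u)^3) (q^3) N * (\<Sum>n. vwp6 a q n (q * u)))"
    unfolding vwp6_step[OF assms(1) Suc.prems] by simp
  also have "\<dots> = (1 - a * u^2) * (1 - a * q * u^2) * (qpoch (a * (q * u)^2) q (2 * N) * (\<Sum>n. vwp6 a q n (q ^ N * (q * u))))"
    unfolding Suc.IH[OF vwp6_convergent_mult_q[OF Suc.prems]] ..
  also have "\<dots> = qpoch (a * u^2) q (2 * Suc N) * (\<Sum>n. vwp6 a q n (q ^ Suc N * u))"
    by (simp add: qpoch_Suc_left power_mult_distrib power2_eq_square mult_ac)
  finally show ?case .
qed simp

text \<open>
  Iterating \<open>vwp6_step\<close> expresses the sum at \<open>u\<close> by its value at \<open>0\<close>, where it is continuous. That value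
  is found by reading the same formula at \<open>u = 1\<close>, since there only the term \<open>n = 0\<close> is left.
\<close>
theorem vwp6_sums:
  assumes "q \<noteq> 0" "qpoch_inf a q \<noteq> 0" "vwp6_convergent u"
  shows "(\<lambda>n. vwp6 a q n u) sums
    (qpoch_inf (a * q^3) (q^3) * qpoch_inf (a * u^2) q / qpoch_inf (a * u^3) (q^3))"
proof -
  define F where "F u = (\<Sum>n. vwp6 a q n u)" for u
  have p: "norm (q^3) < 1" by (rule norm_cube_lt_1[OF q])
  have "norm a * norm (0::complex) ^ 3 < 1" by simp
  then obtain R where R: "R > 0" "norm a * R ^ 3 < 1" by (rule exists_radius)
  have "continuous_on (cball 0 R) F"
    unfolding F_def
    by (rule uniform_limit_theorem[OF _ vwp6_uniform(1)[OF R]]) (auto intro!: continuous_intros always_eventually)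
  then have F0: "isCont F 0"
    using R continuous_on_interior[of "cball 0 R" F 0] by simp
  have lim: "qpoch_inf (v * v * v * a) (q^3) * F v = qpoch_inf (a * v^2) q * F 0" if v: "vwp6_convergent v" for v
  proof (rule LIMSEQ_unique)
    show "(\<lambda>N. qpoch (a * v^3) (q^3) N * F v) \<longlonglongrightarrow> qpoch_inf (v * v * v * a) (q^3) * F v"
      using tendsto_mult_right[OF qpoch_tendsto[OF p, of "a * v ^ 3"], of "F v"]
      by (simp add: power3_eq_cube mult_ac)
    have "(\<lambda>N. q ^ N * v) \<longlonglongrightarrow> 0 * v"
      using q by (intro tendsto_intros LIMSEQ_power_zero) auto
    then have "(\<lambda>N. F (q ^ N * v)) \<longlonglongrightarrow> F 0"
      using F0 isCont_tendsto_compose[of 0 F] by simp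
    moreover have "(\<lambda>N. qpoch (a * v^2) q (2 * N)) \<longlonglongrightarrow> qpoch_inf (a * v^2) q"
      using LIMSEQ_subseq_LIMSEQ[OF qpoch_tendsto[OF q], of "\<lambda>N. 2 * N"]
      by (simp add: o_def strict_mono_def)
    ultimately show "(\<lambda>N. qpoch (a * v^3) (q^3) N * F v) \<longlonglongrightarrow> qpoch_inf (a * v^2) q * F 0"
      unfolding F_def vwp6_iterate[OF assms(1) v] by (intro tendsto_mult)
  qed
  have "(\<lambda>n. vwp6 a q n 1) sums (\<Sum>n\<in>{0}. vwp6 a q n 1)"
  proof (rule sums_finite)
    fix n :: nat assume "n \<notin> {0}"
    then show "vwp6 a q n 1 = 0"
      using rpoch_power_eq_0[of 0 "3 * n" q] by (simp add: vwp6_def)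
  qed simp
  then have "F 1 = vwp6 a q 0 1" unfolding F_def by (simp add: sums_iff)
  also have "\<dots> = qpoch_inf (a * q) q" using a1 by (simp add: vwp6_def)
  finally have F1: "F 1 = qpoch_inf (a * q) q" .
  have "vwp6_convergent 1" unfolding vwp6_convergent_def by (intro disjI2 exI[of _ 0]) simp
  from lim[OF this] have "qpoch_inf a (q^3) * qpoch_inf (a * q) q = qpoch_inf a q * F 0"
    by (simp add: F1)
  then have "(1 - a) * qpoch_inf (a * q) q * qpoch_inf (a * q^3) (q^3) = (1 - a) * qpoch_inf (a * q) q * F 0"
    using qpoch_inf_Suc[OF p, of a] qpoch_inf_Suc[OF q, of a] by (simp add: mult_ac)
  moreover have "(1 - a) * qpoch_inf (a * q) q \<noteq> 0"
    using assms(2) qpoch_inf_Suc[OF q, of a] by simp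
  ultimately have F0e: "F 0 = qpoch_inf (a * q^3) (q^3)"
    by (metis mult_left_cancel)
  have nz: "qpoch_inf (a * u^3) (q^3) \<noteq> 0"
  proof (cases "norm a * norm u ^ 3 < 1")
    case True
    then show ?thesis by (intro qpoch_inf_small_nz[OF p]) (simp add: norm_mult norm_power)
  next
    case False
    with assms(3) obtain k where k: "u = q ^ k" by (auto simp: vwp6_convergent_def)
    have "a * u^3 * (q^3) ^ j = a * q ^ (3 * k + 3 * j)" for j
      by (simp add: k power_add power_mult [symmetric] mult_ac)
    then show ?thesis
      using qpoch_inf_nz[OF q assms(2)] unfolding qpoch_inf_eq_0_iff[OF p] by metis
  qed
  have "F u = qpoch_inf (a * q^3) (q^3) * qpoch_inf (a * u^2) q / qpoch_inf (a * u^3) (q^3)"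
    using lim[OF assms(3)] nz by (simp add: F0e field_simps power3_eq_cube)
  then show ?thesis
    using vwp6_summable[OF assms(3)] unfolding F_def by (simp add: sums_iff)
qed

end

section \<open>Simple poles in an annulus and mean values on circles\<close>

text \<open>
  The principal parts are subtracted one pole at a time. Stating simplicity of the poles as a limit, with \<open>c p = 0\<close>
  allowed, also covers removable singularities.
\<close>
lemma remove_simple_poles:
  fixes f :: "complex \<Rightarrow> complex"
  assumes "finite P" "open U" "P \<subseteq> U" "f holomorphic_on U - P"
    and "\<And>p. p \<in> P \<Longrightarrow> ((\<lambda>t. (t - p) * f t) \<longlongrightarrow> c p) (at p)"
  shows "\<exists>g. g holomorphic_on U \<and> (\<forall>t\<in>U - P. f t = g t + (\<Sum>p\<in>P. c p / (t - p)))"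
  using assms
proof (induction P arbitrary: f)
  case empty
  then show ?case by auto
next
  case (insert p P)
  define V where "V = U - P"
  have V: "open V" "p \<in> V" using insert by (auto simp: V_def open_Diff finite_imp_closed)
  define h where "h t = (if t = p then c p else (t - p) * f t)" for t
  have "h holomorphic_on V"
  proof (rule no_isolated_singularity'[where K = "{p}"])
    have "((\<lambda>t. (t - p) * f t) \<longlongrightarrow> c p) (at p)" using insert.prems by auto
    then have "(h \<longlongrightarrow> c p) (at p)"
      by (rule Lim_transform_eventually) (auto simp: h_def eventually_at_filter)
    then show "(h \<longlongrightarrow> h z) (at z within V)" if "z \<in> {p}" for z
      using that by (auto simp: h_def intro: tendsto_within_subset)
    have "(\<lambda>t. (t - p) * f t) holomorphic_on V - {p}"
      using insert.prems by (intro holomorphic_intros) (auto simp: V_def elim: holomorphic_on_subset)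
    then show "h holomorphic_on V - {p}"
      by (rule holomorphic_transform) (auto simp: h_def)
  qed (use V in auto)
  from pole_lemma_open[OF this V(1), of p]
  have hol: "(\<lambda>t. if t = p then deriv h p else (h t - h p) / (t - p)) holomorphic_on V" .
  define g where "g t = (if t = p then deriv h p else (h t - h p) / (t - p))" for t
  have g_eq: "g t = f t - c p / (t - p)" if "t \<noteq> p" for t
    using that by (simp add: g_def h_def divide_simps)
  have "\<exists>k. k holomorphic_on U \<and> (\<forall>t\<in>U - P. g t = k t + (\<Sum>p\<in>P. c p / (t - p)))"
  proof (rule insert.IH)
    show "g holomorphic_on U - P" using hol by (simp add: g_def[abs_def] V_def)
    fix p' assume p': "p' \<in> P"
    then have ne: "p' \<noteq> p" using insert by auto
    have "((\<lambda>t. (t - p') * f t - (t - p') * (c p / (t - p))) \<longlongrightarrow> c p' - (p' - p') * (c p / (p' - p))) (at p')"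
      using insert.prems p' ne by (intro tendsto_intros) auto
    moreover have "\<forall>\<^sub>F t in at p'. t \<noteq> p"
      using ne by (simp add: eventually_neq_at_within)
    then have "\<forall>\<^sub>F t in at p'. (t - p') * f t - (t - p') * (c p / (t - p)) = (t - p') * g t"
      by eventually_elim (simp add: g_eq algebra_simps)
    ultimately show "((\<lambda>t. (t - p') * g t) \<longlongrightarrow> c p') (at p')"
      by (simp add: Lim_transform_eventually)
  qed (use insert in auto)
  then obtain k where k: "k holomorphic_on U" "\<And>t. t \<in> U - P \<Longrightarrow> g t = k t + (\<Sum>p\<in>P. c p / (t - p))"
    by blast
  show ?case
  proof (intro exI[of _ k] conjI ballI k(1))
    fix t assume t: "t \<in> U - insert p P"
    then have "f t = g t + c p / (t - p)" using g_eq[of t] by simp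
    with k(2)[of t] t insert show "f t = k t + (\<Sum>p\<in>insert p P. c p / (t - p))" by simp
  qed
qed

text \<open>
  The radial homotopy between the two circles stays inside the annulus.
\<close>
lemma contour_integral_annulus_holomorphic:
  assumes "0 < r1" "r1 \<le> r2" "open U" "{t. r1 \<le> norm t \<and> norm t \<le> r2} \<subseteq> U" "g holomorphic_on U"
  shows "contour_integral (circlepath 0 r1) g = contour_integral (circlepath 0 r2) g"
proof (rule Cauchy_theorem_homotopic_loops)
  show "homotopic_loops U (circlepath 0 r1) (circlepath 0 r2)"
  proof (rule homotopic_loops_linear)
    fix t :: real
    show "closed_segment (circlepath 0 r1 t) (circlepath 0 r2 t) \<subseteq> U"
    proof
      fix w assume "w \<in> closed_segment (circlepath 0 r1 t) (circlepath 0 r2 t)"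
      then obtain s where s: "0 \<le> s" "s \<le> 1" "w = (1 - s) *\<^sub>R circlepath 0 r1 t + s *\<^sub>R circlepath 0 r2 t"
        by (auto simp: closed_segment_def)
      then have "w = of_real ((1 - s) * r1 + s * r2) * exp (2 * of_real pi * \<i> * of_real t)"
        by (simp add: circlepath scaleR_conv_of_real algebra_simps)
      then have "norm w = \<bar>(1 - s) * r1 + s * r2\<bar>"
        by (simp add: norm_mult norm_exp_eq_Re del: of_real_add of_real_mult)
      moreover have "(1 - s) * r1 + s * r2 = r1 + s * (r2 - r1)" by (simp add: algebra_simps)
      moreover have "0 \<le> s * (r2 - r1)" "s * (r2 - r1) \<le> 1 * (r2 - r1)"
        using s assms mult_right_mono[of s 1 "r2 - r1"] by auto
      ultimately have "r1 \<le> norm w \<and> norm w \<le> r2" using assms by auto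
      with assms show "w \<in> U" by auto
    qed
  qed auto
qed (use assms in auto)

text \<open>
  After the principal parts are removed, the holomorphic rest has equal integrals over both circles, and \<open>1 / (t - p)\<close>
  contributes only on the outer one.
\<close>
lemma contour_integral_annulus:
  assumes r: "0 < r1" "r1 < r2" and "open V" "f holomorphic_on V"
    and P: "finite P" "P \<subseteq> {t. r1 < norm t \<and> norm t < r2}"
    and sub: "{t. r1 \<le> norm t \<and> norm t \<le> r2} \<subseteq> V \<union> P"
    and lim: "\<And>p. p \<in> P \<Longrightarrow> ((\<lambda>t. (t - p) * f t) \<longlongrightarrow> c p) (at p)"
  shows "contour_integral (circlepath 0 r2) f - contour_integral (circlepath 0 r1) f = 2 * pi * \<i> * (\<Sum>p\<in>P. c p)"
proof -
  define A where "A = {t::complex. r1 < norm t \<and> norm t < r2}"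
  define U where "U = V \<union> A"
  have "open A" unfolding A_def by (intro open_Collect_conj open_Collect_less continuous_intros)
  then have U: "open U" "P \<subseteq> U" using assms by (auto simp: U_def A_def)
  have "A \<subseteq> V \<union> P" using sub by (force simp: A_def)
  then have "f holomorphic_on U - P"
    by (intro holomorphic_on_subset[OF \<open>f holomorphic_on V\<close>]) (auto simp: U_def)
  from remove_simple_poles[OF P(1) U this lim]
  obtain g where g: "g holomorphic_on U" "\<And>t. t \<in> U - P \<Longrightarrow> f t = g t + (\<Sum>p\<in>P. c p / (t - p))"
    by blast
  have on_circle: "contour_integral (circlepath 0 r) f = contour_integral (circlepath 0 r) g
      + (\<Sum>p\<in>P. c p * contour_integral (circlepath 0 r) (\<lambda>t. 1 / (t - p)))"
    if rr: "r = r1 \<or> r = r2" for r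
  proof -
    have r0: "r > 0" using rr r by auto
    have sp: "sphere 0 r \<subseteq> U - P" using sub P rr r by (force simp: U_def)
    have ne: "t \<noteq> p" if "t \<in> sphere 0 r" "p \<in> P" for t p using that sp by auto
    have i1: "(\<lambda>t. 1 / (t - p)) contour_integrable_on circlepath 0 r" if "p \<in> P" for p
      by (rule contour_integrable_continuous_circlepath)
         (use ne[OF _ that] r0 in \<open>auto intro!: continuous_intros\<close>)
    have i2: "g contour_integrable_on circlepath 0 r"
      by (rule contour_integrable_continuous_circlepath)
         (use sp r0 in \<open>auto intro!: holomorphic_on_imp_continuous_on holomorphic_on_subset[OF g(1)]\<close>)
    have "contour_integral (circlepath 0 r) f = contour_integral (circlepath 0 r) (\<lambda>t. g t + (\<Sum>p\<in>P. c p * (1 / (t - p))))"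
      using g(2) sp r0 by (intro contour_integral_cong) auto
    also have "\<dots> = contour_integral (circlepath 0 r) g + contour_integral (circlepath 0 r) (\<lambda>t. \<Sum>p\<in>P. c p * (1 / (t - p)))"
      using i1 i2 P by (intro contour_integral_add contour_integrable_sum contour_integrable_lmul) auto
    also have "contour_integral (circlepath 0 r) (\<lambda>t. \<Sum>p\<in>P. c p * (1 / (t - p)))
        = (\<Sum>p\<in>P. contour_integral (circlepath 0 r) (\<lambda>t. c p * (1 / (t - p))))"
      using i1 P by (intro contour_integral_sum contour_integrable_lmul) auto
    also have "\<dots> = (\<Sum>p\<in>P. c p * contour_integral (circlepath 0 r) (\<lambda>t. 1 / (t - p)))"
      using i1 by (intro sum.cong refl contour_integral_lmul) auto
    finally show ?thesis .
  qed
  have "contour_integral (circlepath 0 r1) g = contour_integral (circlepath 0 r2) g"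
    using r sub P by (intro contour_integral_annulus_holomorphic[OF _ _ U(1) _ g(1)]) (force simp: U_def A_def)+
  moreover have "contour_integral (circlepath 0 r2) (\<lambda>t. 1 / (t - p)) = 2 * pi * \<i>" if "p \<in> P" for p
  proof -
    have "((\<lambda>t. 1 / (t - p)) has_contour_integral 2 * pi * \<i> * 1) (circlepath 0 r2)"
      using Cauchy_integral_circlepath_simple[of "\<lambda>_. 1" 0 r2 p] that P by auto
    then show ?thesis by (simp add: contour_integral_unique)
  qed
  moreover have "contour_integral (circlepath 0 r1) (\<lambda>t. 1 / (t - p)) = 0" if "p \<in> P" for p
  proof -
    have "((\<lambda>t. 1 / (t - p)) has_contour_integral 0) (circlepath 0 r1)"
      using that P r by (intro Cauchy_theorem_convex_simple[of _ "ball 0 (norm p)"] holomorphic_intros)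
        (auto simp: path_image_circlepath)
    then show ?thesis by (simp add: contour_integral_unique)
  qed
  ultimately show ?thesis
    by (simp add: on_circle[of r1] on_circle[of r2] sum_distrib_left sum_distrib_right mult_ac)
qed

text \<open>
  Integrating against \<open>dt / t\<close> makes the mean invariant under scaling of the variable, which is what \<open>q\<close>-difference equations need.
\<close>
definition circle_mean :: "real \<Rightarrow> (complex \<Rightarrow> complex) \<Rightarrow> complex" where
  "circle_mean r g = contour_integral (circlepath 0 r) (\<lambda>t. g t / t) / (2 * pi * \<i>)"

lemma circle_mean_integrable:
  assumes "r > 0" "continuous_on (sphere 0 r) g"
  shows "(\<lambda>t. g t / t) contour_integrable_on circlepath 0 r"
  by (rule contour_integrable_continuous_circlepath) (use assms in \<open>auto intro!: continuous_intros\<close>)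

lemma circle_mean_cong:
  assumes "r > 0" "\<And>t. norm t = r \<Longrightarrow> f t = g t"
  shows "circle_mean r f = circle_mean r g"
  unfolding circle_mean_def using assms by (intro arg_cong[of _ _ "\<lambda>x. x / _"] contour_integral_cong) auto

lemma circle_mean_diff:
  assumes "r > 0" "continuous_on (sphere 0 r) f" "continuous_on (sphere 0 r) g"
  shows "circle_mean r (\<lambda>t. f t - g t) = circle_mean r f - circle_mean r g"
  unfolding circle_mean_def using contour_integral_diff[OF circle_mean_integrable[OF assms(1,2)] circle_mean_integrable[OF assms(1,3)]]
  by (simp add: diff_divide_distrib)

lemma circle_mean_cmult:
  assumes "r > 0" "continuous_on (sphere 0 r) g"
  shows "circle_mean r (\<lambda>t. c * g t) = c * circle_mean r g"
  unfolding circle_mean_def using contour_integral_lmul[OF circle_mean_integrable[OF assms], of c]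
  by simp

lemma norm_circle_mean_le:
  assumes "r > 0" "continuous_on (sphere 0 r) g" "\<And>t. norm t = r \<Longrightarrow> norm (g t) \<le> C"
  shows "norm (circle_mean r g) \<le> C"
proof -
  have "norm (g (of_real r)) \<le> C" using assms by auto
  then have "C \<ge> 0" using norm_ge_zero order_trans by blast
  have "norm (contour_integral (circlepath 0 r) (\<lambda>t. g t / t)) \<le> (C / r) * (2 * pi * r)"
  proof (rule has_contour_integral_bound_circlepath)
    show "((\<lambda>t. g t / t) has_contour_integral contour_integral (circlepath 0 r) (\<lambda>t. g t / t)) (circlepath 0 r)"
      using circle_mean_integrable[OF assms(1,2)] by (rule has_contour_integral_integral)
  qed (use assms \<open>C \<ge> 0\<close> in \<open>auto simp: norm_divide divide_right_mono\<close>)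
  then show ?thesis using assms(1) by (simp add: circle_mean_def norm_divide norm_mult field_simps)
qed

lemma circle_mean_uniform_limit:
  assumes "r > 0" "\<And>n. continuous_on (sphere 0 r) (g n)" "uniform_limit (sphere 0 r) g l sequentially"
  shows "(\<lambda>n. circle_mean r (g n)) \<longlonglongrightarrow> circle_mean r l"
proof -
  have "uniform_limit (sphere 0 r) (\<lambda>n t. g n t / t) (\<lambda>t. l t / t) sequentially"
  proof (rule uniform_limitI)
    fix e :: real assume "e > 0"
    then have "\<forall>\<^sub>F n in sequentially. \<forall>t\<in>sphere 0 r. dist (g n t) (l t) < e * r"
      using assms by (intro uniform_limitD[OF assms(3)]) auto
    then show "\<forall>\<^sub>F n in sequentially. \<forall>t\<in>sphere 0 r. dist (g n t / t) (l t / t) < e"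
      by eventually_elim
         (use \<open>r > 0\<close> in \<open>auto simp: dist_norm norm_divide field_simps simp flip: diff_divide_distrib\<close>)
  qed
  from contour_integral_uniform_limit_circlepath(2)[OF _ this]
  have "(\<lambda>n. contour_integral (circlepath 0 r) (\<lambda>t. g n t / t)) \<longlonglongrightarrow> contour_integral (circlepath 0 r) (\<lambda>t. l t / t)"
    using assms circle_mean_integrable[OF assms(1) assms(2)] by simp
  then show ?thesis unfolding circle_mean_def by (intro tendsto_intros) auto
qed

lemma circle_mean_scale:
  assumes "r > 0" "q \<noteq> 0" "continuous_on (sphere 0 (r * norm q)) u"
  shows "circle_mean r (\<lambda>t. u (q * t)) = circle_mean (r * norm q) u"
proof -
  define \<gamma> where "\<gamma> = circlepath 0 (r * norm q)"
  define a where "a = Arg2pi q / (2 * pi)"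
  have a: "a \<in> {0..1}"
    using Arg2pi_ge_0[of q] Arg2pi_lt_2pi[of q] by (auto simp: a_def)
  have qe: "q = of_real (norm q) * exp (2 * of_real pi * \<i> * of_real a)"
    using Arg2pi_eq[of q] by (simp add: a_def mult_ac)
  have circle_mean_eq: "q * circlepath 0 r t = \<gamma> (a + t)" for t
    by (subst qe) (simp add: \<gamma>_def circlepath exp_add [symmetric] algebra_simps)
  have per: "\<gamma> (t - 1) = \<gamma> t" for t
    by (simp add: \<gamma>_def circlepath algebra_simps exp_diff)
  have sh: "shiftpath a \<gamma> = (\<lambda>t. q * circlepath 0 r t)"
    unfolding shiftpath_def using per circle_mean_eq by (auto simp: fun_eq_iff)
  have "contour_integral (circlepath 0 r) (\<lambda>t. u (q * t) / t)
      = contour_integral (circlepath 0 r) (\<lambda>t. deriv (\<lambda>t. q * t) t * (u (q * t) / (q * t)))"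
    using assms by (intro contour_integral_cong) auto
  also have "\<dots> = contour_integral ((\<lambda>t. q * t) \<circ> circlepath 0 r) (\<lambda>t. u t / t)"
    by (rule contour_integral_comp_analyticW[of _ UNIV, symmetric]) (auto intro!: analytic_intros)
  also have "\<dots> = contour_integral (shiftpath a \<gamma>) (\<lambda>t. u t / t)"
    by (simp add: sh o_def)
  also have "\<dots> = contour_integral \<gamma> (\<lambda>t. u t / t)"
    by (rule contour_integral_shiftpath) (use a in \<open>auto simp: \<gamma>_def\<close>)
  finally show ?thesis by (simp add: circle_mean_def \<gamma>_def)
qed

section \<open>Residues along geometric progressions\<close>

text \<open>
  The residue of \<open>N(t) / \<Prod>\<^bsub>Y \<in> B\<^esub> (Y / t; q)\<^sub>\<infinity>\<close> with respect to \<open>dt / t\<close> at \<open>t = X q\<^sup>k\<close>. The factor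
  \<open>(X / t)\<^sub>\<infinity>\<close> contributes \<open>1 - X q\<^sup>k / t\<close>, which cancels against \<open>dt / t\<close>, the factors \<open>(q\<^bsup>-k\<^esup>; q)\<^sub>k\<close> with smaller index,
  and \<open>(q; q)\<^sub>\<infinity>\<close> with larger index.
\<close>
definition pole_term :: "complex \<Rightarrow> (complex \<Rightarrow> complex) \<Rightarrow> complex set \<Rightarrow> complex \<Rightarrow> nat \<Rightarrow> complex" where
  "pole_term q N B X k = N (X * q ^ k) /
     (qpoch_inf q q * qpoch (1 / q ^ k) q k * (\<Prod>Y\<in>B - {X}. qpoch_inf (Y / (X * q ^ k)) q))"

definition pole_quotient :: "complex \<Rightarrow> (complex \<Rightarrow> complex) \<Rightarrow> complex set \<Rightarrow> complex \<Rightarrow> complex" where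
  "pole_quotient q N B t = N t / (\<Prod>X\<in>B. qpoch_inf (X / t) q)"

text \<open>
  The indices of the finitely many poles that a circle of radius \<open>r\<close> around the origin leaves outside.
\<close>
definition big_poles :: "complex \<Rightarrow> complex set \<Rightarrow> real \<Rightarrow> (complex \<times> nat) set" where
  "big_poles q B r = {(X, k). X \<in> B \<and> norm (X * q ^ k) > r}"

text \<open>
  The progressions \<open>X q\<^sup>k\<close> are pairwise disjoint, hence all poles are simple.
\<close>
definition separated :: "complex \<Rightarrow> complex set \<Rightarrow> bool" where
  "separated q B \<longleftrightarrow> finite B \<and> 0 \<notin> B \<and> (\<forall>X\<in>B. \<forall>Y\<in>B. X \<noteq> Y \<longrightarrow> (\<forall>k l. X * q ^ k \<noteq> Y * q ^ l))"

locale nome =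
  fixes q :: complex
  assumes q: "norm q < 1" and q0: "q \<noteq> 0"
begin

lemma power_q_eq_iff: "q ^ k = q ^ l \<longleftrightarrow> k = l"
proof
  assume "q ^ k = q ^ l"
  then have "norm q ^ k = norm q ^ l" by (metis norm_power)
  then show "k = l" using q q0 power_inject_exp'[of "norm q" k l] by simp
qed simp

lemma qpoch_inverse_power_nz: "qpoch (1 / q ^ k) q k \<noteq> 0"
proof
  assume "qpoch (1 / q ^ k) q k = 0"
  then obtain j where "j < k" "q ^ j = q ^ k" using q0 by (auto simp: qpoch_eq_0_iff field_simps)
  then show False by (simp add: power_q_eq_iff)
qed

lemma separated_qpoch_nz:
  assumes "separated q B" "X \<in> B" "Y \<in> B" "X \<noteq> Y"
  shows "qpoch_inf (Y / (X * q ^ k)) q \<noteq> 0"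
proof -
  have "Y * q ^ j \<noteq> X * q ^ k" for j using assms by (metis separated_def)
  moreover have "X \<noteq> 0" using assms by (auto simp: separated_def)
  ultimately show ?thesis using q0 by (simp add: qpoch_inf_eq_0_iff[OF q] field_simps)
qed

lemma qpoch_inf_inner_nz_iff:
  assumes "t \<noteq> 0"
  shows "qpoch_inf (X / t) q = 0 \<longleftrightarrow> (\<exists>k. t = X * q ^ k)"
  using assms by (auto simp: qpoch_inf_eq_0_iff[OF q] field_simps)

lemma pole_term_limit:
  assumes B: "separated q B" and X: "X \<in> B" and N: "isCont N (X * q ^ k)"
  shows "((\<lambda>t. (t - X * q ^ k) * (pole_quotient q N B t / t)) \<longlongrightarrow> pole_term q N B X k) (at (X * q ^ k))"
proof -
  define p where "p = X * q ^ k"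
  have X0: "X \<noteq> 0" and fin: "finite B" using B X by (auto simp: separated_def)
  have p0: "p \<noteq> 0" using X0 q0 by (simp add: p_def)
  define h where "h t = N t / (qpoch (X / t) q k * qpoch_inf (X * q ^ Suc k / t) q * (\<Prod>Y\<in>B-{X}. qpoch_inf (Y / t) q))" for t
  have Xp: "X / p = 1 / q ^ k" "X * q ^ Suc k / p = q" using X0 q0 by (simp_all add: p_def)
  have hp: "h p = pole_term q N B X k"
    unfolding h_def Xp unfolding pole_term_def p_def by (simp add: mult_ac)
  have nz: "qpoch (X / p) q k * qpoch_inf (X * q ^ Suc k / p) q * (\<Prod>Y\<in>B-{X}. qpoch_inf (Y / p) q) \<noteq> 0"
    unfolding Xp using qpoch_inf_q_nz[OF q] qpoch_inverse_power_nz fin separated_qpoch_nz[OF B X]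
    by (auto simp: p_def)
  have "(h \<longlongrightarrow> h p) (at p)"
    unfolding h_def qpoch_def
    using N nz p0 by (intro tendsto_intros q) (auto simp: isCont_def p_def qpoch_def)
  moreover have "\<forall>\<^sub>F t in at p. h t = (t - p) * (pole_quotient q N B t / t)"
  proof -
    have "\<forall>\<^sub>F t in at p. t \<noteq> p" by (rule eventually_neq_at_within)
    moreover have "\<forall>\<^sub>F t in at p. t \<noteq> 0" by (rule eventually_neq_at_within)
    ultimately show ?thesis
    proof eventually_elim
      case (elim t)
      have "qpoch_inf (X / t) q = qpoch (X / t) q k * ((1 - p / t) * qpoch_inf (X * q ^ Suc k / t) q)"
        using qpoch_inf_split[OF q, of "X / t" k] qpoch_inf_Suc[OF q, of "X * q ^ k / t"]
        by (simp add: p_def mult_ac)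
      also have "1 - p / t = (t - p) / t" using elim by (simp add: field_simps)
      finally have "(\<Prod>Y\<in>B. qpoch_inf (Y / t) q) = (t - p) / t * (qpoch (X / t) q k * qpoch_inf (X * q ^ Suc k / t) q * (\<Prod>Y\<in>B-{X}. qpoch_inf (Y / t) q))"
        using fin X by (simp add: prod.remove mult_ac)
      then show ?case using elim by (simp add: h_def pole_quotient_def)
    qed
  qed
  ultimately show ?thesis unfolding hp by (simp add: Lim_transform_eventually p_def)
qed

lemma pole_term_Suc:
  assumes B: "separated q B" and X: "X \<in> B" and N: "N (X * q ^ Suc k) = \<nu> * N (X * q ^ k)"
  shows "pole_term q N B X (Suc k) * (\<Prod>Y\<in>B. 1 - Y / (X * q ^ Suc k)) = \<nu> * pole_term q N B X k"
proof -
  have X0: "X \<noteq> 0" and fin: "finite B" using B X by (auto simp: separated_def)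
  define a where "a = 1 - 1 / q ^ Suc k"
  define b where "b = (\<Prod>Y\<in>B-{X}. 1 - Y / (X * q ^ Suc k))"
  define R where "R = (\<Prod>Y\<in>B-{X}. qpoch_inf (Y / (X * q ^ k)) q)"
  have 1: "(\<Prod>Y\<in>B. 1 - Y / (X * q ^ Suc k)) = a * b"
    using fin X X0 by (simp add: prod.remove a_def b_def)
  have s: "qpoch_inf (Y / (X * q ^ Suc k)) q = (1 - Y / (X * q ^ Suc k)) * qpoch_inf (Y / (X * q ^ k)) q" for Y
    using qpoch_inf_Suc[OF q, of "Y / (X * q ^ Suc k)"] q0 X0 by (simp add: field_simps)
  have 2: "(\<Prod>Y\<in>B-{X}. qpoch_inf (Y / (X * q ^ Suc k)) q) = b * R"
    unfolding s b_def R_def by (rule prod.distrib)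
  have 3: "qpoch (1 / q ^ Suc k) q (Suc k) = a * qpoch (1 / q ^ k) q k"
    unfolding qpoch_Suc_left a_def using q0 by simp
  have "a \<noteq> 0" using power_q_eq_iff[of "Suc k" 0] q0 by (auto simp: a_def field_simps)
  moreover have "b * R \<noteq> 0"
    unfolding 2 [symmetric] using fin separated_qpoch_nz[OF B X, where k = "Suc k"]
    by (auto simp del: power_Suc)
  ultimately show ?thesis
    unfolding pole_term_def 1 2 3 N R_def [symmetric] by simp
qed

lemma separated_diff_nz:
  assumes "separated q B" "X \<in> B" "Y \<in> B"
  shows "1 - Y / (X * q ^ Suc k) \<noteq> 0"
proof -
  have X0: "X \<noteq> 0" using assms by (auto simp: separated_def)
  have "Y * q ^ 0 \<noteq> X * q ^ Suc k"
  proof (cases "Y = X")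
    case True
    then show ?thesis using power_q_eq_iff[of 0 "Suc k"] X0 by (metis mult_left_cancel nat.distinct(1))
  next
    case False
    then show ?thesis using assms unfolding separated_def by blast
  qed
  then show ?thesis using X0 q0 by (auto simp: field_simps)
qed

text \<open>
  The factor \<open>\<Prod>\<^bsub>Y \<in> B\<^esub> (1 - Y / (q t))\<close> is the change of the denominator under \<open>t \<mapsto> q t\<close>. So the condition says that near the
  origin the quotient \<open>g = N / \<Prod>\<^bsub>Y \<in> B\<^esub> (Y / t)\<^sub>\<infinity>\<close> satisfies \<open>g(q t) = \<rho>(t) g(t)\<close>, where \<open>\<rho>\<close> has a limit of modulus less
  than \<open>1\<close>. The residues then decay geometrically, and so do the means over circles shrinking by the factor \<open>|q|\<close>.
\<close>
definition contracting :: "(complex \<Rightarrow> complex) \<Rightarrow> complex set \<Rightarrow> (complex \<Rightarrow> complex) \<Rightarrow> bool" where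
  "contracting N B \<rho> \<longleftrightarrow> (\<exists>\<delta>>0. \<forall>t. 0 < norm t \<and> norm t < \<delta> \<longrightarrow>
      N (q * t) = \<rho> t * (\<Prod>Y\<in>B. 1 - Y / (q * t)) * N t) \<and> (\<exists>l. (\<rho> \<longlongrightarrow> l) (at 0) \<and> norm l < 1)"

lemma contractingE:
  assumes "contracting N B \<rho>"
  obtains \<delta> l where "\<delta> > 0" "l < 1" "l \<ge> 0"
    "\<And>t. 0 < norm t \<Longrightarrow> norm t < \<delta> \<Longrightarrow> N (q * t) = \<rho> t * (\<Prod>Y\<in>B. 1 - Y / (q * t)) * N t"
    "\<And>t. 0 < norm t \<Longrightarrow> norm t < \<delta> \<Longrightarrow> norm (\<rho> t) \<le> l"
proof -
  from assms obtain \<delta> l where *: "\<delta> > 0" "(\<rho> \<longlongrightarrow> l) (at 0)" "norm l < 1"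
    "\<And>t. 0 < norm t \<Longrightarrow> norm t < \<delta> \<Longrightarrow> N (q * t) = \<rho> t * (\<Prod>Y\<in>B. 1 - Y / (q * t)) * N t"
    unfolding contracting_def by blast
  obtain l' where l': "norm l < l'" "l' < 1" using dense *(3) by blast
  have "\<forall>\<^sub>F t in at 0. norm (\<rho> t) < l'"
    using order_tendstoD(2)[OF tendsto_norm[OF *(2)] l'(1)] .
  then obtain d where "d > 0" "\<And>t. t \<noteq> 0 \<Longrightarrow> norm t < d \<Longrightarrow> norm (\<rho> t) < l'"
    by (auto simp: eventually_at)
  moreover have "l' \<ge> 0" using l'(1) norm_ge_zero[of l] by linarith
  ultimately show thesis using l' *
    by (intro that[of "min \<delta> d" l']) (auto simp: less_imp_le)
qed

lemma pole_term_summable: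
  assumes B: "separated q B" and X: "X \<in> B" and "contracting N B \<rho>"
  shows "summable (pole_term q N B X)"
proof -
  obtain \<delta> l where d: "\<delta> > 0" "l < 1" "l \<ge> 0"
    "\<And>t. 0 < norm t \<Longrightarrow> norm t < \<delta> \<Longrightarrow> N (q * t) = \<rho> t * (\<Prod>Y\<in>B. 1 - Y / (q * t)) * N t"
    "\<And>t. 0 < norm t \<Longrightarrow> norm t < \<delta> \<Longrightarrow> norm (\<rho> t) \<le> l"
    using contractingE[OF assms(3)] by blast
  have X0: "X \<noteq> 0" using B X by (auto simp: separated_def)
  have "(\<lambda>k. norm (X * q ^ k)) \<longlonglongrightarrow> norm (X * 0)"
    using q by (intro tendsto_intros LIMSEQ_power_zero) auto
  then have "\<forall>\<^sub>F k in sequentially. norm (X * q ^ k) < \<delta>"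
    using d(1) by (intro order_tendstoD) auto
  then obtain K where K: "\<And>k. k \<ge> K \<Longrightarrow> norm (X * q ^ k) < \<delta>"
    by (auto simp: eventually_sequentially)
  show ?thesis
  proof (rule summable_ratio_test[OF d(2)])
    fix k assume k: "k \<ge> K"
    let ?t = "X * q ^ k"
    have t: "0 < norm ?t" "norm ?t < \<delta>" using K[OF k] X0 q0 by auto
    have "N (X * q ^ Suc k) = (\<rho> ?t * (\<Prod>Y\<in>B. 1 - Y / (X * q ^ Suc k))) * N ?t"
      using d(4)[OF t] by (simp add: mult_ac)
    from pole_term_Suc[OF B X this]
    have "pole_term q N B X (Suc k) * (\<Prod>Y\<in>B. 1 - Y / (X * q ^ Suc k))
        = (\<rho> ?t * pole_term q N B X k) * (\<Prod>Y\<in>B. 1 - Y / (X * q ^ Suc k))" by (simp only: mult_ac)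
    moreover have "(\<Prod>Y\<in>B. 1 - Y / (X * q ^ Suc k)) \<noteq> 0"
      using separated_diff_nz[OF B X] B by (auto simp: separated_def)
    ultimately have "pole_term q N B X (Suc k) = \<rho> ?t * pole_term q N B X k"
      by (metis mult_right_cancel)
    then show "norm (pole_term q N B X (Suc k)) \<le> l * norm (pole_term q N B X k)"
      using d(5)[OF t] by (simp add: norm_mult mult_right_mono)
  qed
qed

lemma big_poles_finite:
  assumes B: "finite B" and r: "r > 0"
  shows "finite (big_poles q B r)"
proof -
  have "finite {k. norm (X * q ^ k) > r}" for X
  proof -
    have "(\<lambda>k. norm (X * q ^ k)) \<longlonglongrightarrow> norm (X * 0)"
      using q by (intro tendsto_intros LIMSEQ_power_zero) auto
    then have "\<forall>\<^sub>F k in sequentially. norm (X * q ^ k) < r"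
      using r by (intro order_tendstoD) auto
    then obtain K where K: "\<And>k. k \<ge> K \<Longrightarrow> norm (X * q ^ k) < r"
      by (auto simp: eventually_sequentially)
    have "k < K" if "norm (X * q ^ k) > r" for k
      using K[of k] that by (cases "k \<ge> K") auto
    then have "{k. norm (X * q ^ k) > r} \<subseteq> {..<K}" by auto
    then show ?thesis by (rule finite_subset) simp
  qed
  moreover have "big_poles q B r = Sigma B (\<lambda>X. {k. norm (X * q ^ k) > r})"
    by (auto simp: big_poles_def)
  ultimately show ?thesis using B by simp
qed

text \<open>
  For each base, the poles outside a circle form an initial segment of the progression, whose length grows as the circle shrinks.
\<close>
lemma big_poles_sum_tendsto:
  fixes f :: "complex \<Rightarrow> nat \<Rightarrow> complex"
  assumes B: "finite B" "0 \<notin> B" and r: "r > 0" and f: "\<And>X. X \<in> B \<Longrightarrow> summable (f X)"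
  shows "(\<lambda>J. \<Sum>(X,k)\<in>big_poles q B (r * norm q ^ J). f X k) \<longlonglongrightarrow> (\<Sum>X\<in>B. \<Sum>k. f X k)"
proof -
  have 1: "(\<lambda>J. \<Sum>k | norm (X * q ^ k) > r * norm q ^ J. f X k) \<longlonglongrightarrow> (\<Sum>k. f X k)" if X: "X \<in> B" for X
  proof -
    have X0: "X \<noteq> 0" using B X by auto
    define m where "m J = card {k. norm (X * q ^ k) > r * norm q ^ J}" for J
    have fin: "finite {k. norm (X * q ^ k) > r * norm q ^ J}" for J
    proof -
      have "finite (big_poles q {X} (r * norm q ^ J))" using r q0 by (intro big_poles_finite) auto
      then have "finite (snd ` big_poles q {X} (r * norm q ^ J))" by simp
      moreover have "snd ` big_poles q {X} (r * norm q ^ J) = {k. norm (X * q ^ k) > r * norm q ^ J}"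
        by (auto simp: big_poles_def image_iff)
      ultimately show ?thesis by simp
    qed
    have eq: "{k. norm (X * q ^ k) > r * norm q ^ J} = {..<m J}" for J
    proof -
      define A where "A = {k. norm (X * q ^ k) > r * norm q ^ J}"
      have down: "j \<in> A" if "k \<in> A" "j \<le> k" for j k
      proof -
        have "norm q ^ k \<le> norm q ^ j" using q that by (intro power_decreasing) auto
        then have "norm (X * q ^ k) \<le> norm (X * q ^ j)" by (simp add: norm_mult norm_power mult_left_mono)
        then show ?thesis using that by (auto simp: A_def)
      qed
      define n where "n = (LEAST k. k \<notin> A)"
      have "\<exists>k. k \<notin> A" using fin[of J] unfolding A_def [symmetric] by (metis ex_new_if_finite infinite_UNIV_nat)
      then have "n \<notin> A" unfolding n_def by (rule LeastI_ex)
      have "A = {..<n}"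
      proof (intro equalityI subsetI)
        fix x assume "x \<in> A" then show "x \<in> {..<n}" using down[of x n] \<open>n \<notin> A\<close> by force
      next
        fix x assume "x \<in> {..<n}" then show "x \<in> A" using not_less_Least[of x "\<lambda>k. k \<notin> A"] by (auto simp: n_def)
      qed
      then show ?thesis by (simp add: m_def A_def)
    qed
    have "filterlim m at_top sequentially"
      unfolding filterlim_at_top
    proof
      fix K
      have "(\<lambda>J. r * norm q ^ J) \<longlonglongrightarrow> r * 0"
        using q by (intro tendsto_intros LIMSEQ_power_zero) auto
      then have "\<forall>\<^sub>F J in sequentially. r * norm q ^ J < norm (X * q ^ K)"
        using X0 q0 by (intro order_tendstoD) auto
      then show "\<forall>\<^sub>F J in sequentially. K \<le> m J"
      proof eventually_elim
        case (elim J)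
        then have "K \<in> {..<m J}" using eq[of J] by auto
        then show ?case by simp
      qed
    qed
    from filterlim_compose[OF summable_LIMSEQ[OF f[OF X]] this]
    show ?thesis unfolding eq .
  qed
  have "(\<Sum>(X,k)\<in>big_poles q B (r * norm q ^ J). f X k) = (\<Sum>X\<in>B. \<Sum>k | norm (X * q ^ k) > r * norm q ^ J. f X k)" for J
  proof -
    have "finite (big_poles q B (r * norm q ^ J))" using r q0 B by (intro big_poles_finite) auto
    have sg: "big_poles q B (r * norm q ^ J) = Sigma B (\<lambda>X. {k. norm (X * q ^ k) > r * norm q ^ J})"
      by (auto simp: big_poles_def)
    have "finite {k. norm (X * q ^ k) > r * norm q ^ J}" if "X \<in> B" for X
    proof -
      have "{k. norm (X * q ^ k) > r * norm q ^ J} \<subseteq> snd ` big_poles q B (r * norm q ^ J)"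
        using that by (force simp: big_poles_def)
      then show ?thesis using \<open>finite (big_poles q B (r * norm q ^ J))\<close> finite_surj by blast
    qed
    then show ?thesis unfolding sg using B by (subst sum.Sigma) auto
  qed
  then show ?thesis using 1 by (simp add: tendsto_sum)
qed

lemma open_regular:
  assumes "open D" "finite B"
  shows "open {t \<in> D. t \<noteq> 0 \<and> (\<Prod>X\<in>B. qpoch_inf (X / t) q) \<noteq> 0}"
proof -
  have "open (D - {0})" using assms by (simp add: open_Diff)
  moreover have "continuous_on (D - {0}) (\<lambda>t. \<Prod>X\<in>B. qpoch_inf (X / t) q)"
    by (intro continuous_intros q) auto
  ultimately have "open ((D - {0}) \<inter> (\<lambda>t. \<Prod>X\<in>B. qpoch_inf (X / t) q) -` (- {0}))"
    by (intro continuous_open_preimage) auto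
  moreover have "(D - {0}) \<inter> (\<lambda>t. \<Prod>X\<in>B. qpoch_inf (X / t) q) -` (- {0})
      = {t \<in> D. t \<noteq> 0 \<and> (\<Prod>X\<in>B. qpoch_inf (X / t) q) \<noteq> 0}"
    by blast
  ultimately show ?thesis by simp
qed

lemma pole_quotient_holomorphic:
  assumes "N holomorphic_on D"
  shows "(pole_quotient q N B) holomorphic_on {t \<in> D. t \<noteq> 0 \<and> (\<Prod>X\<in>B. qpoch_inf (X / t) q) \<noteq> 0}"
  unfolding pole_quotient_def
  by (intro holomorphic_intros q holomorphic_on_subset[OF assms]) auto

text \<open>
  The residue theorem for the annulus. The points of \<open>Q\<close> are further simple poles, those of the numerator
  \<open>N\<close> itself.
\<close>
lemma circle_mean_diff_poles:
  assumes B: "separated q B" and D: "open D" "N holomorphic_on D"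
    and Q: "finite Q" "\<And>p. p \<in> Q \<Longrightarrow> ((\<lambda>t. (t - p) * N t) \<longlongrightarrow> n p) (at p)"
    and r: "0 < r1" "r1 < r2" and sub: "{t. r1 \<le> norm t \<and> norm t \<le> r2} \<subseteq> D \<union> Q"
    and Qr: "\<And>p. p \<in> Q \<Longrightarrow> r1 < norm p \<and> norm p < r2"
    and QB: "\<And>p X k. p \<in> Q \<Longrightarrow> X \<in> B \<Longrightarrow> p \<noteq> X * q ^ k"
    and rad: "\<And>X k. X \<in> B \<Longrightarrow> norm (X * q ^ k) \<noteq> r1 \<and> norm (X * q ^ k) \<noteq> r2"
  shows "circle_mean r2 (pole_quotient q N B) - circle_mean r1 (pole_quotient q N B) =
     (\<Sum>(X,k)\<in>big_poles q B r1 - big_poles q B r2. pole_term q N B X k)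
     + (\<Sum>p\<in>Q. n p / (p * (\<Prod>X\<in>B. qpoch_inf (X / p) q)))"
proof -
  have fin: "finite B" using B by (auto simp: separated_def)
  define V where "V = {t \<in> D. t \<noteq> 0 \<and> (\<Prod>X\<in>B. qpoch_inf (X / t) q) \<noteq> 0}"
  define E where "E = big_poles q B r1 - big_poles q B r2"
  define \<phi> where "\<phi> = (\<lambda>(X, k). X * q ^ k :: complex)"
  have E: "(X, k) \<in> E \<longleftrightarrow> X \<in> B \<and> r1 < norm (X * q ^ k) \<and> norm (X * q ^ k) < r2" for X k
    using rad[of X k] by (auto simp: E_def big_poles_def)
  have finE: "finite E" unfolding E_def using big_poles_finite[OF fin r(1)] by simp
  have inj: "inj_on \<phi> E"
  proof (rule inj_onI, clarify)
    fix X k Y l assume a: "(X, k) \<in> E" "(Y, l) \<in> E" "\<phi> (X, k) = \<phi> (Y, l)"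
    then have XY: "X \<in> B" "Y \<in> B" "X * q ^ k = Y * q ^ l" using E by (auto simp: \<phi>_def)
    then have "X = Y" using B unfolding separated_def by blast
    moreover have "X \<noteq> 0" using XY B by (auto simp: separated_def)
    ultimately show "X = Y \<and> k = l" using XY power_q_eq_iff by auto
  qed
  define c where "c p = (if p \<in> Q then n p / (p * (\<Prod>X\<in>B. qpoch_inf (X / p) q))
      else case inv_into E \<phi> p of (X, k) \<Rightarrow> pole_term q N B X k)" for p
  have disj: "Q \<inter> \<phi> ` E = {}" using QB E by (force simp: \<phi>_def)
  have c_pole: "c (X * q ^ k) = pole_term q N B X k" if "(X, k) \<in> E" for X k
  proof -
    have "inv_into E \<phi> (\<phi> (X, k)) = (X, k)" using inj that by (rule inv_into_f_f)
    moreover have "X * q ^ k \<notin> Q" using disj that by (force simp: \<phi>_def)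
    ultimately show ?thesis by (simp add: c_def \<phi>_def)
  qed
  have "contour_integral (circlepath 0 r2) (\<lambda>t. pole_quotient q N B t / t) - contour_integral (circlepath 0 r1) (\<lambda>t. pole_quotient q N B t / t)
      = 2 * pi * \<i> * (\<Sum>p\<in>Q \<union> \<phi> ` E. c p)"
  proof (rule contour_integral_annulus)
    show "open V" unfolding V_def by (rule open_regular[OF D(1) fin])
    show "(\<lambda>t. pole_quotient q N B t / t) holomorphic_on V"
      using pole_quotient_holomorphic[OF D(2), of B] by (intro holomorphic_intros) (auto simp: V_def)
    show "finite (Q \<union> \<phi> ` E)" using Q finE by simp
    show "Q \<union> \<phi> ` E \<subseteq> {t. r1 < norm t \<and> norm t < r2}" using Qr E by (auto simp: \<phi>_def)
    show "{t. r1 \<le> norm t \<and> norm t \<le> r2} \<subseteq> V \<union> (Q \<union> \<phi> ` E)"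
    proof
      fix t :: complex assume t: "t \<in> {t. r1 \<le> norm t \<and> norm t \<le> r2}"
      then have t0: "t \<noteq> 0" using r by auto
      show "t \<in> V \<union> (Q \<union> \<phi> ` E)"
      proof (cases "t \<in> Q \<or> t \<in> V")
        case False
        then have "t \<in> D" using t sub by auto
        with False t0 obtain X where "X \<in> B" "qpoch_inf (X / t) q = 0" using fin by (auto simp: V_def)
        then obtain k where k: "X \<in> B" "t = X * q ^ k" using qpoch_inf_inner_nz_iff[OF t0] by auto
        then have "(X, k) \<in> E" using t rad[of X k] by (auto simp: E)
        then show ?thesis using k by (force simp: \<phi>_def)
      qed auto
    qed
    fix p assume p: "p \<in> Q \<union> \<phi> ` E"
    show "((\<lambda>t. (t - p) * (pole_quotient q N B t / t)) \<longlongrightarrow> c p) (at p)"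
    proof (cases "p \<in> Q")
      case True
      then have p0: "p \<noteq> 0" using Qr[OF True] r by auto
      have nz: "(\<Prod>X\<in>B. qpoch_inf (X / p) q) \<noteq> 0"
        using QB[OF True] fin qpoch_inf_inner_nz_iff[OF p0] by auto
      have "((\<lambda>t. ((t - p) * N t) / (t * (\<Prod>X\<in>B. qpoch_inf (X / t) q))) \<longlongrightarrow> n p / (p * (\<Prod>X\<in>B. qpoch_inf (X / p) q))) (at p)"
        using p0 nz by (intro tendsto_intros q Q(2) True) auto
      then show ?thesis using True by (simp add: c_def pole_quotient_def mult_ac)
    next
      case False
      then obtain X k where k: "(X, k) \<in> E" "p = X * q ^ k" using p by (auto simp: \<phi>_def)
      then have "p \<in> {t. r1 \<le> norm t \<and> norm t \<le> r2}" using E[of X k] by auto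
      then have "p \<in> D" using False sub by blast
      then have "isCont N p"
        using D holomorphic_on_imp_continuous_on continuous_on_eq_continuous_at by blast
      then show ?thesis using pole_term_limit[OF B, where X = X and N = N and k = k] k E[of X k] c_pole[OF k(1)] by simp
    qed
  qed (use r in auto)
  moreover have "(\<Sum>p\<in>Q \<union> \<phi> ` E. c p) = (\<Sum>p\<in>Q. c p) + (\<Sum>p\<in>\<phi> ` E. c p)"
    using disj Q finE by (intro sum.union_disjoint) auto
  moreover have "(\<Sum>p\<in>Q. c p) = (\<Sum>p\<in>Q. n p / (p * (\<Prod>X\<in>B. qpoch_inf (X / p) q)))"
    by (intro sum.cong) (auto simp: c_def)
  moreover have "(\<Sum>p\<in>\<phi> ` E. c p) = (\<Sum>(X,k)\<in>E. pole_term q N B X k)"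
    unfolding sum.reindex[OF inj] by (intro sum.cong) (auto simp: \<phi>_def c_pole)
  ultimately show ?thesis
    unfolding circle_mean_def E_def [symmetric] by (simp add: diff_divide_distrib [symmetric])
qed

lemma pole_quotient_continuous_sphere:
  assumes D: "open D" "N holomorphic_on D" and "finite B" and r: "r > 0" "sphere 0 r \<subseteq> D"
    and rad: "\<And>X k. X \<in> B \<Longrightarrow> norm (X * q ^ k) \<noteq> r"
  shows "continuous_on (sphere 0 r) (pole_quotient q N B)"
proof (rule holomorphic_on_imp_continuous_on, rule holomorphic_on_subset[OF pole_quotient_holomorphic[OF D(2), of B]], rule subsetI)
  fix t :: complex assume t: "t \<in> sphere 0 r"
  then have t0: "t \<noteq> 0" using r by auto
  have "qpoch_inf (X / t) q \<noteq> 0" if "X \<in> B" for X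
    using rad[OF that] t by (auto simp: qpoch_inf_inner_nz_iff[OF t0])
  then show "t \<in> {t \<in> D. t \<noteq> 0 \<and> (\<Prod>X\<in>B. qpoch_inf (X / t) q) \<noteq> 0}"
    using t t0 r \<open>finite B\<close> by auto
qed

text \<open>
  On the circle of radius \<open>r |q|\<^bsup>J+1\<^esup>\<close> the quotient is obtained from its values on the preceding circle by
  multiplication with \<open>\<rho>\<close>, hence its maximum decays geometrically.
\<close>
lemma circle_mean_tendsto_0:
  assumes B: "separated q B" and D: "open D" "N holomorphic_on D" "finite Q"
    and r: "0 < r" and sub: "{t. 0 < norm t \<and> norm t \<le> r} \<subseteq> D \<union> Q"
    and Qr: "0 \<notin> Q"
    and rad: "\<And>X k J. X \<in> B \<Longrightarrow> norm (X * q ^ k) \<noteq> r * norm q ^ J"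
    and ratio: "contracting N B \<rho>"
  shows "(\<lambda>J. circle_mean (r * norm q ^ J) (pole_quotient q N B)) \<longlonglongrightarrow> 0"
proof -
  have fin: "finite B" using B by (auto simp: separated_def)
  obtain \<delta> l where d: "\<delta> > 0" "l < 1" "l \<ge> 0"
    "\<And>t. 0 < norm t \<Longrightarrow> norm t < \<delta> \<Longrightarrow> N (q * t) = \<rho> t * (\<Prod>Y\<in>B. 1 - Y / (q * t)) * N t"
    "\<And>t. 0 < norm t \<Longrightarrow> norm t < \<delta> \<Longrightarrow> norm (\<rho> t) \<le> l"
    using contractingE[OF ratio] by blast
  let ?r = "\<lambda>J. r * norm q ^ J"
  have r0: "?r J > 0" for J using r q0 by simp
  have rl: "?r \<longlonglongrightarrow> r * 0" using q by (intro tendsto_intros LIMSEQ_power_zero) auto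
  have "\<forall>\<^sub>F J in sequentially. ?r J < \<delta>" using rl d(1) by (intro order_tendstoD) auto
  moreover have "\<forall>\<^sub>F J in sequentially. \<forall>p\<in>Q. ?r J < norm p"
    using rl Qr by (intro eventually_ball_finite \<open>finite Q\<close> ballI order_tendstoD(2)[OF rl]) auto
  ultimately have "\<forall>\<^sub>F J in sequentially. ?r J < \<delta> \<and> (\<forall>p\<in>Q. ?r J < norm p)"
    by eventually_elim auto
  then obtain J0 where J0: "\<And>J. J \<ge> J0 \<Longrightarrow> ?r J < \<delta> \<and> (\<forall>p\<in>Q. ?r J < norm p)"
    by (auto simp: eventually_sequentially)
  have rle: "?r J \<le> r" for J
  proof -
    have "norm q ^ J \<le> 1" using q by (intro power_le_one) auto
    then have "r * norm q ^ J \<le> r * 1" using r by (intro mult_left_mono) auto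
    then show ?thesis by simp
  qed
  have sphD: "sphere 0 (?r J) \<subseteq> D" if "J \<ge> J0" for J
  proof
    fix t :: complex assume "t \<in> sphere 0 (?r J)"
    then have nt: "norm t = ?r J" by simp
    then have "t \<in> {t. 0 < norm t \<and> norm t \<le> r}"
      using r0[of J] rle[of J] unfolding nt [symmetric] by simp
    moreover have "t \<notin> Q" using J0[OF that] nt by force
    ultimately show "t \<in> D" using sub by blast
  qed
  have cont: "continuous_on (sphere 0 (?r J)) (pole_quotient q N B)" if "J \<ge> J0" for J
    using rad by (intro pole_quotient_continuous_sphere[OF D(1,2) fin r0 sphD[OF that]]) auto
  have "compact (pole_quotient q N B ` sphere 0 (?r J0))"
    by (intro compact_continuous_image cont) auto
  from compact_imp_bounded[OF this]
  obtain C where "\<forall>x\<in>pole_quotient q N B ` sphere 0 (?r J0). norm x \<le> C" unfolding bounded_iff by blast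
  then have C: "norm (pole_quotient q N B t) \<le> C" if "norm t = ?r J0" for t
    using that by auto
  have bound: "norm (pole_quotient q N B t) \<le> C * l ^ i" if "norm t = ?r (J0 + i)" for i t
    using that
  proof (induction i arbitrary: t)
    case 0
    then show ?case using C by simp
  next
    case (Suc i)
    define s where "s = t / q"
    have t: "t = q * s" using q0 by (simp add: s_def)
    have ns: "norm s = ?r (J0 + i)" using Suc.prems q0 by (simp add: s_def norm_divide)
    then have s: "0 < norm s" "norm s < \<delta>" using r0[of "J0 + i"] J0[of "J0 + i"] by auto
    then have s0: "s \<noteq> 0" by auto
    have ne: "1 - Y / (q * s) \<noteq> 0" if "Y \<in> B" for Y
    proof
      assume "1 - Y / (q * s) = 0"
      then have "Y * q ^ 0 = t" using t s0 q0 by (simp add: field_simps)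
      then show False using rad[OF that, of 0 "Suc (J0 + i)"] Suc.prems by simp
    qed
    have "(\<Prod>Y\<in>B. qpoch_inf (Y / t) q) = (\<Prod>Y\<in>B. 1 - Y / (q * s)) * (\<Prod>Y\<in>B. qpoch_inf (Y / s) q)"
      unfolding prod.distrib [symmetric] t using qpoch_inf_Suc[OF q, of "_ / (q * s)"] q0
      by (intro prod.cong) auto
    moreover have "N t = \<rho> s * (\<Prod>Y\<in>B. 1 - Y / (q * s)) * N s" unfolding t using d(4)[OF s] .
    moreover have "(\<Prod>Y\<in>B. 1 - Y / (q * s)) \<noteq> 0" using fin ne by auto
    ultimately have "pole_quotient q N B t = \<rho> s * pole_quotient q N B s" by (simp add: pole_quotient_def)
    then have "norm (pole_quotient q N B t) = norm (\<rho> s) * norm (pole_quotient q N B s)"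
      by (simp add: norm_mult)
    also have "\<dots> \<le> l * (C * l ^ i)"
      using d(3) d(5)[OF s] Suc.IH[OF ns] by (intro mult_mono) auto
    finally have "norm (pole_quotient q N B t) \<le> l * (C * l ^ i)" .
    then show ?case by (simp add: mult_ac)
  qed
  have "(\<lambda>i. circle_mean (?r (i + J0)) (pole_quotient q N B)) \<longlonglongrightarrow> 0"
  proof (rule Lim_null_comparison)
    show "\<forall>\<^sub>F i in sequentially. norm (circle_mean (?r (i + J0)) (pole_quotient q N B)) \<le> C * l ^ i"
      using bound by (intro always_eventually allI norm_circle_mean_le cont r0) (auto simp: add.commute)
    show "(\<lambda>i. C * l ^ i) \<longlonglongrightarrow> 0"
      using d by (intro tendsto_mult_right_zero LIMSEQ_power_zero) auto
  qed
  then show ?thesis by (rule LIMSEQ_offset)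
qed

text \<open>
  The circle is shrunk to the origin by powers of \<open>|q|\<close>: in the limit the annulus contains all the poles inside the
  original circle, while the mean over the inner circle vanishes.
\<close>
theorem inner_pole_sum:
  assumes B: "separated q B" and D: "open D" "N holomorphic_on D"
    and Q: "finite Q" "\<And>p. p \<in> Q \<Longrightarrow> ((\<lambda>t. (t - p) * N t) \<longlongrightarrow> n p) (at p)"
    and r: "0 < r" and sub: "{t. 0 < norm t \<and> norm t \<le> r} \<subseteq> D \<union> Q"
    and Qr: "\<And>p. p \<in> Q \<Longrightarrow> 0 < norm p \<and> norm p < r"
    and QB: "\<And>p X k. p \<in> Q \<Longrightarrow> X \<in> B \<Longrightarrow> p \<noteq> X * q ^ k"
    and rad: "\<And>X k J. X \<in> B \<Longrightarrow> norm (X * q ^ k) \<noteq> r * norm q ^ J"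
    and ratio: "contracting N B \<rho>"
  shows "(\<Sum>X\<in>B. \<Sum>k. pole_term q N B X k) = circle_mean r (pole_quotient q N B)
     + (\<Sum>(X,k)\<in>big_poles q B r. pole_term q N B X k)
     - (\<Sum>p\<in>Q. n p / (p * (\<Prod>X\<in>B. qpoch_inf (X / p) q)))"
proof -
  have fin: "finite B" "0 \<notin> B" using B by (auto simp: separated_def)
  let ?r = "\<lambda>J. r * norm q ^ J"
  let ?S = "\<lambda>J. \<Sum>(X,k)\<in>big_poles q B (?r J). pole_term q N B X k"
  have r0: "?r J > 0" for J using r q0 by simp
  have rl: "?r \<longlonglongrightarrow> r * 0" using q by (intro tendsto_intros LIMSEQ_power_zero) auto
  have "\<forall>\<^sub>F J in sequentially. \<forall>p\<in>Q. ?r J < norm p"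
    using Qr by (intro eventually_ball_finite \<open>finite Q\<close> ballI order_tendstoD(2)[OF rl]) auto
  moreover have "\<forall>\<^sub>F J in sequentially. ?r J < r"
    using r by (intro order_tendstoD(2)[OF rl]) auto
  ultimately have "\<forall>\<^sub>F J in sequentially. ?S J = circle_mean r (pole_quotient q N B) - circle_mean (?r J) (pole_quotient q N B)
      + (\<Sum>(X,k)\<in>big_poles q B r. pole_term q N B X k)
      - (\<Sum>p\<in>Q. n p / (p * (\<Prod>X\<in>B. qpoch_inf (X / p) q)))"
  proof eventually_elim
    case (elim J)
    have "big_poles q B r \<subseteq> big_poles q B (?r J)" using elim by (auto simp: big_poles_def)
    then have "?S J = (\<Sum>(X,k)\<in>big_poles q B (?r J) - big_poles q B r. pole_term q N B X k)
        + (\<Sum>(X,k)\<in>big_poles q B r. pole_term q N B X k)"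
      using big_poles_finite[OF fin(1) r0[of J]] by (intro sum.subset_diff)
    moreover have "circle_mean r (pole_quotient q N B) - circle_mean (?r J) (pole_quotient q N B) =
       (\<Sum>(X,k)\<in>big_poles q B (?r J) - big_poles q B r. pole_term q N B X k)
       + (\<Sum>p\<in>Q. n p / (p * (\<Prod>X\<in>B. qpoch_inf (X / p) q)))"
    proof (rule circle_mean_diff_poles[OF B D Q r0])
      show "{t. ?r J \<le> norm t \<and> norm t \<le> r} \<subseteq> D \<union> Q"
      proof
        fix t :: complex assume t: "t \<in> {t. ?r J \<le> norm t \<and> norm t \<le> r}"
        have "0 < norm t" using t r0[of J] by auto
        then show "t \<in> D \<union> Q" using sub t by blast
      qed
      show "norm (X * q ^ k) \<noteq> ?r J \<and> norm (X * q ^ k) \<noteq> r" if "X \<in> B" for X k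
        using rad[OF that, of k J] rad[OF that, of k 0] by simp
    qed (use elim Qr QB in auto)
    ultimately show ?case by simp
  qed
  moreover have "?S \<longlonglongrightarrow> (\<Sum>X\<in>B. \<Sum>k. pole_term q N B X k)"
    by (intro big_poles_sum_tendsto fin r pole_term_summable[OF B _ ratio])
  ultimately have 1: "(\<lambda>J. circle_mean r (pole_quotient q N B) - circle_mean (?r J) (pole_quotient q N B)
      + (\<Sum>(X,k)\<in>big_poles q B r. pole_term q N B X k)
      - (\<Sum>p\<in>Q. n p / (p * (\<Prod>X\<in>B. qpoch_inf (X / p) q)))) \<longlonglongrightarrow> (\<Sum>X\<in>B. \<Sum>k. pole_term q N B X k)"
    by (rule Lim_transform_eventually[rotated])
  have "(\<lambda>J. circle_mean (?r J) (pole_quotient q N B)) \<longlonglongrightarrow> 0"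
    using Qr by (intro circle_mean_tendsto_0[OF B D Q(1) r sub _ rad ratio]) auto
  from tendsto_diff[OF tendsto_add[OF tendsto_diff[OF tendsto_const this] tendsto_const] tendsto_const]
  have "(\<lambda>J. circle_mean r (pole_quotient q N B) - circle_mean (?r J) (pole_quotient q N B)
      + (\<Sum>(X,k)\<in>big_poles q B r. pole_term q N B X k)
      - (\<Sum>p\<in>Q. n p / (p * (\<Prod>X\<in>B. qpoch_inf (X / p) q)))) \<longlonglongrightarrow> circle_mean r (pole_quotient q N B) - 0
      + (\<Sum>(X,k)\<in>big_poles q B r. pole_term q N B X k)
      - (\<Sum>p\<in>Q. n p / (p * (\<Prod>X\<in>B. qpoch_inf (X / p) q)))"
    .
  from LIMSEQ_unique[OF 1 this] show ?thesis by simp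
qed

corollary inner_pole_sum_no_outer_poles:
  assumes "separated q B" "open D" "N holomorphic_on D"
    and "0 < r" "{t. 0 < norm t \<and> norm t \<le> r} \<subseteq> D"
    and "\<And>X k J. X \<in> B \<Longrightarrow> norm (X * q ^ k) \<noteq> r * norm q ^ J"
    and "contracting N B \<rho>"
  shows "(\<Sum>X\<in>B. \<Sum>k. pole_term q N B X k) = circle_mean r (pole_quotient q N B)
     + (\<Sum>(X,k)\<in>big_poles q B r. pole_term q N B X k)"
proof -
  have "(\<Sum>X\<in>B. \<Sum>k. pole_term q N B X k) = circle_mean r (pole_quotient q N B)
     + (\<Sum>(X,k)\<in>big_poles q B r. pole_term q N B X k)
     - (\<Sum>p\<in>{}. (\<lambda>_. 0) p / (p * (\<Prod>X\<in>B. qpoch_inf (X / p) q)))"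
    by (rule inner_pole_sum[OF assms(1-3) _ _ assms(4) _ _ _ assms(6,7)]) (use assms(5) in auto)
  then show ?thesis by simp
qed

text \<open>
  If \<open>g(t) = u(q t) - u(t)\<close>, the residues telescope along each progression, but the residues of \<open>u\<close> may have nonzero limits
  there. These limits never appear: by invariance under scaling, the mean of \<open>g\<close> over the circle of radius \<open>r\<close> is minus the sum of the residues of
  \<open>u\<close> between the radii \<open>r |q|\<close> and \<open>r\<close>, which cancels the last terms of the finite telescoping sums over the poles outside the
  circle. Only the first residues remain. The hypothesis \<open>small\<close> puts all of these outside.
\<close>
lemma q_difference_pole_sum:
  assumes B: "separated q B" and D: "open D" "M holomorphic_on D"
    and r: "0 < r" and sub: "{t. 0 < norm t \<and> norm t \<le> r} \<subseteq> D"
    and rad: "\<And>X k J. X \<in> B \<Longrightarrow> norm (X * q ^ k) \<noteq> r * norm q ^ J"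
    and small: "\<And>X. X \<in> B \<Longrightarrow> r < norm X"
    and N: "(\<Sum>X\<in>B. \<Sum>k. f X k) = circle_mean r g + (\<Sum>(X,k)\<in>big_poles q B r. f X k)"
    and diff: "\<And>t. norm t = r \<Longrightarrow> g t = pole_quotient q M B (q * t) - pole_quotient q M B t"
    and pd: "\<And>X k. X \<in> B \<Longrightarrow> f X k = pole_term q M B X (Suc k) - pole_term q M B X k"
  shows "(\<Sum>X\<in>B. \<Sum>k. f X k) = - (\<Sum>X\<in>B. pole_term q M B X 0)"
proof -
  have fin: "finite B" "0 \<notin> B" using B by (auto simp: separated_def)
  let ?u = "pole_quotient q M B" and ?r = "r * norm q"
  have r0: "?r > 0" "?r < r" using r q0 q by auto
  have sph: "sphere 0 s \<subseteq> D" if "0 < s" "s \<le> r" for s :: real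
  proof
    fix t :: complex assume "t \<in> sphere 0 s"
    then have "t \<in> {t. 0 < norm t \<and> norm t \<le> r}" using that by auto
    with sub show "t \<in> D" by blast
  qed
  have c1: "continuous_on (sphere 0 r) ?u"
    using sph[OF r] rad[of _ _ 0] by (intro pole_quotient_continuous_sphere[OF D fin(1) r]) auto
  have c2: "continuous_on (sphere 0 ?r) ?u"
    using sph[OF r0(1) less_imp_le[OF r0(2)]] r0 rad[of _ _ 1] by (intro pole_quotient_continuous_sphere[OF D fin(1)]) auto
  have c3: "continuous_on (sphere 0 r) (\<lambda>t. ?u (q * t))"
    by (rule continuous_on_compose2[OF c2]) (auto intro!: continuous_intros simp: norm_mult)
  have "circle_mean r g = circle_mean r (\<lambda>t. ?u (q * t) - ?u t)" using diff r by (intro circle_mean_cong) auto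
  also have "\<dots> = circle_mean ?r ?u - circle_mean r ?u"
    using circle_mean_diff[OF r c3 c1] circle_mean_scale[OF r q0 c2] by simp
  also have "\<dots> = - (\<Sum>(X,k)\<in>big_poles q B ?r - big_poles q B r. pole_term q M B X k)"
  proof -
    have "circle_mean r ?u - circle_mean ?r ?u = (\<Sum>(X,k)\<in>big_poles q B ?r - big_poles q B r. pole_term q M B X k)
       + (\<Sum>p\<in>{}. (\<lambda>_. 0) p / (p * (\<Prod>X\<in>B. qpoch_inf (X / p) q)))"
    proof (rule circle_mean_diff_poles[OF B D _ _ r0])
      show "{t. ?r \<le> norm t \<and> norm t \<le> r} \<subseteq> D \<union> {}"
      proof
        fix t :: complex assume t: "t \<in> {t. ?r \<le> norm t \<and> norm t \<le> r}"
        have "0 < norm t" using t r0(1) by auto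
        then show "t \<in> D \<union> {}" using sub t by blast
      qed
      show "norm (X * q ^ k) \<noteq> ?r \<and> norm (X * q ^ k) \<noteq> r" if "X \<in> B" for X k
        using rad[OF that, of k 1] rad[OF that, of k 0] by simp
    qed auto
    then show ?thesis by (simp add: algebra_simps)
  qed
  finally have 1: "circle_mean r g = - (\<Sum>(X,k)\<in>big_poles q B ?r - big_poles q B r. pole_term q M B X k)" .
  have "(\<Sum>(X,k)\<in>big_poles q B r. f X k)
      = (\<Sum>(X,k)\<in>big_poles q B r. pole_term q M B X (Suc k)) - (\<Sum>(X,k)\<in>big_poles q B r. pole_term q M B X k)"
    unfolding sum_subtractf [symmetric] by (intro sum.cong) (auto simp: big_poles_def pd)
  also have "(\<Sum>(X,k)\<in>big_poles q B r. pole_term q M B X (Suc k))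
      = (\<Sum>(X,k)\<in>big_poles q B ?r - B \<times> {0}. pole_term q M B X k)"
  proof -
    have iff: "(X, Suc k) \<in> big_poles q B ?r \<longleftrightarrow> (X, k) \<in> big_poles q B r" for X k
    proof -
      have "norm (X * q ^ Suc k) = norm (X * q ^ k) * norm q" by (simp add: norm_mult norm_power)
      then show ?thesis using q0 by (simp add: big_poles_def del: power_Suc)
    qed
    have in_B: "X \<in> B" if "(X, k) \<in> big_poles q B s" for X k s
      using that by (simp add: big_poles_def)
    have "big_poles q B ?r - B \<times> {0} = (\<lambda>(X,k). (X, Suc k)) ` big_poles q B r"
    proof (intro equalityI subsetI)
      fix x assume x: "x \<in> big_poles q B ?r - B \<times> {0}"
      obtain X k where k: "x = (X, k)" by (cases x)
      then have "k \<noteq> 0" using x in_B[of X k ?r] by auto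
      then obtain j where "k = Suc j" by (cases k) auto
      then show "x \<in> (\<lambda>(X,k). (X, Suc k)) ` big_poles q B r"
        using x k iff[of X j] by (intro image_eqI[of _ _ "(X, j)"]) auto
    next
      fix x assume "x \<in> (\<lambda>(X,k). (X, Suc k)) ` big_poles q B r"
      then obtain X j where "x = (X, Suc j)" "(X, j) \<in> big_poles q B r" by auto
      then show "x \<in> big_poles q B ?r - B \<times> {0}" using iff[of X j] by auto
    qed
    moreover have "inj_on (\<lambda>(X,k). (X, Suc k)) (big_poles q B r)" by (auto simp: inj_on_def)
    ultimately show ?thesis by (simp add: sum.reindex case_prod_unfold)
  qed
  also have "\<dots> = (\<Sum>(X,k)\<in>big_poles q B ?r. pole_term q M B X k) - (\<Sum>(X,k)\<in>B \<times> {0}. pole_term q M B X k)"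
    using big_poles_finite[OF fin(1) r0(1)] small r0(2) by (intro sum_diff) (auto simp: big_poles_def intro: less_trans)
  also have "(\<Sum>(X,k)\<in>B \<times> {0}. pole_term q M B X k) = (\<Sum>X\<in>B. pole_term q M B X 0)"
    using fin by (subst sum.Sigma [symmetric]) auto
  also have "(\<Sum>(X,k)\<in>big_poles q B ?r. pole_term q M B X k)
      = (\<Sum>(X,k)\<in>big_poles q B ?r - big_poles q B r. pole_term q M B X k) + (\<Sum>(X,k)\<in>big_poles q B r. pole_term q M B X k)"
    using big_poles_finite[OF fin(1) r0(1)] r0 by (intro sum.subset_diff) (auto simp: big_poles_def)
  finally show ?thesis unfolding N 1 by simp
qed

end

section \<open>The nonterminating \<open>q\<close>-Saalschuetz sum\<close>

text \<open>
  Under \<open>t \<mapsto> q t\<close> the product of the two theta functions is divided by \<open>c q t\<^sup>2\<close>, with no dependence on \<open>h\<close>. This is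
  the reason why \<open>h\<close> remains a free parameter.
\<close>
definition theta_kernel :: "complex \<Rightarrow> complex \<Rightarrow> complex \<Rightarrow> complex \<Rightarrow> complex" where
  "theta_kernel q h c t = theta (h * t) q * theta (h / (c * t)) q / (qpoch_inf t q * qpoch_inf (c * t) q)"

text \<open>
  Divided by \<open>(x / t, y / t, z / t)\<^sub>\<infinity>\<close>, this is the function whose residues make up the nonterminating \<open>q\<close>-Saalschuetz
  sum. The balancing condition is \<open>e = x y z c\<close>.
\<close>
definition saal_num :: "complex \<Rightarrow> complex \<Rightarrow> complex \<Rightarrow> complex \<Rightarrow> complex \<Rightarrow> complex" where
  "saal_num q h c e t = theta (h * t) q * theta (h / (c * t)) q * qpoch_inf (e / t) q
     / (qpoch_inf t q * qpoch_inf (c * t) q)"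

definition saal_sum :: "complex \<Rightarrow> complex \<Rightarrow> complex \<Rightarrow> complex \<Rightarrow> complex \<Rightarrow> complex \<Rightarrow> complex" where
  "saal_sum q h c x y z = (\<Sum>X\<in>{x, y, z}. \<Sum>k. pole_term q (saal_num q h c (x * y * z * c)) {x, y, z} X k)"

definition saal_generic :: "complex \<Rightarrow> complex \<Rightarrow> complex \<Rightarrow> complex \<Rightarrow> complex \<Rightarrow> bool" where
  "saal_generic q c x y z \<longleftrightarrow> separated q {x, y, z} \<and> x \<noteq> y \<and> x \<noteq> z \<and> y \<noteq> z \<and>
     (\<forall>X\<in>{x, y, z}. qpoch_inf X q \<noteq> 0 \<and> qpoch_inf (c * X) q \<noteq> 0)"

lemma pole_term_mult: "pole_term q (\<lambda>t. \<phi> t * N t) B X k = \<phi> (X * q ^ k) * pole_term q N B X k"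
  by (simp add: pole_term_def)

lemma pole_quotient_mult: "pole_quotient q (\<lambda>t. \<phi> t * N t) B t = \<phi> t * pole_quotient q N B t"
  by (simp add: pole_quotient_def)

lemma saal_sum_swap12: "saal_sum q h c x y z = saal_sum q h c y x z"
  unfolding saal_sum_def by (simp add: insert_commute mult_ac)

lemma saal_sum_swap13: "saal_sum q h c x y z = saal_sum q h c z y x"
  unfolding saal_sum_def by (simp add: insert_commute mult_ac)

lemma saal_generic_swap12: "saal_generic q c x y z \<longleftrightarrow> saal_generic q c y x z"
  unfolding saal_generic_def by (auto simp: insert_commute)

lemma saal_generic_swap13: "saal_generic q c x y z \<longleftrightarrow> saal_generic q c z y x"
  unfolding saal_generic_def by (auto simp: insert_commute)

text \<open>
  Only countably many radii are excluded.
\<close>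
lemma exists_generic_radius:
  fixes B :: "complex set"
  assumes "finite B" "a < b" "q \<noteq> 0"
  obtains r where "a < r" "r < b" "\<And>X k J. X \<in> B \<Longrightarrow> norm (X * q ^ k) \<noteq> r * norm q ^ J"
proof -
  define S where "S = (\<lambda>(X, k, J). norm (X * q ^ k) / norm q ^ J) ` (B \<times> (UNIV :: nat set) \<times> (UNIV :: nat set))"
  have "countable S" unfolding S_def using assms(1)
    by (intro countable_image countable_SIGMA) (auto intro: countable_finite)
  then have "uncountable ({a<..<b} - S)"
    using assms(2) uncountable_minus_countable uncountable_open_interval by blast
  then have "{a<..<b} - S \<noteq> {}" by (metis countable_empty)
  then obtain r where "r \<in> {a<..<b} - S" by blast
  then have r: "a < r" "r < b" "r \<notin> S" by auto
  have "norm (X * q ^ k) \<noteq> r * norm q ^ J" if "X \<in> B" for X k J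
  proof
    assume "norm (X * q ^ k) = r * norm q ^ J"
    then have "r = norm (X * q ^ k) / norm q ^ J" using assms(3) by simp
    then have "r \<in> S" unfolding S_def using that by (intro image_eqI[of _ _ "(X, k, J)"]) auto
    with r show False by simp
  qed
  with r that show thesis by blast
qed

context nome
begin

lemma theta_pair_mult_q:
  assumes "h \<noteq> 0" "c \<noteq> 0" "t \<noteq> 0"
  shows "theta (h * (q * t)) q * theta (h / (c * (q * t))) q = theta (h * t) q * theta (h / (c * t)) q / (c * q * t^2)"
proof -
  have 1: "theta (h * (q * t)) q = - theta (h * t) q / (h * t)"
    using theta_mult_q[OF q q0, of "h * t"] assms by (simp add: mult_ac)
  have 2: "theta (h / (c * (q * t))) q = - (h / (c * t) / q) * theta (h / (c * t)) q"
    using theta_div_q[OF q q0, of "h / (c * t)"] assms by (simp add: mult_ac)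
  show ?thesis unfolding 1 2 using assms q0 by (simp add: power2_eq_square)
qed

lemma saal_num_mult_q:
  assumes "h \<noteq> 0" "c \<noteq> 0" "t \<noteq> 0" "qpoch_inf t q \<noteq> 0" "qpoch_inf (c * t) q \<noteq> 0"
  shows "saal_num q h c e (q * t) = (1 - e / (q * t)) * (1 - t) * (1 - c * t) / (c * q * t^2) * saal_num q h c e t"
proof -
  have 1: "qpoch_inf t q = (1 - t) * qpoch_inf (q * t) q" "qpoch_inf (c * t) q = (1 - c * t) * qpoch_inf (c * (q * t)) q"
    using qpoch_inf_Suc[OF q, of t] qpoch_inf_Suc[OF q, of "c * t"] by (simp_all add: mult_ac)
  have 2: "qpoch_inf (e / (q * t)) q = (1 - e / (q * t)) * qpoch_inf (e / t) q"
    using qpoch_inf_Suc[OF q, of "e / (q * t)"] q0 by (simp add: mult_ac)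
  have nz: "1 - t \<noteq> 0" "qpoch_inf (q * t) q \<noteq> 0" "1 - c * t \<noteq> 0" "qpoch_inf (c * (q * t)) q \<noteq> 0"
    using assms 1 by auto
  have "saal_num q h c e (q * t) = (theta (h * (q * t)) q * theta (h / (c * (q * t))) q) * qpoch_inf (e / (q * t)) q
     / (qpoch_inf (q * t) q * qpoch_inf (c * (q * t)) q)"
    by (simp add: saal_num_def)
  also have "\<dots> = (1 - e / (q * t)) * (1 - t) * (1 - c * t) / (c * q * t^2) * saal_num q h c e t"
    unfolding theta_pair_mult_q[OF assms(1-3)] 2 saal_num_def 1 using nz by (simp add: mult_ac)
  finally show ?thesis .
qed

lemma saal_num_split: "saal_num q h c e t = (1 - e / t) * saal_num q h c (q * e) t"
  using qpoch_inf_Suc[OF q, of "e / t"] by (simp add: saal_num_def mult_ac)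

definition regular_dom :: "complex \<Rightarrow> complex set" where
  "regular_dom c = {t. t \<noteq> 0 \<and> qpoch_inf t q \<noteq> 0 \<and> qpoch_inf (c * t) q \<noteq> 0}"

lemma open_regular_dom: "open (regular_dom c)"
proof -
  have "open ((\<lambda>t. t * (qpoch_inf t q * qpoch_inf (c * t) q)) -` (- {0}))"
    by (intro open_vimage continuous_intros q)
  moreover have "(\<lambda>t. t * (qpoch_inf t q * qpoch_inf (c * t) q)) -` (- {0}) = regular_dom c"
    by (auto simp: regular_dom_def)
  ultimately show ?thesis by simp
qed

lemma saal_num_holomorphic:
  assumes "h \<noteq> 0" "c \<noteq> 0"
  shows "saal_num q h c e holomorphic_on regular_dom c"
  unfolding saal_num_def using assms by (intro holomorphic_intros q) (auto simp: regular_dom_def)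

lemma regular_dom_small:
  assumes "t \<noteq> 0" "norm t < 1" "norm (c * t) < 1" shows "t \<in> regular_dom c"
  using assms qpoch_inf_small_nz[OF q] by (simp add: regular_dom_def)

lemma small_in_regular_dom:
  assumes "r < 1" "r * norm c < 1"
  shows "{t. 0 < norm t \<and> norm t \<le> r} \<subseteq> regular_dom c"
proof
  fix t :: complex assume t: "t \<in> {t. 0 < norm t \<and> norm t \<le> r}"
  then have "norm (c * t) \<le> norm c * r" by (simp add: norm_mult mult_left_mono)
  then show "t \<in> regular_dom c" using t assms by (intro regular_dom_small) (auto simp: mult_ac)
qed

lemma prod3: "x \<noteq> y \<Longrightarrow> x \<noteq> z \<Longrightarrow> y \<noteq> z \<Longrightarrow> (\<Prod>X\<in>{x, y, z}. f X) = f x * f y * (f z :: complex)"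
  by (simp add: mult_ac)

lemma saal_num_small_mult_q:
  assumes "h \<noteq> 0" "c \<noteq> 0"
  shows "\<exists>\<delta>>0. \<forall>t. 0 < norm t \<and> norm t < \<delta> \<longrightarrow>
    saal_num q h c e (q * t) = (1 - e / (q * t)) * (1 - t) * (1 - c * t) / (c * q * t^2) * saal_num q h c e t"
proof (intro exI[of _ "min 1 (1 / norm c)"] conjI allI impI)
  show "0 < min 1 (1 / norm c)" using assms by simp
  fix t :: complex assume t: "0 < norm t \<and> norm t < min 1 (1 / norm c)"
  then have "t \<in> regular_dom c" using assms by (intro regular_dom_small) (auto simp: norm_mult field_simps)
  then show "saal_num q h c e (q * t) = (1 - e / (q * t)) * (1 - t) * (1 - c * t) / (c * q * t^2) * saal_num q h c e t"
    using assms by (intro saal_num_mult_q) (auto simp: regular_dom_def)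
qed

text \<open>
  By the balancing condition the limit of \<open>\<rho>\<close> at the origin is \<open>e q / (x y z c) = q\<close>.
\<close>
lemma contracting_saal:
  assumes "h \<noteq> 0" "c \<noteq> 0" "x \<noteq> 0" "y \<noteq> 0" "z \<noteq> 0" "x \<noteq> y" "x \<noteq> z" "y \<noteq> z" "e = x * y * z * c"
  shows "contracting (saal_num q h c e) {x, y, z}
     (\<lambda>t. (t - e / q) * (1 - t) * (1 - c * t) / (c * q * ((t - x / q) * (t - y / q) * (t - z / q))))"
    (is "contracting ?N ?B ?\<rho>")
proof -
  note xyz = assms(3-5)
  obtain \<delta> where d: "\<delta> > 0" "\<And>t. 0 < norm t \<Longrightarrow> norm t < \<delta> \<Longrightarrow>
    ?N (q * t) = (1 - e / (q * t)) * (1 - t) * (1 - c * t) / (c * q * t^2) * ?N t"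
    using saal_num_small_mult_q[OF assms(1,2), of e] by blast
  define \<delta>' where "\<delta>' = min \<delta> (min (norm (x/q)) (min (norm (y/q)) (norm (z/q))))"
  have d': "\<delta>' > 0" using d xyz q0 by (simp add: \<delta>'_def)
  have "?N (q * t) = ?\<rho> t * (\<Prod>Y\<in>?B. 1 - Y / (q * t)) * ?N t" if t: "0 < norm t" "norm t < \<delta>'" for t
  proof -
    have nt: "t \<noteq> 0" "t \<noteq> x / q" "t \<noteq> y / q" "t \<noteq> z / q" using t by (auto simp: \<delta>'_def)
    have e1: "1 - Y / (q * t) = (t - Y / q) / t" for Y using nt q0 by (simp add: field_simps)
    have "?\<rho> t * (\<Prod>Y\<in>?B. 1 - Y / (q * t)) = (1 - e / (q * t)) * (1 - t) * (1 - c * t) / (c * q * t^2)"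
      unfolding prod3[OF assms(6-8)] e1 using nt assms(2) q0 by (simp add: power2_eq_square)
    then show ?thesis using d(2)[of t] t by (simp add: \<delta>'_def)
  qed
  moreover have "(?\<rho> \<longlongrightarrow> (0 - e / q) * (1 - 0) * (1 - c * 0) / (c * q * ((0 - x / q) * (0 - y / q) * (0 - z / q)))) (at 0)"
    using xyz q0 assms(2) by (intro tendsto_intros) auto
  then have "(?\<rho> \<longlongrightarrow> q) (at 0)"
    using xyz q0 assms(2) unfolding assms(9) by (simp add: field_simps)
  ultimately show ?thesis unfolding contracting_def using q d' by blast
qed

text \<open>
  Dividing by \<open>1 - x / t\<close> and dropping the base \<open>x\<close> to \<open>q x\<close> leaves the quotient unchanged, so the two share the multiplier
  \<open>\<rho>\<close>.
\<close>
lemma contracting_saal_shift: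
  assumes "h \<noteq> 0" "c \<noteq> 0" and nz: "x \<noteq> 0" "y \<noteq> 0" "z \<noteq> 0" and ne: "x \<noteq> y" "x \<noteq> z" "y \<noteq> z"
    and ne': "q * x \<noteq> y" "q * x \<noteq> z" and e: "e = x * y * z * c"
  obtains \<rho> where "contracting (saal_num q h c e) {x, y, z} \<rho>"
    "contracting (\<lambda>t. saal_num q h c e t / (1 - x / t)) {q * x, y, z} \<rho>"
proof -
  define B' where "B' = {q * x, y, z}"
  define N where N: "N t = saal_num q h c e t / (1 - x / t)" for t
  have x0: "x \<noteq> 0" by fact
  obtain \<rho> where \<rho>: "contracting (saal_num q h c e) {x, y, z} \<rho>"
    using contracting_saal[OF assms(1,2) nz ne e] by auto
  have "contracting N B' \<rho>"
  proof -
    obtain \<delta> l where d: "\<delta> > 0" "(\<rho> \<longlongrightarrow> l) (at 0)" "norm l < 1"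
      "\<And>t. 0 < norm t \<Longrightarrow> norm t < \<delta> \<Longrightarrow> saal_num q h c e (q * t) = \<rho> t * (\<Prod>Y\<in>{x, y, z}. 1 - Y / (q * t)) * saal_num q h c e t"
      using \<rho> unfolding contracting_def by blast
    have "N (q * t) = \<rho> t * (\<Prod>Y\<in>B'. 1 - Y / (q * t)) * N t" if t: "0 < norm t" "norm t < min \<delta> (norm x)" for t
    proof -
      have nt: "t \<noteq> 0" "t \<noteq> x" "q * t \<noteq> x"
      proof -
        show "t \<noteq> 0" "t \<noteq> x" using t by auto
        have "norm (q * t) \<le> 1 * norm t" unfolding norm_mult using q by (intro mult_right_mono) auto
        then show "q * t \<noteq> x" using t by auto
      qed
      define P where "P = 1 - x / (q * t)"
      have P0: "P \<noteq> 0" using nt q0 by (auto simp: P_def field_simps)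
      have "N (q * t) = \<rho> t * (P * (1 - y / (q * t)) * (1 - z / (q * t))) * saal_num q h c e t / P"
        unfolding N using d(4)[of t] t unfolding prod3[OF ne] by (simp add: P_def)
      also have "\<dots> = \<rho> t * ((1 - x / t) * (1 - y / (q * t)) * (1 - z / (q * t))) * N t"
        unfolding N using P0 nt by simp
      also have "(1 - x / t) * (1 - y / (q * t)) * (1 - z / (q * t)) = (\<Prod>Y\<in>B'. 1 - Y / (q * t))"
        unfolding B'_def prod3[OF ne' ne(3)] using q0 by simp
      finally show ?thesis .
    qed
    moreover have "min \<delta> (norm x) > 0" using d(1) x0 by simp
    ultimately show ?thesis unfolding contracting_def using d(2,3) by blast
  qed
  with \<rho> show thesis by (intro that[of \<rho>]) (simp_all add: N[abs_def] B'_def)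
qed

text \<open>
  Multiplied by \<open>N\<^sub>0(t) / (1 - x / t)\<close>, where \<open>N\<^sub>0\<close> is the numerator for the parameters \<open>q x, y, z\<close>, and divided by
  \<open>(q x / t, y / t, z / t)\<^sub>\<infinity>\<close>, this becomes a contiguous relation between the quotients for \<open>q x, y, z\<close> and for \<open>x, y, z\<close>: the left-hand side
  is then a \<open>q\<close>-difference.
\<close>
lemma saal_key_identity:
  fixes c t x y z :: complex
  assumes "t \<noteq> 0" "c \<noteq> 0" "q \<noteq> 0"
  shows "- (x * c * (q * t)) * ((1 - x * y * z * c / t) * (1 - t) * (1 - c * t) / (c * q * t^2))
       + x * c * t * (1 - x / t) * (1 - y / t) * (1 - z / t)
     = (1 - x * y * c) * (1 - x * z * c) * (1 - x / t) - (1 - x) * (1 - x * c) * (1 - x * y * z * c / t)"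
proof -
  define u where "u = 1 / t"
  have tu: "t * u = 1" using assms by (simp add: u_def)
  have "- (x * c * (q * t)) * ((1 - x * y * z * c / t) * (1 - t) * (1 - c * t) / (c * q * t^2))
     = - x * u * ((1 - x * y * z * c * u) * (1 - t) * (1 - c * t))"
    using assms by (simp add: u_def power2_eq_square)
  moreover have "- x * u * ((1 - x * y * z * c * u) * (1 - t) * (1 - c * t))
      + x * c * t * (1 - x * u) * (1 - y * u) * (1 - z * u)
     = (1 - x * y * c) * (1 - x * z * c) * (1 - x * u) - (1 - x) * (1 - x * c) * (1 - x * y * z * c * u)"
    using tu by algebra
  ultimately show ?thesis by (simp add: u_def)
qed

text \<open>
  The quotient of \<open>N\<close> by the bases in \<open>B\<close> is the Saalschuetz quotient for \<open>x, y, z\<close>, but its residue at \<open>t = x\<close> is not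
  counted. Leaving this residue out makes the relation valid also when \<open>x\<close> coincides with a pole of \<open>1 / (t, c t)\<^sub>\<infinity>\<close>. The last term
  is the first residue of the \<open>q\<close>-difference at \<open>q x\<close>; at \<open>y\<close> and \<open>z\<close> the first residues are zero, because the certificate
  has the factors \<open>1 - y / t\<close> and \<open>1 - z / t\<close>.
\<close>
lemma saal_shift:
  assumes h: "h \<noteq> 0" and c: "c \<noteq> 0" and x: "x \<noteq> 0" and ok: "saal_generic q c (q * x) y z"
  defines "N \<equiv> \<lambda>t. (1 - x * y * z * c / t) / (1 - x / t) * saal_num q h c (q * (x * y * z * c)) t"
  defines "B \<equiv> {q * x, y, z}"
  shows "(1 - x * y * c) * (1 - x * z * c) * saal_sum q h c (q * x) y z
    = (1 - x) * (1 - x * c) * (\<Sum>X\<in>B. \<Sum>k. pole_term q N B X k)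
      + theta (h * x) q * theta (h / (c * x)) q * qpoch_inf (y * z * c) q /
        (qpoch_inf q q * qpoch_inf (y / x) q * qpoch_inf (z / x) q * qpoch_inf (q * x) q * qpoch_inf (c * (q * x)) q)"
proof -
  define e where "e = x * y * z * c"
  define N0 where "N0 = saal_num q h c (q * e)"
  define M where "M t = - (x * c * t * (1 - y / t) * (1 - z / t)) * N0 t" for t
  define \<alpha> where "\<alpha> = (1 - x * y * c) * (1 - x * z * c)"
  define \<beta> where "\<beta> = (1 - x) * (1 - x * c)"
  have sep: "separated q B" and ne: "q * x \<noteq> y" "q * x \<noteq> z" "y \<noteq> z"
    and nz: "\<And>X. X \<in> B \<Longrightarrow> qpoch_inf X q \<noteq> 0" "\<And>X. X \<in> B \<Longrightarrow> qpoch_inf (c * X) q \<noteq> 0"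
    using ok by (auto simp: saal_generic_def B_def)
  have fin: "finite B" "0 \<notin> B" using sep by (auto simp: separated_def)
  have N_eq: "N t = (1 - e / t) / (1 - x / t) * N0 t" for t by (simp add: N_def N0_def e_def)
  have ne2: "x \<noteq> y" "x \<noteq> z"
  proof -
    have "q * x * q ^ 0 \<noteq> Y * q ^ 1" if "Y \<in> {y, z}" for Y
      using sep ne that unfolding separated_def B_def by blast
    from this[of y] this[of z] show "x \<noteq> y" "x \<noteq> z" by auto
  qed
  have yz0: "y \<noteq> 0" "z \<noteq> 0" using fin by (auto simp: B_def)
  obtain \<rho> where "contracting (\<lambda>t. saal_num q h c e t / (1 - x / t)) B \<rho>"
    using contracting_saal_shift[OF h c x yz0 ne2 ne(3,1,2) e_def] unfolding B_def by blast
  moreover have "(\<lambda>t. saal_num q h c e t / (1 - x / t)) = N"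
    unfolding N_eq[abs_def] N0_def saal_num_split[of h c e] by (simp add: fun_eq_iff)
  ultimately have sum: "contracting N B \<rho>" by simp
  \<comment> \<open>A circle this small separates the origin from all poles that do not accumulate there, and from the first pole of each
    progression.\<close>
  define b where "b = Min ({1, 1 / norm c, norm x} \<union> norm ` B)"
  have "b > 0" using fin c x by (auto simp: b_def)
  obtain r where r: "0 < r" "r < b" "\<And>X k J. X \<in> B \<Longrightarrow> norm (X * q ^ k) \<noteq> r * norm q ^ J"
    using exists_generic_radius[OF fin(1) \<open>b > 0\<close> q0] by blast
  have rb: "r < 1" "r < 1 / norm c" "r < norm x" "\<And>X. X \<in> B \<Longrightarrow> r < norm X"
    using r(2) fin by (auto simp: b_def)
  have rc: "r * norm c < 1" using rb(2) c by (simp add: field_simps)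
  define D where "D = regular_dom c - {x}"
  have D: "open D" unfolding D_def using open_regular_dom by (simp add: open_Diff)
  have sub: "{t. 0 < norm t \<and> norm t \<le> r} \<subseteq> D"
    using small_in_regular_dom[OF rb(1) rc] rb(3) by (auto simp: D_def)
  have N0: "N0 holomorphic_on D" unfolding N0_def
    by (rule holomorphic_on_subset[OF saal_num_holomorphic[OF h c]]) (auto simp: D_def)
  have Nh: "N holomorphic_on D"
    unfolding N_eq[abs_def] by (intro holomorphic_intros N0) (auto simp: D_def regular_dom_def)
  have Mh: "M holomorphic_on D"
    unfolding M_def[abs_def] by (intro holomorphic_intros N0) (auto simp: D_def regular_dom_def)
  have ratio0: "contracting N0 B (\<lambda>t. (t - q * x * y * z * c / q) * (1 - t) * (1 - c * t) / (c * q * ((t - q * x / q) * (t - y / q) * (t - z / q))))"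
    using contracting_saal[OF h c _ yz0 ne, of "q * x * y * z * c"] q0 x by (simp add: N0_def e_def B_def mult_ac)
  have pts: "X * q ^ k \<noteq> 0" "qpoch_inf (X * q ^ k) q \<noteq> 0" "qpoch_inf (c * (X * q ^ k)) q \<noteq> 0" "X * q ^ k \<noteq> x"
    if X: "X \<in> B" for X k
  proof -
    show "X * q ^ k \<noteq> 0" using X fin q0 by auto
    show "qpoch_inf (X * q ^ k) q \<noteq> 0" using qpoch_inf_shift_nz[OF q nz(1)[OF X]] .
    show "qpoch_inf (c * (X * q ^ k)) q \<noteq> 0" using qpoch_inf_shift_nz[OF q nz(2)[OF X]] by (simp add: mult.assoc)
    show "X * q ^ k \<noteq> x"
    proof
      assume "X * q ^ k = x"
      then have "X * q ^ Suc k = (q * x) * q ^ 0" by (simp add: mult_ac)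
      moreover have "X = q * x \<or> X * q ^ Suc k \<noteq> (q * x) * q ^ 0"
        using sep X unfolding separated_def B_def by blast
      ultimately have "q * x * q ^ Suc k = q * x * q ^ 0" by simp
      then show False using power_q_eq_iff[of "Suc k" 0] x q0 by simp
    qed
  qed
  have main: "\<alpha> * N0 t - \<beta> * N t = (- (x * c * (q * t)) * ((1 - e / t) * (1 - t) * (1 - c * t) / (c * q * t^2)) / (1 - x / t)
       + x * c * t * (1 - y / t) * (1 - z / t)) * N0 t" if "t \<noteq> 0" "t \<noteq> x" for t
  proof -
    define P where "P = 1 - x / t"
    define T1 where "T1 = - (x * c * (q * t)) * ((1 - e / t) * (1 - t) * (1 - c * t) / (c * q * t^2))"
    define S2 where "S2 = x * c * t * (1 - y / t) * (1 - z / t)"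
    define E where "E = 1 - e / t"
    have P0: "P \<noteq> 0" using that by (simp add: P_def)
    have "T1 + P * S2 = \<alpha> * P - \<beta> * E"
      using saal_key_identity[OF that(1) c q0, of x y z]
      by (simp add: \<alpha>_def \<beta>_def e_def T1_def S2_def P_def E_def mult_ac)
    then have T1: "T1 = \<alpha> * P - \<beta> * E - P * S2" by (simp add: algebra_simps)
    have "\<alpha> * N0 t - \<beta> * (E / P * N0 t) = (T1 / P + S2) * N0 t"
      using P0 unfolding T1 by (simp add: field_simps)
    then show ?thesis unfolding N_eq P_def T1_def S2_def E_def by simp
  qed
  have Mq: "M (q * t) * \<Psi> = - (x * c * (q * t)) * ((1 - e / t) * (1 - t) * (1 - c * t) / (c * q * t^2)) / (1 - x / t) * (N0 t * ((1 - x / t) * (1 - y / (q * t)) * (1 - z / (q * t)) * \<Psi>))"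
    if "t \<noteq> 0" "t \<noteq> x" "qpoch_inf t q \<noteq> 0" "qpoch_inf (c * t) q \<noteq> 0" for t \<Psi>
  proof -
    have "N0 (q * t) = (1 - e / t) * (1 - t) * (1 - c * t) / (c * q * t^2) * N0 t"
      unfolding N0_def using saal_num_mult_q[OF h c that(1,3,4), of "q * e"] q0 by simp
    then show ?thesis using that(1,2) by (simp add: M_def)
  qed
  let ?f = "\<lambda>X k. \<alpha> * pole_term q N0 B X k - \<beta> * pole_term q N B X k"
  have s0: "summable (pole_term q N0 B X)" "summable (pole_term q N B X)" if "X \<in> B" for X
    using pole_term_summable[OF sep that ratio0] pole_term_summable[OF sep that sum] by auto
  have "(\<Sum>X\<in>B. \<Sum>k. ?f X k) = - (\<Sum>X\<in>B. pole_term q M B X 0)"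
  proof (rule q_difference_pole_sum[OF sep D Mh r(1) sub r(3) rb(4)])
    have "(\<Sum>X\<in>B. \<Sum>k. ?f X k) = \<alpha> * (\<Sum>X\<in>B. \<Sum>k. pole_term q N0 B X k) - \<beta> * (\<Sum>X\<in>B. \<Sum>k. pole_term q N B X k)"
      using s0 by (simp add: suminf_diff[symmetric] suminf_mult sum_subtractf sum_distrib_left summable_mult)
    also have "(\<Sum>X\<in>B. \<Sum>k. pole_term q N0 B X k) = circle_mean r (pole_quotient q N0 B) + (\<Sum>(X,k)\<in>big_poles q B r. pole_term q N0 B X k)"
      by (rule inner_pole_sum_no_outer_poles[OF sep D N0 r(1) sub r(3) ratio0])
    also have "(\<Sum>X\<in>B. \<Sum>k. pole_term q N B X k) = circle_mean r (pole_quotient q N B) + (\<Sum>(X,k)\<in>big_poles q B r. pole_term q N B X k)"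
      by (rule inner_pole_sum_no_outer_poles[OF sep D Nh r(1) sub r(3) sum])
    also have "\<alpha> * (circle_mean r (pole_quotient q N0 B) + (\<Sum>(X,k)\<in>big_poles q B r. pole_term q N0 B X k))
      - \<beta> * (circle_mean r (pole_quotient q N B) + (\<Sum>(X,k)\<in>big_poles q B r. pole_term q N B X k))
      = (\<alpha> * circle_mean r (pole_quotient q N0 B) - \<beta> * circle_mean r (pole_quotient q N B)) + (\<Sum>(X,k)\<in>big_poles q B r. ?f X k)"
      by (simp add: sum_subtractf sum_distrib_left case_prod_unfold algebra_simps)
    also have "\<alpha> * circle_mean r (pole_quotient q N0 B) - \<beta> * circle_mean r (pole_quotient q N B) = circle_mean r (\<lambda>t. \<alpha> * pole_quotient q N0 B t - \<beta> * pole_quotient q N B t)"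
    proof -
      have sph: "sphere 0 r \<subseteq> D" using sub r(1) by auto
      have cN: "continuous_on (sphere 0 r) (pole_quotient q N0 B)" "continuous_on (sphere 0 r) (pole_quotient q N B)"
        using pole_quotient_continuous_sphere[OF D N0 fin(1) r(1) sph] pole_quotient_continuous_sphere[OF D Nh fin(1) r(1) sph]
          r(3)[of _ _ 0] by auto
      show ?thesis using circle_mean_diff[of r "\<lambda>t. \<alpha> * pole_quotient q N0 B t" "\<lambda>t. \<beta> * pole_quotient q N B t"] circle_mean_cmult cN r(1)
        by (simp add: continuous_on_mult_left)
    qed
    finally show "(\<Sum>X\<in>B. \<Sum>k. ?f X k) = circle_mean r (\<lambda>t. \<alpha> * pole_quotient q N0 B t - \<beta> * pole_quotient q N B t) + (\<Sum>(X,k)\<in>big_poles q B r. ?f X k)" .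
  next
    fix t :: complex assume t: "norm t = r"
    have "t \<in> D" using sub t r(1) by auto
    then have t0: "t \<noteq> 0" "t \<noteq> x" "qpoch_inf t q \<noteq> 0" "qpoch_inf (c * t) q \<noteq> 0" by (auto simp: D_def regular_dom_def)
    define \<Psi> where "\<Psi> = (\<Prod>X\<in>B. qpoch_inf (X / t) q)"
    have fac: "1 - X / (q * t) \<noteq> 0" if "X \<in> B" for X
    proof
      assume "1 - X / (q * t) = 0"
      then have "X = q * t" using t0 q0 by (simp add: field_simps)
      then show False using r(3)[OF that, of 0 1] t by (simp add: norm_mult)
    qed
    have "(\<Prod>X\<in>B. qpoch_inf (X / (q * t)) q) = (\<Prod>X\<in>B. (1 - X / (q * t)) * qpoch_inf (X / t) q)"
      using qpoch_inf_Suc[OF q, of "_ / (q * t)"] q0 by (intro prod.cong) auto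
    also have "\<dots> = (\<Prod>X\<in>B. 1 - X / (q * t)) * \<Psi>" by (simp add: prod.distrib \<Psi>_def)
    also have "(\<Prod>X\<in>B. 1 - X / (q * t)) = (1 - x / t) * (1 - y / (q * t)) * (1 - z / (q * t))"
      unfolding B_def prod3[OF ne] using q0 by simp
    finally have Pq: "(\<Prod>X\<in>B. qpoch_inf (X / (q * t)) q) = (1 - x / t) * (1 - y / (q * t)) * (1 - z / (q * t)) * \<Psi>" .
    have nzf: "(1 - x / t) * (1 - y / (q * t)) * (1 - z / (q * t)) \<noteq> 0"
      using fac[of "q * x"] fac[of y] fac[of z] q0 by (auto simp: B_def)
    define W where "W = - (x * c * (q * t)) * ((1 - e / t) * (1 - t) * (1 - c * t) / (c * q * t^2)) / (1 - x / t)"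
    have "pole_quotient q M B (q * t) = W * N0 t / \<Psi>"
    proof (cases "\<Psi> = 0")
      case False
      have "M (q * t) * \<Psi> = W * (N0 t * ((1 - x / t) * (1 - y / (q * t)) * (1 - z / (q * t)) * \<Psi>))"
        unfolding W_def by (rule Mq[OF t0])
      then have "M (q * t) = W * N0 t * ((1 - x / t) * (1 - y / (q * t)) * (1 - z / (q * t)))"
        using False by simp
      then show ?thesis unfolding pole_quotient_def Pq using nzf by simp
    qed (simp add: pole_quotient_def Pq)
    moreover have "\<alpha> * N0 t - \<beta> * N t = W * N0 t - M t"
      using main[OF t0(1,2)] unfolding W_def [symmetric] by (simp add: M_def distrib_right)
    then have "(\<alpha> * N0 t - \<beta> * N t) / \<Psi> = (W * N0 t - M t) / \<Psi>" by simp
    ultimately show "\<alpha> * pole_quotient q N0 B t - \<beta> * pole_quotient q N B t = pole_quotient q M B (q * t) - pole_quotient q M B t"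
      by (simp add: pole_quotient_def[of q N0] pole_quotient_def[of q N] pole_quotient_def[of q M B t] \<Psi>_def [symmetric] diff_divide_distrib)
  next
    fix X k assume X: "X \<in> B"
    define t where "t = X * q ^ k"
    have qt: "X * q ^ Suc k = q * t" by (simp add: t_def)
    have t0: "t \<noteq> 0" "t \<noteq> x" "qpoch_inf t q \<noteq> 0" "qpoch_inf (c * t) q \<noteq> 0" using pts[OF X] by (auto simp: t_def)
    define \<nu> where "\<nu> = (1 - e / t) * (1 - t) * (1 - c * t) / (c * q * t^2)"
    have "N0 (X * q ^ Suc k) = \<nu> * N0 (X * q ^ k)"
      unfolding N0_def \<nu>_def qt using saal_num_mult_q[OF h c t0(1,3,4), of "q * e"] q0 by (simp add: t_def)
    from pole_term_Suc[OF sep X this]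
    have P: "pole_term q N0 B X (Suc k) * ((1 - x / t) * (1 - y / (q * t)) * (1 - z / (q * t))) = \<nu> * pole_term q N0 B X k"
      unfolding qt unfolding B_def prod3[OF ne] using q0 by simp
    have pM: "pole_term q M B X j = - (x * c * (X * q ^ j) * (1 - y / (X * q ^ j)) * (1 - z / (X * q ^ j))) * pole_term q N0 B X j" for j
      unfolding M_def[abs_def] by (rule pole_term_mult)
    have nz1: "1 - x / t \<noteq> 0" using t0 by simp
    have "pole_term q M B X (Suc k) = - (x * c * (q * t)) / (1 - x / t) * (pole_term q N0 B X (Suc k) * ((1 - x / t) * (1 - y / (q * t)) * (1 - z / (q * t))))"
      unfolding pM qt using nz1 t0(1,2) by simp
    then have 1: "pole_term q M B X (Suc k) = - (x * c * (q * t)) * \<nu> / (1 - x / t) * pole_term q N0 B X k"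
      unfolding P by simp
    define G where "G = pole_term q (\<lambda>t. 1) B X k"
    have g: "pole_term q F B X k = F t * G" for F by (simp add: pole_term_def G_def t_def)
    have "?f X k = (\<alpha> * N0 t - \<beta> * N t) * G" unfolding g by (simp add: left_diff_distrib)
    then show "?f X k = pole_term q M B X (Suc k) - pole_term q M B X k"
      unfolding 1 main[OF t0(1,2)] unfolding g M_def \<nu>_def by (simp add: algebra_simps)
  qed
  moreover have "(\<Sum>X\<in>B. \<Sum>k. ?f X k) = \<alpha> * (\<Sum>X\<in>B. \<Sum>k. pole_term q N0 B X k) - \<beta> * (\<Sum>X\<in>B. \<Sum>k. pole_term q N B X k)"
    using s0 by (simp add: suminf_diff[symmetric] suminf_mult sum_subtractf sum_distrib_left summable_mult)
  moreover have "(\<Sum>X\<in>B. \<Sum>k. pole_term q N0 B X k) = saal_sum q h c (q * x) y z"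
    by (simp add: saal_sum_def N0_def e_def B_def mult_ac)
  moreover have "(\<Sum>X\<in>B. pole_term q M B X 0) = - (theta (h * x) q * theta (h / (c * x)) q * qpoch_inf (y * z * c) q /
        (qpoch_inf q q * qpoch_inf (y / x) q * qpoch_inf (z / x) q * qpoch_inf (q * x) q * qpoch_inf (c * (q * x)) q))"
  proof -
    have "pole_term q M B y 0 = 0" "pole_term q M B z 0 = 0"
      using fin(2) by (auto simp: pole_term_def M_def B_def)
    then have "(\<Sum>X\<in>B. pole_term q M B X 0) = pole_term q M B (q * x) 0"
      using ne by (simp add: B_def)
    also have "\<dots> = M (q * x) / (qpoch_inf q q * (qpoch_inf (y / (q * x)) q * qpoch_inf (z / (q * x)) q))"
      using ne by (simp add: pole_term_def B_def insert_Diff_if)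
    also have "\<dots> = - (x * c * (q * x) * N0 (q * x)) / (qpoch_inf q q * (qpoch_inf (y / x) q * qpoch_inf (z / x) q))"
    proof -
      have "y / (q * x) \<noteq> 1" "z / (q * x) \<noteq> 1" using ne x q0 by auto
      then show ?thesis
        using qpoch_inf_Suc[OF q, of "y / (q * x)"] qpoch_inf_Suc[OF q, of "z / (q * x)"] q0 x ne by (simp add: M_def)
    qed
    also have "N0 (q * x) = theta (h * x) q * theta (h / (c * x)) q / (c * q * x^2) * qpoch_inf (y * z * c) q / (qpoch_inf (q * x) q * qpoch_inf (c * (q * x)) q)"
    proof -
      have "q * e / (q * x) = y * z * c" using q0 x by (simp add: e_def)
      then show ?thesis unfolding N0_def saal_num_def theta_pair_mult_q[OF h c x] by simp
    qed
    finally show ?thesis using q0 x c by (simp add: power2_eq_square mult_ac)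
  qed
  ultimately show ?thesis unfolding \<alpha>_def \<beta>_def by (simp add: algebra_simps)
qed

lemma saal_generic_shift:
  assumes "saal_generic q c x y z" shows "saal_generic q c (q * x) y z"
proof -
  have sep: "separated q {x, y, z}" and ne: "x \<noteq> y" "x \<noteq> z" "y \<noteq> z"
    and nz: "\<And>X. X \<in> {x, y, z} \<Longrightarrow> qpoch_inf X q \<noteq> 0" "\<And>X. X \<in> {x, y, z} \<Longrightarrow> qpoch_inf (c * X) q \<noteq> 0"
    using assms by (auto simp: saal_generic_def)
  have S: "X * q ^ k \<noteq> Y * q ^ l" if "X \<in> {x, y, z}" "Y \<in> {x, y, z}" "X \<noteq> Y" for X Y k l
    using sep that unfolding separated_def by blast
  have Sx: "q * x * q ^ k \<noteq> Y * q ^ l" if "Y \<in> {y, z}" for Y k l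
    using S[of x Y "Suc k" l] that ne by (auto simp: mult_ac)
  have "separated q {q * x, y, z}"
    unfolding separated_def
  proof (intro conjI ballI impI allI)
    show "0 \<notin> {q * x, y, z}" using sep q0 by (auto simp: separated_def)
    fix X Y k l assume "X \<in> {q * x, y, z}" "Y \<in> {q * x, y, z}" "X \<noteq> Y"
    then show "X * q ^ k \<noteq> Y * q ^ l"
      using S[of X Y k l] Sx[of Y k l] Sx[of X l k] ne by (cases "X = q * x"; cases "Y = q * x") auto
  qed simp
  moreover have "q * x \<noteq> y" "q * x \<noteq> z" using Sx[of _ 0 0] by auto
  moreover have "qpoch_inf (q * x) q \<noteq> 0" "qpoch_inf (c * (q * x)) q \<noteq> 0"
    using qpoch_inf_shift_nz[OF q nz(1)[of x], of 1] qpoch_inf_shift_nz[OF q nz(2)[of x], of 1] by (simp_all add: mult_ac)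
  ultimately show ?thesis using ne nz unfolding saal_generic_def by auto
qed

text \<open>
  If \<open>t = x\<close> is a simple pole, the last term of \<open>saal_shift\<close> is exactly its residue, multiplied by \<open>(1 - x) (1 - c x)\<close>.
\<close>
lemma saal_contiguous:
  assumes h: "h \<noteq> 0" and c: "c \<noteq> 0" and ok: "saal_generic q c x y z"
  shows "(1 - x * y * c) * (1 - x * z * c) * saal_sum q h c (q * x) y z
    = (1 - x) * (1 - x * c) * saal_sum q h c x y z"
proof -
  define e where "e = x * y * z * c"
  define B where "B = {x, y, z}"
  define B' where "B' = {q * x, y, z}"
  define N where "N t = (1 - x * y * z * c / t) / (1 - x / t) * saal_num q h c (q * (x * y * z * c)) t" for t
  have sep: "separated q {x, y, z}" and ne: "x \<noteq> y" "x \<noteq> z" "y \<noteq> z"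
    and nz: "\<And>X. X \<in> {x, y, z} \<Longrightarrow> qpoch_inf X q \<noteq> 0" "\<And>X. X \<in> {x, y, z} \<Longrightarrow> qpoch_inf (c * X) q \<noteq> 0"
    using ok by (auto simp: saal_generic_def)
  have x0: "x \<noteq> 0" using sep by (auto simp: separated_def)
  have ok': "saal_generic q c (q * x) y z" by (rule saal_generic_shift[OF ok])
  then have ne': "q * x \<noteq> y" "q * x \<noteq> z" by (auto simp: saal_generic_def)
  have N: "N t = saal_num q h c e t / (1 - x / t)" for t
    unfolding N_def e_def saal_num_split[of h c "x * y * z * c" t] by simp
  have yz0: "y \<noteq> 0" "z \<noteq> 0" using sep by (auto simp: separated_def)
  obtain \<rho> where \<rho>: "contracting (saal_num q h c e) {x, y, z} \<rho>"
    using contracting_saal[OF h c x0 yz0 ne e_def] by auto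
  define S where "S X = (\<Sum>k. pole_term q (saal_num q h c e) B X k)" for X
  have summ: "summable (pole_term q (saal_num q h c e) B X)" if "X \<in> B" for X
    using pole_term_summable[OF _ _ \<rho>] sep that by (simp add: B_def)
  have other: "pole_term q N B' Y k = pole_term q (saal_num q h c e) B Y k" if Y: "Y \<in> {y, z}" for Y k
  proof -
    define t where "t = Y * q ^ k"
    have t0: "t \<noteq> 0" using Y sep q0 by (auto simp: t_def separated_def)
    have tx: "t \<noteq> x"
    proof
      assume "t = x"
      then have "Y * q ^ k = x * q ^ 0" by (simp add: t_def)
      moreover have "Y \<in> {x, y, z}" "Y \<noteq> x" using Y ne by auto
      ultimately show False using sep unfolding separated_def by blast
    qed
    have "qpoch_inf (x / t) q = (1 - x / t) * qpoch_inf (q * x / t) q"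
      using qpoch_inf_Suc[OF q, of "x / t"] by (simp add: mult_ac)
    moreover have "B' - {Y} = insert (q * x) ({y, z} - {Y})" "B - {Y} = insert x ({y, z} - {Y})"
      using Y ne ne' by (auto simp: B_def B'_def)
    moreover have "q * x \<notin> {y, z} - {Y}" "x \<notin> {y, z} - {Y}" using ne ne' by auto
    ultimately show ?thesis
      unfolding pole_term_def N t_def [symmetric] using tx t0 by simp
  qed
  have own: "pole_term q N B' (q * x) k = pole_term q (saal_num q h c e) B x (Suc k)" for k
  proof -
    have 1: "B' - {q * x} = {y, z}" "B - {x} = {y, z}" using ne ne' by (auto simp: B_def B'_def)
    have 2: "q * x * q ^ k = x * q ^ Suc k" by simp
    have 3: "qpoch (1 / q ^ Suc k) q (Suc k) = (1 - x / (x * q ^ Suc k)) * qpoch (1 / q ^ k) q k"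
      unfolding qpoch_Suc_left using q0 x0 by simp
    show ?thesis unfolding pole_term_def 1 2 N 3 by simp
  qed
  have sumB': "(\<Sum>X\<in>B'. \<Sum>k. pole_term q N B' X k) = saal_sum q h c x y z - pole_term q (saal_num q h c e) B x 0"
  proof -
    have "(\<Sum>X\<in>B'. \<Sum>k. pole_term q N B' X k)
      = (\<Sum>k. pole_term q N B' (q * x) k) + (\<Sum>k. pole_term q N B' y k) + (\<Sum>k. pole_term q N B' z k)"
      using ne ne' unfolding B'_def by simp
    also have "\<dots> = (\<Sum>k. pole_term q (saal_num q h c e) B x (Suc k)) + S y + S z"
      unfolding own S_def using other by simp
    also have "(\<Sum>k. pole_term q (saal_num q h c e) B x (Suc k)) = S x - pole_term q (saal_num q h c e) B x 0"
      unfolding S_def using suminf_split_head[OF summ[of x]] by (simp add: B_def)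
    finally show ?thesis using ne by (simp add: saal_sum_def S_def e_def B_def)
  qed
  have first: "(1 - x) * (1 - x * c) * pole_term q (saal_num q h c e) B x 0 = theta (h * x) q * theta (h / (c * x)) q * qpoch_inf (y * z * c) q /
        (qpoch_inf q q * qpoch_inf (y / x) q * qpoch_inf (z / x) q * qpoch_inf (q * x) q * qpoch_inf (c * (q * x)) q)"
  proof -
    have "B - {x} = {y, z}" using ne by (auto simp: B_def)
    moreover have "e / x = y * z * c" using x0 by (simp add: e_def)
    moreover have "qpoch_inf x q = (1 - x) * qpoch_inf (q * x) q" "qpoch_inf (c * x) q = (1 - x * c) * qpoch_inf (c * (q * x)) q"
      using qpoch_inf_Suc[OF q, of x] qpoch_inf_Suc[OF q, of "c * x"] by (simp_all add: mult_ac)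
    moreover have "1 - x \<noteq> 0" "1 - x * c \<noteq> 0" using calculation(3,4) nz[of x] by auto
    ultimately show ?thesis using ne by (simp add: pole_term_def saal_num_def mult_ac)
  qed
  have "(1 - x * y * c) * (1 - x * z * c) * saal_sum q h c (q * x) y z
    = (1 - x) * (1 - x * c) * (\<Sum>X\<in>B'. \<Sum>k. pole_term q N B' X k)
      + (1 - x) * (1 - x * c) * pole_term q (saal_num q h c e) B x 0"
    unfolding first using saal_shift[OF h c x0 ok'] unfolding N_def[abs_def] B'_def by simp
  then show ?thesis unfolding sumB' by (simp add: algebra_simps)
qed

text \<open>
  At these two values of \<open>x\<close> the coefficient of the unshifted sum in \<open>saal_shift\<close> vanishes, so that a single residue is left. The two
  values give the same theta functions, which are exchanged for \<open>x = 1 / c\<close>.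
\<close>
lemma saal_boundary:
  assumes h: "h \<noteq> 0" and c: "c \<noteq> 0" and x: "x = 1 \<or> x = 1 / c" and ok: "saal_generic q c (q * x) y z"
  shows "(1 - x * y * c) * (1 - x * z * c) * saal_sum q h c (q * x) y z
    = theta h q * theta (h / c) q * qpoch_inf (y * z * c) q /
        (qpoch_inf q q * qpoch_inf (y / x) q * qpoch_inf (z / x) q * qpoch_inf (q * x) q * qpoch_inf (c * (q * x)) q)"
proof -
  have x0: "x \<noteq> 0" using x c by auto
  have "(1 - x) * (1 - x * c) = 0" using x c by auto
  moreover have "theta (h * x) q * theta (h / (c * x)) q = theta h q * theta (h / c) q"
    using x c by (auto simp: mult_ac)
  ultimately show ?thesis
    unfolding saal_shift[OF h c x0 ok] by simp
qed

end

lemma uniform_limit_of_jointly_continuous: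
  fixes F :: "complex \<Rightarrow> complex \<Rightarrow> complex"
  assumes "\<delta> > 0" "continuous_on (cball 0 \<delta> \<times> sphere 0 r) (\<lambda>p. F (fst p) (snd p))" "w \<longlonglongrightarrow> 0"
  shows "uniform_limit (sphere 0 r) (\<lambda>n t. F (w n) t) (F 0) sequentially"
proof (rule uniform_limitI)
  fix e :: real assume "e > 0"
  have "compact (cball (0::complex) \<delta> \<times> sphere (0::complex) r)" by (intro compact_Times) auto
  from compact_uniformly_continuous[OF assms(2) this]
  obtain d where d: "d > 0" "\<And>p p'. p \<in> cball 0 \<delta> \<times> sphere 0 r \<Longrightarrow> p' \<in> cball 0 \<delta> \<times> sphere 0 r \<Longrightarrow>
     dist p' p < d \<Longrightarrow> dist (F (fst p') (snd p')) (F (fst p) (snd p)) < e"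
    unfolding uniformly_continuous_on_def using \<open>e > 0\<close> by metis
  have "\<forall>\<^sub>F n in sequentially. norm (w n) < min d \<delta>"
    using tendsto_norm_zero[OF assms(3)] d(1) assms(1) by (intro order_tendstoD) auto
  then show "\<forall>\<^sub>F n in sequentially. \<forall>t\<in>sphere 0 r. dist (F (w n) t) (F 0 t) < e"
  proof eventually_elim
    case (elim n)
    show ?case
    proof
      fix t :: complex assume "t \<in> sphere 0 r"
      then show "dist (F (w n) t) (F 0 t) < e"
        using d(2)[of "(0, t)" "(w n, t)"] elim assms(1) by (auto simp: dist_Pair_Pair)
    qed
  qed
qed

context nome
begin

lemma saal_step:
  assumes h: "h \<noteq> 0" and c: "c \<noteq> 0" and ok: "saal_generic q c x y z"
  shows "saal_sum q h c x y z = (1 - x * y * c) * (1 - x * z * c) / ((1 - x) * (1 - x * c)) * saal_sum q h c (q * x) y z"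
proof -
  have "x * q ^ 0 \<noteq> 1" "c * x * q ^ 0 \<noteq> 1"
    using ok qpoch_inf_nz[OF q] unfolding saal_generic_def by blast+
  then have "(1 - x) * (1 - x * c) \<noteq> 0" by (auto simp: mult_ac)
  then show ?thesis
    using saal_contiguous[OF h c ok] by (simp add: eq_divide_eq mult_ac)
qed

text \<open>
  One round shifts each of the three parameters once, so every pair gains two factors and every single parameter one.
\<close>
lemma saal_iterate:
  assumes h: "h \<noteq> 0" and c: "c \<noteq> 0" and ok: "saal_generic q c x y z"
  shows "saal_generic q c (q ^ N * x) (q ^ N * y) (q ^ N * z) \<and> saal_sum q h c x y z =
    qpoch (x * y * c) q (2 * N) * qpoch (x * z * c) q (2 * N) * qpoch (y * z * c) q (2 * N)
     / (qpoch x q N * qpoch y q N * qpoch z q N * qpoch (c * x) q N * qpoch (c * y) q N * qpoch (c * z) q N)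
     * saal_sum q h c (q ^ N * x) (q ^ N * y) (q ^ N * z)"
  using ok
proof (induction N arbitrary: x y z)
  case (Suc N)
  note ok0 = Suc.prems
  have ok1: "saal_generic q c (q * x) y z" by (rule saal_generic_shift[OF ok0])
  have ok1': "saal_generic q c y (q * x) z" using ok1 by (simp add: saal_generic_swap12)
  have ok2': "saal_generic q c (q * y) (q * x) z" by (rule saal_generic_shift[OF ok1'])
  then have ok2: "saal_generic q c (q * x) (q * y) z" by (simp add: saal_generic_swap12)
  then have ok2'': "saal_generic q c z (q * y) (q * x)" by (simp add: saal_generic_swap13)
  have ok3': "saal_generic q c (q * z) (q * y) (q * x)" by (rule saal_generic_shift[OF ok2''])
  then have ok3: "saal_generic q c (q * x) (q * y) (q * z)" by (simp add: saal_generic_swap13)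
  have e1: "saal_sum q h c x y z = (1 - x * y * c) * (1 - x * z * c) / ((1 - x) * (1 - x * c)) * saal_sum q h c (q * x) y z"
    by (rule saal_step[OF h c ok0])
  have e2: "saal_sum q h c (q * x) y z = (1 - y * (q * x) * c) * (1 - y * z * c) / ((1 - y) * (1 - y * c)) * saal_sum q h c (q * x) (q * y) z"
    using saal_step[OF h c ok1'] by (simp add: saal_sum_swap12[of q h c "q * x"])
  have e3: "saal_sum q h c (q * x) (q * y) z = (1 - z * (q * y) * c) * (1 - z * (q * x) * c) / ((1 - z) * (1 - z * c)) * saal_sum q h c (q * x) (q * y) (q * z)"
    using saal_step[OF h c ok2''] by (simp add: saal_sum_swap13[of q h c "q * x"])
  have IH: "saal_generic q c (q ^ N * (q * x)) (q ^ N * (q * y)) (q ^ N * (q * z))"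
    "saal_sum q h c (q * x) (q * y) (q * z) =
    qpoch (q * x * (q * y) * c) q (2 * N) * qpoch (q * x * (q * z) * c) q (2 * N) * qpoch (q * y * (q * z) * c) q (2 * N)
     / (qpoch (q * x) q N * qpoch (q * y) q N * qpoch (q * z) q N * qpoch (c * (q * x)) q N * qpoch (c * (q * y)) q N * qpoch (c * (q * z)) q N)
     * saal_sum q h c (q ^ N * (q * x)) (q ^ N * (q * y)) (q ^ N * (q * z))"
    using Suc.IH[OF ok3] by auto
  have p2: "qpoch (u * v * c) q (2 * Suc N) = (1 - u * v * c) * (1 - v * (q * u) * c) * qpoch (q * u * (q * v) * c) q (2 * N)" for u v
    by (simp add: qpoch_Suc_left mult_ac)
  have p1: "qpoch u q (Suc N) = (1 - u) * qpoch (q * u) q N" for u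
    by (simp add: qpoch_Suc_left mult_ac)
  have p1c: "qpoch (c * u) q (Suc N) = (1 - u * c) * qpoch (c * (q * u)) q N" for u
    by (simp add: qpoch_Suc_left mult_ac)
  have pw: "q ^ Suc N * u = q ^ N * (q * u)" for u by (simp add: mult_ac)
  show ?case
    unfolding pw p2 p1 p1c using IH(1) unfolding e1 e2 e3 IH(2) by (simp add: mult_ac)
qed simp

text \<open>
  The limit of the sum as \<open>x, y, z\<close> tend to \<open>0\<close>: all three progressions of poles shrink into the origin, and only the kernel remains.
\<close>
definition saal_const :: "real \<Rightarrow> complex \<Rightarrow> complex \<Rightarrow> complex" where
  "saal_const r h c = circle_mean r (theta_kernel q h c)"

text \<open>
  After \<open>N\<close> rounds of \<open>saal_iterate\<close> all poles \<open>q\<^sup>N X q\<^sup>k\<close> lie inside the circle of radius \<open>r\<close>, for all large \<open>N\<close>, and the sum is a mean over this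
  circle. The integrand converges to the kernel uniformly there.
\<close>
lemma saal_sum_eq_const:
  assumes h: "h \<noteq> 0" and c: "c \<noteq> 0" and ok: "saal_generic q c x y z"
    and r: "0 < r" "r < 1" "r * norm c < 1"
    and rad: "\<And>X k J. X \<in> {x, y, z} \<Longrightarrow> norm (X * q ^ k) \<noteq> r * norm q ^ J"
  shows "saal_sum q h c x y z = qpoch_inf (x * y * c) q * qpoch_inf (x * z * c) q * qpoch_inf (y * z * c) q
     / (qpoch_inf x q * qpoch_inf y q * qpoch_inf z q * qpoch_inf (c * x) q * qpoch_inf (c * y) q * qpoch_inf (c * z) q)
     * saal_const r h c"
proof -
  define e where "e = x * y * z * c"
  define F where "F w t = theta (h * t) q * theta (h / (c * t)) q / (qpoch_inf t q * qpoch_inf (c * t) q)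
      * (qpoch_inf (e * w ^ 3 / t) q / (qpoch_inf (x * w / t) q * qpoch_inf (y * w / t) q * qpoch_inf (z * w / t) q))" for w t
  have dom: "{t. 0 < norm t \<and> norm t \<le> r} \<subseteq> regular_dom c"
    using small_in_regular_dom[OF r(2,3)] .
  have domt: "t \<noteq> 0" "qpoch_inf t q \<noteq> 0" "qpoch_inf (c * t) q \<noteq> 0" if "norm t = r" for t
  proof -
    have "t \<in> regular_dom c" using dom that r(1) by auto
    then show "t \<noteq> 0" "qpoch_inf t q \<noteq> 0" "qpoch_inf (c * t) q \<noteq> 0" by (auto simp: regular_dom_def)
  qed
  \<comment> \<open>For \<open>|w| \<le> \<delta>\<close> and \<open>|t| = r\<close> all of \<open>|x w / t|, |y w / t|, |z w / t|\<close> are at most \<open>1 / 2\<close>, so the denominators of \<open>F w\<close> stay away from zero.\<close>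
  define m where "m = norm x + norm y + norm z + 1"
  define \<delta> where "\<delta> = r / (2 * m)"
  have m: "m > 0" "norm x \<le> m" "norm y \<le> m" "norm z \<le> m" by (auto simp: m_def add_nonneg_pos)
  have \<delta>: "\<delta> > 0" using r m by (simp add: \<delta>_def)
  have small: "qpoch_inf (X * w / t) q \<noteq> 0" if "norm w \<le> \<delta>" "norm t = r" "norm X \<le> m" for X w t
  proof (rule qpoch_inf_small_nz[OF q])
    have "norm (X * w / t) = norm X * norm w / r" using that by (simp add: norm_mult norm_divide)
    also have "\<dots> \<le> m * \<delta> / r" using that r m by (intro divide_right_mono mult_mono) auto
    also have "\<dots> < 1" using r m by (simp add: \<delta>_def)
    finally show "norm (X * w / t) < 1" .
  qed
  have contF: "continuous_on (cball 0 \<delta> \<times> sphere 0 r) (\<lambda>p. F (fst p) (snd p))"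
    unfolding F_def theta_eq[OF q]
    by (intro continuous_intros q) (use domt small m h c in \<open>auto simp: mult.commute\<close>)
  have contN: "continuous_on (sphere 0 r) (F w)" if "norm w \<le> \<delta>" for w
  proof -
    have "continuous_on (sphere 0 r) (\<lambda>t. (w, t))" by (intro continuous_intros)
    moreover have "(\<lambda>t. (w, t)) ` sphere 0 r \<subseteq> cball 0 \<delta> \<times> sphere 0 r" using that by auto
    ultimately have "continuous_on (sphere 0 r) (\<lambda>t. F (fst (w, t)) (snd (w, t)))"
      by (rule continuous_on_compose2[OF contF])
    then show ?thesis by simp
  qed
  have qN: "(\<lambda>N. q ^ N) \<longlonglongrightarrow> 0" using q by (intro LIMSEQ_power_zero) auto
  have "\<forall>\<^sub>F N in sequentially. norm (q ^ N) < \<delta>"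
    using tendsto_norm_zero[OF qN] \<delta> by (intro order_tendstoD) auto
  then obtain N0 where N0: "\<And>N. N \<ge> N0 \<Longrightarrow> norm (q ^ N) < \<delta>" by (auto simp: eventually_sequentially)
  have "(\<lambda>N. circle_mean r (F (q ^ (N + N0)))) \<longlonglongrightarrow> circle_mean r (F 0)"
  proof (rule circle_mean_uniform_limit[OF r(1)])
    show "continuous_on (sphere 0 r) (F (q ^ (N + N0)))" for N
      using N0[of "N + N0"] by (intro contN) auto
    show "uniform_limit (sphere 0 r) (\<lambda>N. F (q ^ (N + N0))) (F 0) sequentially"
      by (rule uniform_limit_of_jointly_continuous[OF \<delta> contF LIMSEQ_ignore_initial_segment[OF qN]])
  qed
  moreover have "F 0 = theta_kernel q h c"
    by (simp add: F_def theta_kernel_def fun_eq_iff qpoch_inf_0[OF q])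
  ultimately have lim1: "(\<lambda>N. circle_mean r (F (q ^ (N + N0)))) \<longlonglongrightarrow> saal_const r h c"
    by (simp add: saal_const_def)
  have sums: "saal_sum q h c (q ^ N * x) (q ^ N * y) (q ^ N * z) = circle_mean r (F (q ^ N))" if N: "N \<ge> N0" for N
  proof -
    define B where "B = {q ^ N * x, q ^ N * y, q ^ N * z}"
    define e' where "e' = q ^ N * x * (q ^ N * y) * (q ^ N * z) * c"
    have okN: "saal_generic q c (q ^ N * x) (q ^ N * y) (q ^ N * z)"
      using saal_iterate[OF h c ok] by blast
    then have sep: "separated q B" and ne: "q ^ N * x \<noteq> q ^ N * y" "q ^ N * x \<noteq> q ^ N * z" "q ^ N * y \<noteq> q ^ N * z"
      by (auto simp: saal_generic_def B_def)
    have nz: "q ^ N * x \<noteq> 0" "q ^ N * y \<noteq> 0" "q ^ N * z \<noteq> 0" using sep by (auto simp: separated_def B_def)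
    have "\<exists>\<rho>. contracting (saal_num q h c e') B \<rho>"
      using contracting_saal[OF h c nz ne e'_def] unfolding B_def by blast
    then obtain \<rho> where \<rho>: "contracting (saal_num q h c e') B \<rho>" by blast
    have radN: "norm (X * q ^ k) \<noteq> r * norm q ^ J" if "X \<in> B" for X k J
    proof -
      have "X \<in> (*) (q ^ N) ` {x, y, z}" using that by (simp add: B_def)
      then obtain Y where "X = q ^ N * Y" "Y \<in> {x, y, z}" by (rule imageE)
      moreover from this have "X * q ^ k = Y * q ^ (N + k)" by (simp add: power_add)
      ultimately show ?thesis using rad[of Y "N + k" J] by metis
    qed
    have big: "big_poles q B r = {}"
    proof -
      have "\<not> norm (X * q ^ k) > r" if X: "X \<in> B" for X k
      proof -
        have "X \<in> (*) (q ^ N) ` {x, y, z}" using X by (simp add: B_def)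
        then obtain Y where Y: "X = q ^ N * Y" "Y \<in> {x, y, z}" by (rule imageE)
        have "norm (X * q ^ k) = norm (q ^ N) * norm Y * norm q ^ k" by (simp add: Y norm_mult norm_power)
        also have "\<dots> \<le> \<delta> * m * 1"
          using N0[OF N] Y m q \<delta> by (intro mult_mono power_le_one) auto
        also have "\<dots> \<le> r" using m r by (simp add: \<delta>_def)
        finally show ?thesis by simp
      qed
      then show ?thesis by (auto simp: big_poles_def)
    qed
    have "saal_sum q h c (q ^ N * x) (q ^ N * y) (q ^ N * z) = (\<Sum>X\<in>B. \<Sum>k. pole_term q (saal_num q h c e') B X k)"
      by (simp add: saal_sum_def B_def e'_def)
    also have "\<dots> = circle_mean r (pole_quotient q (saal_num q h c e') B) + (\<Sum>(X,k)\<in>big_poles q B r. pole_term q (saal_num q h c e') B X k)"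
      by (rule inner_pole_sum_no_outer_poles[OF sep open_regular_dom saal_num_holomorphic[OF h c] r(1) dom radN \<rho>])
    also have "\<dots> = circle_mean r (pole_quotient q (saal_num q h c e') B)" by (simp add: big)
    also have "\<dots> = circle_mean r (F (q ^ N))"
    proof (rule circle_mean_cong[OF r(1)])
      fix t
      have "e' = e * (q ^ N) ^ 3" by (simp add: e'_def e_def power3_eq_cube mult_ac)
      then show "pole_quotient q (saal_num q h c e') B t = F (q ^ N) t"
        unfolding pole_quotient_def B_def prod3[OF ne] saal_num_def F_def by (simp add: mult_ac)
    qed
    finally show ?thesis .
  qed
  define E where "E N = qpoch (x * y * c) q (2 * N) * qpoch (x * z * c) q (2 * N) * qpoch (y * z * c) q (2 * N)
     / (qpoch x q N * qpoch y q N * qpoch z q N * qpoch (c * x) q N * qpoch (c * y) q N * qpoch (c * z) q N)" for N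
  have nz: "qpoch_inf x q * qpoch_inf y q * qpoch_inf z q * qpoch_inf (c * x) q * qpoch_inf (c * y) q * qpoch_inf (c * z) q \<noteq> 0"
    using ok by (auto simp: saal_generic_def)
  have t2: "(\<lambda>N. qpoch b q (2 * N)) \<longlonglongrightarrow> qpoch_inf b q" for b
    using LIMSEQ_subseq_LIMSEQ[OF qpoch_tendsto[OF q, of b], of "\<lambda>N. 2 * N"] by (simp add: o_def strict_mono_def)
  have "E \<longlonglongrightarrow> qpoch_inf (x * y * c) q * qpoch_inf (x * z * c) q * qpoch_inf (y * z * c) q
     / (qpoch_inf x q * qpoch_inf y q * qpoch_inf z q * qpoch_inf (c * x) q * qpoch_inf (c * y) q * qpoch_inf (c * z) q)"
    unfolding E_def using nz by (intro tendsto_divide tendsto_mult t2 qpoch_tendsto q)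
  from tendsto_mult[OF LIMSEQ_ignore_initial_segment[OF this, of N0] lim1]
  have "(\<lambda>N. E (N + N0) * circle_mean r (F (q ^ (N + N0)))) \<longlonglongrightarrow> qpoch_inf (x * y * c) q * qpoch_inf (x * z * c) q * qpoch_inf (y * z * c) q
     / (qpoch_inf x q * qpoch_inf y q * qpoch_inf z q * qpoch_inf (c * x) q * qpoch_inf (c * y) q * qpoch_inf (c * z) q) * saal_const r h c" .
  moreover have "E (N + N0) * circle_mean r (F (q ^ (N + N0))) = saal_sum q h c x y z" for N
    using conjunct2[OF saal_iterate[OF h c ok, of "N + N0"]] unfolding E_def sums[OF le_add2] by (rule sym)
  ultimately show ?thesis by (simp only: LIMSEQ_const_iff)
qed

text \<open>
  The constant is independent of \<open>x, y, z\<close>, so it can be read off from any instance where the sum is known; \<open>saal_boundary\<close> provides one with first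
  parameter \<open>q\<close> or \<open>q / c\<close>. The finite set \<open>A\<close> lets the radius be chosen generic for a given triple as well.
\<close>
lemma saal_const_eq:
  assumes h: "h \<noteq> 0" and c: "c \<noteq> 0" and fin: "finite A"
  obtains r where "0 < r" "r < 1" "r * norm c < 1"
    "\<And>X k J. X \<in> A \<Longrightarrow> norm (X * q ^ k) \<noteq> r * norm q ^ J"
    "saal_const r h c = theta h q * theta (h / c) q / qpoch_inf q q"
proof -
  \<comment> \<open>The parameter \<open>q\<close> is admissible unless it equals some \<open>q\<^bsup>-k\<^esup> / c\<close>, and \<open>q / c\<close> is admissible unless it equals some
    \<open>q\<^bsup>-k\<^esup>\<close>. The first is excluded if \<open>|c| \<le> 1\<close>, the second if \<open>|c| > 1\<close>.\<close>
  have "\<exists>x. (x = 1 \<or> x = 1 / c) \<and> qpoch_inf (q * x) q \<noteq> 0 \<and> qpoch_inf (c * (q * x)) q \<noteq> 0"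
  proof (cases "norm c \<le> 1")
    case True
    then have "norm (c * q) < 1" using q mult_left_le_one_le[of "norm q" "norm c"] by (simp add: norm_mult)
    then show ?thesis using qpoch_inf_small_nz[OF q] q by (intro exI[of _ 1]) auto
  next
    case False
    then have "norm q < norm c * 1" using q by linarith
    then have "norm (q * (1 / c)) < 1" using c by (simp add: norm_mult norm_divide field_simps)
    moreover have "c * (q * (1 / c)) = q" using c by simp
    ultimately show ?thesis using qpoch_inf_small_nz[OF q] q by (intro exI[of _ "1 / c"]) auto
  qed
  then obtain x where x: "x = 1 \<or> x = 1 / c" "qpoch_inf (q * x) q \<noteq> 0" "qpoch_inf (c * (q * x)) q \<noteq> 0" by blast
  have x0: "x \<noteq> 0" using x c by auto
  \<comment> \<open>The ratios of the moduli of the three parameters are non-integral powers of \<open>|q|\<close>, so their progressions are disjoint.\<close>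
  define w where "w = root 3 (norm q)"
  have w3: "w ^ 3 = norm q" unfolding w_def by (rule real_root_pow_pos2) auto
  have w: "0 < w" "w < 1" using q q0 by (auto simp: w_def)
  have w_inj: "w ^ i = w ^ j \<longleftrightarrow> i = j" for i j using w power_inject_exp'[of w i j] by auto
  have "(\<lambda>n. (norm x + 1) * (norm c + 1) * (norm (q * x) * w ^ n)) \<longlonglongrightarrow> (norm x + 1) * (norm c + 1) * (norm (q * x) * 0)"
    using w by (intro tendsto_intros LIMSEQ_power_zero) auto
  then have "\<forall>\<^sub>F n in sequentially. (norm x + 1) * (norm c + 1) * (norm (q * x) * w ^ n) < 1"
    by (intro order_tendstoD) auto
  then obtain n where n: "\<And>m. m \<ge> n \<Longrightarrow> (norm x + 1) * (norm c + 1) * (norm (q * x) * w ^ m) < 1"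
    by (auto simp: eventually_sequentially)
  define y where "y = q * x * of_real (w ^ (3 * n + 1))"
  define z where "z = q * x * of_real (w ^ (3 * n + 2))"
  have ny: "norm y = norm (q * x) * w ^ (3 * n + 1)" and nz: "norm z = norm (q * x) * w ^ (3 * n + 2)"
    using w by (simp_all add: y_def z_def norm_mult norm_power)
  have small: "norm Y < 1 \<and> norm (c * Y) < 1 \<and> norm (x * Y * c) < 1" if "Y \<in> {y, z}" for Y
  proof -
    have b: "(norm x + 1) * (norm c + 1) * norm Y < 1" using n[of "3 * n + 1"] n[of "3 * n + 2"] that ny nz by auto
    have le: "k * norm Y \<le> (norm x + 1) * (norm c + 1) * norm Y" if "k \<le> (norm x + 1) * (norm c + 1)" for k
      using that by (intro mult_right_mono) auto
    have "1 \<le> (norm x + 1) * (norm c + 1)" "norm c \<le> (norm x + 1) * (norm c + 1)" "norm x * norm c \<le> (norm x + 1) * (norm c + 1)"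
      by (auto simp: algebra_simps)
    from this[THEN le] b show ?thesis by (auto simp: norm_mult mult_ac)
  qed
  have Bn: "\<exists>i\<in>{0, 3 * n + 1, 3 * n + 2}. X = q * x * of_real (w ^ i)" if "X \<in> {q * x, y, z}" for X
    using that unfolding y_def z_def by auto
  have nX: "norm (q * x * of_real (w ^ i) * q ^ k) = norm (q * x) * w ^ (i + 3 * k)" for i k
    using w by (simp add: norm_mult norm_power power_add power_mult w3)
  have x0': "norm (q * x) \<noteq> 0" using x0 q0 by simp
  have sep_aux: "X * q ^ k \<noteq> Y * q ^ l" if XY: "X \<in> {q * x, y, z}" "Y \<in> {q * x, y, z}" "X \<noteq> Y" for X Y k l
  proof
    assume eq: "X * q ^ k = Y * q ^ l"
    obtain i j where i: "i \<in> {0, 3 * n + 1, 3 * n + 2}" "X = q * x * of_real (w ^ i)"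
      and j: "j \<in> {0, 3 * n + 1, 3 * n + 2}" "Y = q * x * of_real (w ^ j)"
      using Bn[OF XY(1)] Bn[OF XY(2)] by blast
    have "norm (q * x) * w ^ (i + 3 * k) = norm (q * x) * w ^ (j + 3 * l)"
      using arg_cong[OF eq, of norm] unfolding i(2) j(2) nX .
    then have "i + 3 * k = j + 3 * l" using x0' w_inj by simp
    then have "i mod 3 = j mod 3" by presburger
    then have "i = j" using i(1) j(1) by (auto simp: mod_Suc)
    then show False using i(2) j(2) XY(3) by simp
  qed
  have sep: "separated q {q * x, y, z}"
    unfolding separated_def using sep_aux x0 q0 w by (auto simp: y_def z_def)
  have "w ^ (3 * n + 1) \<noteq> w ^ 0" "w ^ (3 * n + 2) \<noteq> w ^ 0" "w ^ (3 * n + 1) \<noteq> w ^ (3 * n + 2)"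
    unfolding w_inj by auto
  then have ne0: "norm y \<noteq> norm (q * x)" "norm z \<noteq> norm (q * x)" "norm y \<noteq> norm z"
    unfolding ny nz using x0' by auto
  then have ne: "q * x \<noteq> y" "q * x \<noteq> z" "y \<noteq> z" by metis+
  have ok: "saal_generic q c (q * x) y z"
    unfolding saal_generic_def using sep ne small x qpoch_inf_small_nz[OF q] by auto
  define b where "b = min 1 (1 / norm c)"
  have "0 < b" using c by (simp add: b_def)
  have "finite ({q * x, y, z} \<union> A)" using fin by simp
  from exists_generic_radius[OF this \<open>0 < b\<close> q0]
  obtain r where r: "0 < r" "r < b" "\<And>X k J. X \<in> {q * x, y, z} \<union> A \<Longrightarrow> norm (X * q ^ k) \<noteq> r * norm q ^ J"
    by blast
  have r1: "r < 1" "r * norm c < 1" using r(2) c by (auto simp: b_def field_simps)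
  have rad: "\<And>X k J. X \<in> {q * x, y, z} \<Longrightarrow> norm (X * q ^ k) \<noteq> r * norm q ^ J" using r(3) by blast
  have yz: "qpoch_inf (y * z * c) q \<noteq> 0"
  proof (rule qpoch_inf_small_nz[OF q])
    have "norm (y * z * c) = norm y * norm (c * z)" by (simp add: norm_mult mult_ac)
    also have "\<dots> < 1 * 1" using small[of y] small[of z] by (intro mult_strict_mono) auto
    finally show "norm (y * z * c) < 1" by simp
  qed
  define T where "T = saal_const r h c"
  define \<Theta> where "\<Theta> = theta h q * theta (h / c) q"
  have A1: "(1 - x * y * c) * (1 - x * z * c) * saal_sum q h c (q * x) y z = \<Theta> * qpoch_inf (y * z * c) q /
        (qpoch_inf q q * qpoch_inf (y / x) q * qpoch_inf (z / x) q * qpoch_inf (q * x) q * qpoch_inf (c * (q * x)) q)"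
    unfolding \<Theta>_def by (rule saal_boundary[OF h c x(1) ok])
  have A2: "saal_sum q h c (q * x) y z = qpoch_inf (q * x * y * c) q * qpoch_inf (q * x * z * c) q * qpoch_inf (y * z * c) q
     / (qpoch_inf (q * x) q * qpoch_inf y q * qpoch_inf z q * qpoch_inf (c * (q * x)) q * qpoch_inf (c * y) q * qpoch_inf (c * z) q) * T"
    unfolding T_def by (rule saal_sum_eq_const[OF h c ok r(1) r1 rad])
  have s: "qpoch_inf (x * Y * c) q = (1 - x * Y * c) * qpoch_inf (q * x * Y * c) q" for Y
    using qpoch_inf_Suc[OF q, of "x * Y * c"] by (simp add: mult_ac)
  have A3: "qpoch_inf (x * y * c) q * qpoch_inf (x * z * c) q * qpoch_inf (y * z * c) q
     / (qpoch_inf (q * x) q * qpoch_inf y q * qpoch_inf z q * qpoch_inf (c * (q * x)) q * qpoch_inf (c * y) q * qpoch_inf (c * z) q) * T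
     = \<Theta> * qpoch_inf (y * z * c) q /
        (qpoch_inf q q * qpoch_inf (y / x) q * qpoch_inf (z / x) q * qpoch_inf (q * x) q * qpoch_inf (c * (q * x)) q)"
    unfolding A1 [symmetric] A2 s by (simp add: mult_ac)
  have nz6: "qpoch_inf y q \<noteq> 0" "qpoch_inf z q \<noteq> 0" "qpoch_inf (c * y) q \<noteq> 0" "qpoch_inf (c * z) q \<noteq> 0" "qpoch_inf q q \<noteq> 0"
    using small qpoch_inf_small_nz[OF q] q by auto
  have "T = \<Theta> / qpoch_inf q q"
    using x(1)
  proof
    assume "x = 1"
    then show ?thesis using A3 nz6 yz x(2,3) by (simp add: field_simps)
  next
    assume x1: "x = 1 / c"
    then have e: "x * y * c = y" "x * z * c = z" "y / x = c * y" "z / x = c * z" using c by auto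
    show ?thesis using A3 nz6 yz x(2,3) unfolding e by (simp add: field_simps)
  qed
  with r(1) r1 r(3) that[of r] show thesis unfolding T_def \<Theta>_def by blast
qed

text \<open>
  For \<open>h = 1 / x\<close> the residues at \<open>x q\<^sup>k\<close> vanish, and the classical formula with two series remains.
\<close>
theorem nonterminating_saalschuetz:
  assumes h: "h \<noteq> 0" and c: "c \<noteq> 0" and ok: "saal_generic q c x y z"
  shows "saal_sum q h c x y z = theta h q * theta (h / c) q
     * qpoch_inf (x * y * c) q * qpoch_inf (x * z * c) q * qpoch_inf (y * z * c) q
     / (qpoch_inf q q * qpoch_inf x q * qpoch_inf y q * qpoch_inf z q
        * qpoch_inf (c * x) q * qpoch_inf (c * y) q * qpoch_inf (c * z) q)"
proof -
  have "finite {x, y, z}" by simp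
  from saal_const_eq[OF h c this]
  obtain r where r: "0 < r" "r < 1" "r * norm c < 1"
    "\<And>X k J. X \<in> {x, y, z} \<Longrightarrow> norm (X * q ^ k) \<noteq> r * norm q ^ J"
    "saal_const r h c = theta h q * theta (h / c) q / qpoch_inf q q"
    by blast
  have "saal_sum q h c x y z = qpoch_inf (x * y * c) q * qpoch_inf (x * z * c) q * qpoch_inf (y * z * c) q
     / (qpoch_inf x q * qpoch_inf y q * qpoch_inf z q * qpoch_inf (c * x) q * qpoch_inf (c * y) q * qpoch_inf (c * z) q)
     * saal_const r h c"
    by (rule saal_sum_eq_const[OF h c ok r(1-4)])
  then show ?thesis unfolding r(5) by (simp only: times_divide_eq_left times_divide_eq_right divide_divide_eq_left mult_ac)
qed

end

section \<open>Summation of the cubic series under the contour\<close>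

definition cubic_bases :: "complex \<Rightarrow> complex \<Rightarrow> complex \<Rightarrow> complex \<Rightarrow> complex set" where
  "cubic_bases s x y z = {x, y, z, s ^ 2, \<omega> * s ^ 2, \<omega> ^ 2 * s ^ 2}"

text \<open>
  The \<open>n\<close>-th summand of the integrand and, in the next definition, the numerator of its sum over \<open>n\<close>.
\<close>
definition kernel_vwp :: "complex \<Rightarrow> complex \<Rightarrow> complex \<Rightarrow> complex \<Rightarrow> nat \<Rightarrow> complex \<Rightarrow> complex" where
  "kernel_vwp q a h c n t = theta_kernel q h c t * vwp6 a q n (1 / t)"

definition cubic_num :: "complex \<Rightarrow> complex \<Rightarrow> complex \<Rightarrow> complex \<Rightarrow> complex \<Rightarrow> complex" where
  "cubic_num q a h c t = theta_kernel q h c t * (qpoch_inf (a * q ^ 3) (q ^ 3) * qpoch_inf (a / t ^ 2) q)"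

lemma cube_root_factor: "(1 - t) * (1 - \<omega> * t) * (1 - \<omega> ^ 2 * t) = 1 - t ^ 3"
  using omega_cube omega_sum by algebra

lemma circle_mean_sum:
  assumes "r > 0" "\<And>n. n \<in> A \<Longrightarrow> continuous_on (sphere 0 r) (f n)" "finite A"
  shows "circle_mean r (\<lambda>t. \<Sum>n\<in>A. f n t) = (\<Sum>n\<in>A. circle_mean r (f n))"
  unfolding circle_mean_def sum_divide_distrib
  by (subst contour_integral_sum) (use assms circle_mean_integrable in \<open>auto simp: sum_divide_distrib\<close>)

lemma qpochs_Suc: "qpochs as q (Suc k) = qpochs as q k * (\<Prod>a\<leftarrow>as. 1 - a * q ^ k)"
  by (induction as) (simp_all add: qpochs_def qpoch_Suc mult_ac)

lemma qpochs_0: "qpochs as q 0 = 1"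
  by (induction as) (simp_all add: qpochs_def)

text \<open>
  Identifies the sum of the residues along one progression with a basic hypergeometric series, from the term ratio alone.
\<close>
lemma suminf_eq_qhyp:
  assumes "\<And>k. f (Suc k) = (\<Prod>a\<leftarrow>as. 1 - a * q ^ k) / (\<Prod>b\<leftarrow>q # bs. 1 - b * q ^ k) * q * f k"
    and "summable f"
  shows "(\<Sum>k. f k) = f 0 * qhyp as bs q q"
proof -
  define T where "T k = qpochs as q k / qpochs (q # bs) q k * q ^ k" for k
  have f: "f k = f 0 * T k" for k
  proof (induction k)
    case (Suc k)
    have "T (Suc k) = (\<Prod>a\<leftarrow>as. 1 - a * q ^ k) / (\<Prod>b\<leftarrow>q # bs. 1 - b * q ^ k) * q * T k"
      unfolding T_def qpochs_Suc by (simp add: mult_ac)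
    then show ?case unfolding assms(1)[of k] Suc by simp
  qed (simp add: T_def qpochs_0)
  show ?thesis
  proof (cases "f 0 = 0")
    case True
    have "f k = 0" for k using f[of k] unfolding True by simp
    then show ?thesis by simp
  next
    case False
    have "T k = f k / f 0" for k using False by (subst f[of k]) simp
    then have "summable T" using summable_divide[OF assms(2), of "f 0"] by presburger
    then have "(\<Sum>k. f 0 * T k) = f 0 * suminf T" by (rule suminf_mult)
    moreover have "suminf T = qhyp as bs q q" unfolding T_def qhyp_def ..
    moreover have "f = (\<lambda>k. f 0 * T k)" using f by (rule ext)
    ultimately show ?thesis by metis
  qed
qed

context nome
begin

lemma theta_kernel_mult_q:
  assumes "h \<noteq> 0" "c \<noteq> 0" "t \<noteq> 0" "qpoch_inf t q \<noteq> 0" "qpoch_inf (c * t) q \<noteq> 0"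
  shows "theta_kernel q h c (q * t) = (1 - t) * (1 - c * t) / (c * q * t^2) * theta_kernel q h c t"
  using saal_num_mult_q[OF assms, of 0] by (simp add: saal_num_def theta_kernel_def qpoch_inf_0[OF q])

lemma theta_kernel_holomorphic: "h \<noteq> 0 \<Longrightarrow> c \<noteq> 0 \<Longrightarrow> theta_kernel q h c holomorphic_on regular_dom c"
  unfolding theta_kernel_def by (intro holomorphic_intros q) (auto simp: regular_dom_def)

lemma vwp6_holomorphic: "(\<lambda>t. vwp6 a q n (1 / t)) holomorphic_on regular_dom c"
  unfolding vwp6_def rpoch_def by (intro holomorphic_intros q) (auto simp: regular_dom_def)

text \<open>
  Only the existence of the residue is recorded: its value enters the sums before and after the summation over \<open>n\<close> in the same way.
\<close>
lemma theta_kernel_pole: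
  assumes "h \<noteq> 0" "c \<noteq> 0" "norm (c / q ^ k) < 1"
  shows "\<exists>m. ((\<lambda>t. (t - 1 / q ^ k) * theta_kernel q h c t) \<longlongrightarrow> m) (at (1 / q ^ k))"
proof -
  define p where "p = 1 / q ^ k"
  have p0: "p \<noteq> 0" using q0 by (simp add: p_def)
  define f where "f t = theta (h * t) q * theta (h / (c * t)) q
     / ((- (q ^ k)) * qpoch t q k * qpoch_inf (t * q ^ Suc k) q * qpoch_inf (c * t) q)" for t
  have nz: "(- (q ^ k)) * qpoch p q k * qpoch_inf (p * q ^ Suc k) q * qpoch_inf (c * p) q \<noteq> 0"
  proof -
    have "p * q ^ Suc k = q" using q0 by (simp add: p_def)
    moreover have "qpoch_inf (c * p) q \<noteq> 0" using assms(3) by (intro qpoch_inf_small_nz[OF q]) (simp add: p_def)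
    ultimately show ?thesis using q0 qpoch_inf_q_nz[OF q] qpoch_inverse_power_nz by (simp add: p_def)
  qed
  have "(f \<longlongrightarrow> f p) (at p)"
    unfolding f_def theta_eq[OF q] qpoch_def using nz p0 assms(1,2)
    by (intro tendsto_intros q) (auto simp: qpoch_def)
  moreover have "\<forall>\<^sub>F t in at p. f t = (t - p) * theta_kernel q h c t"
  proof -
    have "\<forall>\<^sub>F t in at p. t \<noteq> p" by (rule eventually_neq_at_within)
    then show ?thesis
    proof eventually_elim
      case (elim t)
      have "qpoch_inf t q = qpoch t q k * ((1 - t * q ^ k) * qpoch_inf (t * q ^ Suc k) q)"
        using qpoch_inf_split[OF q, of t k] qpoch_inf_Suc[OF q, of "t * q ^ k"] by (simp add: mult_ac)
      also have "1 - t * q ^ k = - (q ^ k) * (t - p)" using q0 by (simp add: p_def algebra_simps)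
      finally show ?case using elim by (simp add: f_def theta_kernel_def)
    qed
  qed
  ultimately have "((\<lambda>t. (t - p) * theta_kernel q h c t) \<longlongrightarrow> f p) (at p)"
    by (simp add: Lim_transform_eventually)
  then show ?thesis unfolding p_def by blast
qed

lemma vwp6_inverse_mult_q:
  assumes "t \<noteq> 0" "t \<noteq> 1"
  shows "vwp6 a q n (1 / (q * t)) = (1 - a * q ^ (3 * n) / t) * (1 - t * q ^ (3 * n)) / (q ^ (3 * n) * (1 - t)) * vwp6 a q n (1 / t)"
proof -
  define m where "m = 3 * n"
  have "rpoch (1 / t) q m * (1 / t - q ^ m) = q ^ m * (1 / t - 1) * rpoch (1 / (q * t)) q m"
    using rpoch_mult_q[of q "1 / (q * t)" m] q0 by (simp add: rpoch_Suc)
  then have "rpoch (1 / (q * t)) q m = (1 / t - q ^ m) / (q ^ m * (1 / t - 1)) * rpoch (1 / t) q m"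
    using assms q0 by (simp add: eq_divide_eq mult_ac)
  also have "(1 / t - q ^ m) / (q ^ m * (1 / t - 1)) = (1 - t * q ^ m) / (q ^ m * (1 - t))"
    using assms q0 by (simp add: divide_simps)
  finally have 1: "rpoch (1 / (q * t)) q m = (1 - t * q ^ m) / (q ^ m * (1 - t)) * rpoch (1 / t) q m" .
  have 2: "qpoch_inf (a * q ^ (m + 1) * (1 / (q * t))) q = (1 - a * q ^ m / t) * qpoch_inf (a * q ^ (m + 1) * (1 / t)) q"
    using qpoch_inf_Suc[OF q, of "a * q ^ m / t"] q0 by (simp add: mult_ac)
  show ?thesis unfolding vwp6_def m_def [symmetric] 1 2 by (simp add: mult_ac)
qed

text \<open>
  Again the limit of the multiplier at the origin is \<open>q\<close>, because \<open>x y z c = q a\<close>.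
\<close>
lemma contracting_kernel_vwp:
  assumes "h \<noteq> 0" "c \<noteq> 0" "x \<noteq> 0" "y \<noteq> 0" "z \<noteq> 0" "x \<noteq> y" "x \<noteq> z" "y \<noteq> z" "x * y * z * c = q * a"
  shows "contracting (kernel_vwp q a h c n) {x, y, z}
     (\<lambda>t. (t - a * q ^ (3 * n)) * (1 - t * q ^ (3 * n)) * (1 - c * t) /
       (c * q * q ^ (3 * n) * ((t - x / q) * (t - y / q) * (t - z / q))))"
    (is "contracting ?N ?B ?\<rho>")
proof -
  note xyz = assms(3-5)
  define Q where "Q = q ^ (3 * n)"
  have Q0: "Q \<noteq> 0" using q0 by (simp add: Q_def)
  define \<delta>' where "\<delta>' = min (min 1 (1 / norm c)) (min (norm (x/q)) (min (norm (y/q)) (norm (z/q))))"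
  have d': "\<delta>' > 0" using assms(2) xyz q0 by (simp add: \<delta>'_def)
  have step: "?N (q * t) = ?\<rho> t * (\<Prod>Y\<in>?B. 1 - Y / (q * t)) * ?N t" if t: "0 < norm t" "norm t < \<delta>'" for t
  proof -
    have nt: "t \<noteq> 0" "t \<noteq> 1" "t \<noteq> x / q" "t \<noteq> y / q" "t \<noteq> z / q" using t by (auto simp: \<delta>'_def)
    have "t \<in> regular_dom c" using t assms(2) by (intro regular_dom_small) (auto simp: \<delta>'_def norm_mult field_simps)
    then have dom: "qpoch_inf t q \<noteq> 0" "qpoch_inf (c * t) q \<noteq> 0" by (auto simp: regular_dom_def)
    have e1: "1 - Y / (q * t) = (t - Y / q) / t" for Y using nt q0 by (simp add: field_simps)
    have e2: "1 - a * Q / t = (t - a * Q) / t" using nt by (simp add: field_simps)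
    have "?\<rho> t * (\<Prod>Y\<in>?B. 1 - Y / (q * t)) = (1 - t) * (1 - c * t) / (c * q * t^2)
       * ((1 - a * Q / t) * (1 - t * Q) / (Q * (1 - t)))"
    proof -
      define X1 where "X1 = t - x / q"
      define X2 where "X2 = t - y / q"
      define X3 where "X3 = t - z / q"
      define A1 where "A1 = t - a * Q"
      define A2 where "A2 = 1 - t * Q"
      define A3 where "A3 = 1 - c * t"
      define A4 where "A4 = 1 - t"
      have nz: "X1 \<noteq> 0" "X2 \<noteq> 0" "X3 \<noteq> 0" "A4 \<noteq> 0" using nt by (auto simp: X1_def X2_def X3_def A4_def)
      show ?thesis
        unfolding prod3[OF assms(6-8)] e1 e2 Q_def [symmetric]
        unfolding X1_def [symmetric] X2_def [symmetric] X3_def [symmetric] A1_def [symmetric] A2_def [symmetric]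
          A3_def [symmetric] A4_def [symmetric]
        using nz nt(1) assms(2) q0 Q0 by (simp add: power2_eq_square mult_ac)
    qed
    moreover have "?N (q * t) = (1 - t) * (1 - c * t) / (c * q * t^2)
       * ((1 - a * Q / t) * (1 - t * Q) / (Q * (1 - t))) * ?N t"
      unfolding kernel_vwp_def theta_kernel_mult_q[OF assms(1,2) nt(1) dom] vwp6_inverse_mult_q[OF nt(1,2)] Q_def
      by (simp only: mult_ac)
    ultimately show ?thesis by (simp only:)
  qed
  have lim: "(?\<rho> \<longlongrightarrow> (0 - a * q ^ (3 * n)) * (1 - 0 * q ^ (3 * n)) * (1 - c * 0) / (c * q * q ^ (3 * n) * ((0 - x / q) * (0 - y / q) * (0 - z / q)))) (at 0)"
    using xyz q0 assms(2) by (intro tendsto_intros) auto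
  have val: "(0 - a * Q) * (1 - 0 * Q) * (1 - c * 0) / (c * q * Q * ((0 - x / q) * (0 - y / q) * (0 - z / q))) = q"
  proof -
    have "(0 - a * Q) * (1 - 0 * Q) * (1 - c * 0) / (c * q * Q * ((0 - x / q) * (0 - y / q) * (0 - z / q)))
       = (q * a) * q / (x * y * z * c)"
    proof -
      have "(0 - x / q) * (0 - y / q) * (0 - z / q) = - (x * y * z / (q * q * q))" by simp
      then show ?thesis using xyz q0 assms(2) Q0 by (simp add: mult_ac)
    qed
    also have "\<dots> = q"
    proof -
      have "x * y * z * c \<noteq> 0" using xyz assms(2) by simp
      then have "q * a \<noteq> 0" unfolding assms(9) .
      then show ?thesis unfolding assms(9) by simp
    qed
    finally show ?thesis .
  qed
  have "(?\<rho> \<longlongrightarrow> q) (at 0)" using lim unfolding Q_def [symmetric] val .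
  with step show ?thesis unfolding contracting_def using q d' by blast
qed

lemma pole_term_scale:
  assumes "b \<noteq> 0" "N (X * q ^ k) = \<kappa> * N' (b * (X * q ^ k))" "X \<in> B"
  shows "pole_term q N B X k = \<kappa> * pole_term q N' ((*) b ` B) (b * X) k"
proof -
  have "(*) b ` B - {b * X} = (*) b ` (B - {X})" using assms(1) by auto
  moreover have "inj_on ((*) b) (B - {X})" using assms(1) by (auto simp: inj_on_def)
  ultimately show ?thesis
    unfolding pole_term_def assms(2) using assms(1) by (simp add: prod.reindex mult.assoc)
qed

lemma saal_generic_scale:
  assumes "saal_generic q c x y z"
  shows "saal_generic q (c / q ^ m) (q ^ m * x) (q ^ m * y) (q ^ m * z)"
proof -
  have sep: "separated q {x, y, z}" and ne: "x \<noteq> y" "x \<noteq> z" "y \<noteq> z"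
    and nz: "\<And>X. X \<in> {x, y, z} \<Longrightarrow> qpoch_inf X q \<noteq> 0" "\<And>X. X \<in> {x, y, z} \<Longrightarrow> qpoch_inf (c * X) q \<noteq> 0"
    using assms by (auto simp: saal_generic_def)
  have Q0: "q ^ m \<noteq> 0" using q0 by simp
  have im: "{q ^ m * x, q ^ m * y, q ^ m * z} = (*) (q ^ m) ` {x, y, z}" by simp
  have "separated q ((*) (q ^ m) ` {x, y, z})"
    unfolding separated_def
  proof (intro conjI ballI impI allI)
    fix X' Y' k l assume "X' \<in> (*) (q ^ m) ` {x, y, z}" "Y' \<in> (*) (q ^ m) ` {x, y, z}" "X' \<noteq> Y'"
    then obtain X Y where XY: "X' = q ^ m * X" "Y' = q ^ m * Y" "X \<in> {x, y, z}" "Y \<in> {x, y, z}" "X \<noteq> Y" by blast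
    then have "X * q ^ k \<noteq> Y * q ^ l" using sep unfolding separated_def by blast
    then show "X' * q ^ k \<noteq> Y' * q ^ l" using Q0 by (simp add: XY mult.assoc)
  qed (use sep q0 in \<open>auto simp: separated_def\<close>)
  moreover have "c / q ^ m * (q ^ m * X) = c * X" for X using q0 by simp
  moreover have "qpoch_inf (q ^ m * X) q \<noteq> 0" if "X \<in> {x, y, z}" for X
    using qpoch_inf_shift_nz[OF q nz(1)[OF that], of m] by (simp add: mult.commute)
  ultimately show ?thesis
    unfolding saal_generic_def im [symmetric] using ne nz Q0 by auto
qed

text \<open>
  The factor \<open>(t; q)\<^bsub>3 n\<^esub>\<close> shortens \<open>(t)\<^sub>\<infinity>\<close> to \<open>(q\<^bsup>3 n\<^esup> t)\<^sub>\<infinity>\<close>, and the first theta function absorbs the shift of its argument by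
  quasi-periodicity. So the integrand is a Saalschuetz integrand in the variable \<open>q\<^bsup>3 n\<^esup> t\<close>, with \<open>c\<close> replaced by \<open>c / q\<^bsup>3 n\<^esup>\<close>.
\<close>
lemma kernel_vwp_eq_saal:
  fixes n :: nat
  assumes h: "h \<noteq> 0" and c: "c \<noteq> 0" and t: "t \<noteq> 0" "qpoch_inf t q \<noteq> 0"
  defines "m \<equiv> 3 * n"
  shows "kernel_vwp q a h c n t =
     (1 - a * q ^ (6 * n)) / (1 - a) * qpoch a (q^3) n / qpoch (q^3) (q^3) n * a ^ n * ((- h) ^ m * q ^ (m * (m - 1) div 2))
     * saal_num q h (c / q ^ m) (q ^ (2 * m) * (q * a)) (q ^ m * t)"
proof -
  define E where "E = q ^ (m * (m - 1) div 2)"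
  define Q where "Q = q ^ m"
  have Q0: "Q \<noteq> 0" "E \<noteq> 0" using q0 by (auto simp: Q_def E_def)
  define P where "P = qpoch t q m"
  have 1: "qpoch_inf t q = P * qpoch_inf (Q * t) q"
    using qpoch_inf_split[OF q, of t m] by (simp add: P_def Q_def mult_ac)
  then have P0: "P \<noteq> 0" "qpoch_inf (Q * t) q \<noteq> 0" using t by auto
  have 2: "theta (h * (Q * t)) q = theta (h * t) q / ((- h * t) ^ m * E)"
    using theta_mult_power[OF q q0, of "h * t" m] h t by (simp add: Q_def E_def mult_ac)
  have 3: "c / Q * (Q * t) = c * t" using Q0 by simp
  have 4: "q ^ (2 * m) * (q * a) / (Q * t) = a * q ^ (m + 1) / t"
  proof -
    have "q ^ (2 * m) = Q * Q" "q ^ (m + 1) = q * Q" by (simp_all add: Q_def mult_2 power_add)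
    then show ?thesis unfolding Q_def [symmetric] using Q0 by (simp only:) simp
  qed
  have 5: "rpoch (1 / t) q m = P / t ^ m"
    using qpoch_eq_rpoch[of "1 / t" q m] t by (simp add: P_def power_divide)
  have "saal_num q h (c / Q) (q ^ (2 * m) * (q * a)) (Q * t)
     = theta (h * t) q / ((- h) ^ m * t ^ m * E) * theta (h / (c * t)) q * qpoch_inf (a * q ^ (m + 1) / t) q / (qpoch_inf (Q * t) q * qpoch_inf (c * t) q)"
    unfolding saal_num_def 2 3 4 power_mult_distrib ..
  then show ?thesis
    unfolding kernel_vwp_def theta_kernel_def vwp6_def m_def [symmetric] E_def [symmetric] Q_def [symmetric] 1 5
    using P0 Q0 h t by (simp add: power_mult_distrib mult_ac)
qed

text \<open>
  The Saalschuetz sum with parameters \<open>q\<^bsup>3 n\<^esup> x, q\<^bsup>3 n\<^esup> y, q\<^bsup>3 n\<^esup> z\<close> and \<open>c / q\<^bsup>3 n\<^esup>\<close>. The quasi-periodicity factors of the two theta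
  functions combine to \<open>c\<^bsup>3 n\<^esup>\<close>, which gives the argument \<open>a c\<^sup>3\<close> of the very-well-poised series.
\<close>
lemma kernel_vwp_sum:
  assumes h: "h \<noteq> 0" and c: "c \<noteq> 0" and ok: "saal_generic q c x y z" and e: "x * y * z * c = q * a"
    and nzl: "qpoch_inf (x * y * c) q \<noteq> 0" "qpoch_inf (x * z * c) q \<noteq> 0" "qpoch_inf (y * z * c) q \<noteq> 0"
  shows "(\<Sum>X\<in>{x, y, z}. \<Sum>k. pole_term q (kernel_vwp q a h c n) {x, y, z} X k) =
     (1 - a * q ^ (6 * n)) / (1 - a) * qpoch a (q^3) n / qpoch (q^3) (q^3) n * (a * c ^ 3) ^ n
     * (qpoch x q (3 * n) * qpoch y q (3 * n) * qpoch z q (3 * n))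
     / (qpoch (x * y * c) q (3 * n) * qpoch (x * z * c) q (3 * n) * qpoch (y * z * c) q (3 * n))
     * (theta h q * theta (h / c) q * qpoch_inf (x * y * c) q * qpoch_inf (x * z * c) q * qpoch_inf (y * z * c) q
     / (qpoch_inf q q * qpoch_inf x q * qpoch_inf y q * qpoch_inf z q
        * qpoch_inf (c * x) q * qpoch_inf (c * y) q * qpoch_inf (c * z) q))"
proof -
  define m where "m = 3 * n"
  define Q where "Q = q ^ m"
  define B where "B = {x, y, z}"
  define E where "E = q ^ (m * (m - 1) div 2)"
  define C where "C = (1 - a * q ^ (6 * n)) / (1 - a) * qpoch a (q^3) n / qpoch (q^3) (q^3) n"
  define \<kappa> where "\<kappa> = C * a ^ n * ((- h) ^ m * E)"
  define N' where "N' = saal_num q h (c / Q) (Q * x * (Q * y) * (Q * z) * (c / Q))"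
  have Q0: "Q \<noteq> 0" "E \<noteq> 0" using q0 by (auto simp: Q_def E_def)
  have ne: "x \<noteq> y" "x \<noteq> z" "y \<noteq> z" and sep: "separated q B"
    and nz: "\<And>X. X \<in> B \<Longrightarrow> qpoch_inf X q \<noteq> 0" "\<And>X. X \<in> B \<Longrightarrow> qpoch_inf (c * X) q \<noteq> 0"
    using ok by (auto simp: saal_generic_def B_def)
  have xyz: "x \<noteq> 0" "y \<noteq> 0" "z \<noteq> 0" using sep by (auto simp: B_def separated_def)
  have ok': "saal_generic q (c / Q) (Q * x) (Q * y) (Q * z)" unfolding Q_def by (rule saal_generic_scale[OF ok])
  have e': "Q * x * (Q * y) * (Q * z) * (c / Q) = q ^ (2 * m) * (q * a)"
  proof -
    have "q ^ (2 * m) = Q * Q" by (simp add: Q_def mult_2 power_add)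
    then show ?thesis using Q0 e [symmetric] by (simp add: mult_ac)
  qed
  have pt: "pole_term q (kernel_vwp q a h c n) B X k = \<kappa> * pole_term q N' {Q * x, Q * y, Q * z} (Q * X) k" if X: "X \<in> B" for X k
  proof -
    have X0: "X * q ^ k \<noteq> 0" "qpoch_inf (X * q ^ k) q \<noteq> 0"
      using X sep q0 qpoch_inf_shift_nz[OF q nz(1)[OF X]] by (auto simp: separated_def)
    have "kernel_vwp q a h c n (X * q ^ k) = \<kappa> * N' (Q * (X * q ^ k))"
    proof -
      have "N' = saal_num q h (c / q ^ m) (q ^ (2 * m) * (q * a))"
        unfolding N'_def e' unfolding Q_def ..
      then show ?thesis
        unfolding kernel_vwp_eq_saal[OF h c X0] \<kappa>_def C_def E_def Q_def m_def by simp
    qed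
    from pole_term_scale[where b = Q and N' = N' and N = "kernel_vwp q a h c n" and X = X and k = k and \<kappa> = \<kappa> and B = B, OF Q0(1) this X] show ?thesis by (simp add: B_def)
  qed
  have "(\<Sum>X\<in>B. \<Sum>k. pole_term q (kernel_vwp q a h c n) B X k) = (\<Sum>X\<in>B. \<Sum>k. \<kappa> * pole_term q N' {Q * x, Q * y, Q * z} (Q * X) k)"
    using pt by simp
  also have "\<dots> = (\<Sum>X\<in>B. \<kappa> * (\<Sum>k. pole_term q N' {Q * x, Q * y, Q * z} (Q * X) k))"
  proof (intro sum.cong refl suminf_mult)
    fix X assume X: "X \<in> B"
    have ne': "Q * x \<noteq> Q * y" "Q * x \<noteq> Q * z" "Q * y \<noteq> Q * z" using ne Q0 by auto
    have "\<exists>\<rho>. contracting N' {Q * x, Q * y, Q * z} \<rho>"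
      unfolding N'_def using contracting_saal[OF h _ _ _ _ ne' refl, of "c / Q"] c Q0 xyz by auto
    then show "summable (pole_term q N' {Q * x, Q * y, Q * z} (Q * X))"
      using pole_term_summable[of "{Q * x, Q * y, Q * z}" "Q * X" N'] ok' X by (auto simp: saal_generic_def B_def)
  qed
  also have "\<dots> = \<kappa> * (\<Sum>X\<in>(*) Q ` B. \<Sum>k. pole_term q N' {Q * x, Q * y, Q * z} X k)"
    using Q0 by (subst sum.reindex) (auto simp: inj_on_def sum_distrib_left)
  also have "(*) Q ` B = {Q * x, Q * y, Q * z}" by (simp add: B_def)
  also have "(\<Sum>X\<in>{Q * x, Q * y, Q * z}. \<Sum>k. pole_term q N' {Q * x, Q * y, Q * z} X k) = saal_sum q h (c / Q) (Q * x) (Q * y) (Q * z)"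
    by (simp only: saal_sum_def N'_def)
  also have "\<dots> = theta h q * theta (h / (c / Q)) q
     * qpoch_inf (Q * x * (Q * y) * (c / Q)) q * qpoch_inf (Q * x * (Q * z) * (c / Q)) q * qpoch_inf (Q * y * (Q * z) * (c / Q)) q
     / (qpoch_inf q q * qpoch_inf (Q * x) q * qpoch_inf (Q * y) q * qpoch_inf (Q * z) q
        * qpoch_inf (c / Q * (Q * x)) q * qpoch_inf (c / Q * (Q * y)) q * qpoch_inf (c / Q * (Q * z)) q)"
    using h c Q0 by (intro nonterminating_saalschuetz[OF _ _ ok']) auto
  also have "theta (h / (c / Q)) q = theta (h / c) q / ((- h / c) ^ m * E)"
    using theta_mult_power[OF q q0, of "h / c" m] h c by (simp add: Q_def E_def mult_ac)
  also have "qpoch_inf (Q * x * (Q * y) * (c / Q)) q = qpoch_inf (x * y * c) q / qpoch (x * y * c) q m"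
    using qpoch_inf_split[OF q, of "x * y * c" m] qpoch_nz[OF q nzl(1), of m] Q0 by (simp add: Q_def mult_ac)
  also have "qpoch_inf (Q * x * (Q * z) * (c / Q)) q = qpoch_inf (x * z * c) q / qpoch (x * z * c) q m"
    using qpoch_inf_split[OF q, of "x * z * c" m] qpoch_nz[OF q nzl(2), of m] Q0 by (simp add: Q_def mult_ac)
  also have "qpoch_inf (Q * y * (Q * z) * (c / Q)) q = qpoch_inf (y * z * c) q / qpoch (y * z * c) q m"
    using qpoch_inf_split[OF q, of "y * z * c" m] qpoch_nz[OF q nzl(3), of m] Q0 by (simp add: Q_def mult_ac)
  also have "qpoch_inf (Q * x) q = qpoch_inf x q / qpoch x q m"
    using qpoch_inf_split[OF q, of x m] qpoch_nz[OF q nz(1), of x m] by (simp add: Q_def B_def mult_ac)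
  also have "qpoch_inf (Q * y) q = qpoch_inf y q / qpoch y q m"
    using qpoch_inf_split[OF q, of y m] qpoch_nz[OF q nz(1), of y m] by (simp add: Q_def B_def mult_ac)
  also have "qpoch_inf (Q * z) q = qpoch_inf z q / qpoch z q m"
    using qpoch_inf_split[OF q, of z m] qpoch_nz[OF q nz(1), of z m] by (simp add: Q_def B_def mult_ac)
  also have "c / Q * (Q * x) = c * x" using Q0 by simp
  also have "c / Q * (Q * y) = c * y" using Q0 by simp
  also have "c / Q * (Q * z) = c * z" using Q0 by simp
  finally have *: "(\<Sum>X\<in>B. \<Sum>k. pole_term q (kernel_vwp q a h c n) B X k) =
     \<kappa> * (theta h q * (theta (h / c) q / ((- h / c) ^ m * E))
     * (qpoch_inf (x * y * c) q / qpoch (x * y * c) q m) * (qpoch_inf (x * z * c) q / qpoch (x * z * c) q m) * (qpoch_inf (y * z * c) q / qpoch (y * z * c) q m)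
     / (qpoch_inf q q * (qpoch_inf x q / qpoch x q m) * (qpoch_inf y q / qpoch y q m) * (qpoch_inf z q / qpoch z q m)
        * qpoch_inf (c * x) q * qpoch_inf (c * y) q * qpoch_inf (c * z) q))" .
  have p1: "(a * c ^ 3) ^ n = a ^ n * c ^ m" by (simp add: m_def power_mult_distrib power_mult)
  have p2: "(- h) ^ m * E / ((- h / c) ^ m * E) = c ^ m"
  proof -
    have "(- h) ^ m = (- h / c) ^ m * c ^ m" using c by (simp add: power_mult_distrib [symmetric])
    moreover have "(- h / c) ^ m \<noteq> 0" using h c by simp
    ultimately show ?thesis using Q0 by simp
  qed
  have "\<kappa> / ((- h / c) ^ m * E) = C * a ^ n * ((- h) ^ m * E / ((- h / c) ^ m * E))"
    unfolding \<kappa>_def by (rule times_divide_eq_right [symmetric])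
  then have k: "\<kappa> / ((- h / c) ^ m * E) = C * (a * c ^ 3) ^ n"
    unfolding p1 p2 by (simp only: mult.assoc)
  show ?thesis unfolding B_def [symmetric] * m_def [symmetric] C_def [symmetric] k [symmetric] by (simp add: mult_ac)
qed

lemma cubic_num_mult_q:
  assumes "h \<noteq> 0" "c \<noteq> 0" "t \<noteq> 0" "qpoch_inf t q \<noteq> 0" "qpoch_inf (c * t) q \<noteq> 0"
  shows "cubic_num q a h c (q * t) = (1 - t) * (1 - c * t) / (c * q * t^2) * ((1 - a / (q * t^2)) * (1 - a / (q^2 * t^2)))
     * cubic_num q a h c t"
proof -
  have "qpoch_inf (a / (q * t) ^ 2) q = (1 - a / (q^2 * t^2)) * ((1 - a / (q * t^2)) * qpoch_inf (a / t ^ 2) q)"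
    using qpoch_inf_Suc[OF q, of "a / (q * t) ^ 2"] qpoch_inf_Suc[OF q, of "a / (q * t^2)"] q0
    by (simp add: power_mult_distrib power2_eq_square mult_ac)
  then show ?thesis unfolding cubic_num_def theta_kernel_mult_q[OF assms] by (simp only: mult_ac)
qed

lemma cubic_bases_prod:
  fixes f :: "complex \<Rightarrow> complex"
  assumes "distinct [x, y, z, s ^ 2, \<omega> * s ^ 2, \<omega> ^ 2 * s ^ 2]"
  shows "(\<Prod>X\<in>cubic_bases s x y z. f X) = f x * f y * f z * (f (s ^ 2) * f (\<omega> * s ^ 2) * f (\<omega> ^ 2 * s ^ 2))"
proof -
  have "cubic_bases s x y z = set [x, y, z, s ^ 2, \<omega> * s ^ 2, \<omega> ^ 2 * s ^ 2]" by (simp add: cubic_bases_def)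
  then show ?thesis using prod.distinct_set_conv_list[OF assms, of f] by (simp add: mult_ac)
qed

text \<open>
  The quotient of consecutive residues, as a function of the pole \<open>t\<close>. It is the same for all six progressions; substituting \<open>t = X q\<^sup>k\<close>
  yields the parameters of the six \<open>6\<phi>5\<close> series.
\<close>
definition cubic_ratio :: "complex \<Rightarrow> complex \<Rightarrow> complex \<Rightarrow> complex \<Rightarrow> complex \<Rightarrow> complex \<Rightarrow> complex" where
  "cubic_ratio a c x y z t = (1 - t) * (1 - c * t) * (1 - q * t^2 / a) * (1 - q^2 * t^2 / a) /
     ((1 - q * t / x) * (1 - q * t / y) * (1 - q * t / z) * (1 - (q * t)^3 / a)) * q"

lemma cubic_ratio_prod:
  assumes dist: "distinct [x, y, z, s ^ 2, \<omega> * s ^ 2, \<omega> ^ 2 * s ^ 2]"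
    and nz: "x \<noteq> 0" "y \<noteq> 0" "z \<noteq> 0" "s \<noteq> 0" "c \<noteq> 0" and t: "t \<noteq> 0"
    and a: "a = s ^ 6" and e: "x * y * z * c = q * a"
    and P0: "\<And>X. X \<in> cubic_bases s x y z \<Longrightarrow> 1 - X / (q * t) \<noteq> 0"
  shows "cubic_ratio a c x y z t * (\<Prod>X\<in>cubic_bases s x y z. 1 - X / (q * t))
    = (1 - t) * (1 - c * t) / (c * q * t^2) * ((1 - a / (q * t^2)) * (1 - a / (q^2 * t^2)))"
proof -
  define w where "w = q * t"
  have w0: "w \<noteq> 0" using q0 t by (simp add: w_def)
  have a0: "a \<noteq> 0" using nz a by simp
  define P1 where "P1 = 1 - x / w"
  define P2 where "P2 = 1 - y / w"
  define P3 where "P3 = 1 - z / w"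
  define P4 where "P4 = 1 - a / w ^ 3"
  define M1 where "M1 = 1 - a / (q * t^2)"
  define M2 where "M2 = 1 - a / (q^2 * t^2)"
  have "(s ^ 2 / w) ^ 3 = a / w ^ 3" by (simp add: a power_divide flip: power_mult)
  then have P4: "(1 - s ^ 2 / w) * (1 - \<omega> * s ^ 2 / w) * (1 - \<omega> ^ 2 * s ^ 2 / w) = P4"
    using cube_root_factor[of "s ^ 2 / w"] by (simp add: P4_def)
  have prod: "(\<Prod>X\<in>cubic_bases s x y z. 1 - X / (q * t)) = P1 * P2 * P3 * P4"
    unfolding cubic_bases_prod[OF dist] w_def [symmetric] P4 by (simp add: P1_def P2_def P3_def)
  have nzP: "P1 \<noteq> 0" "P2 \<noteq> 0" "P3 \<noteq> 0"
    using P0[of x] P0[of y] P0[of z] by (auto simp: cubic_bases_def P1_def P2_def P3_def w_def)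
  have nzP4: "P4 \<noteq> 0"
    using P0[of "s^2"] P0[of "\<omega> * s^2"] P0[of "\<omega>^2 * s^2"] unfolding P4 [symmetric] w_def [symmetric]
    by (simp add: cubic_bases_def)
  have d: "1 - w / x = - (w / x) * P1" "1 - w / y = - (w / y) * P2" "1 - w / z = - (w / z) * P3"
    "1 - w ^ 3 / a = - (w ^ 3 / a) * P4" "1 - q * t^2 / a = - (q * t^2 / a) * M1" "1 - q^2 * t^2 / a = - (q^2 * t^2 / a) * M2"
    using nz a0 w0 q0 t by (auto simp: P1_def P2_def P3_def P4_def M1_def M2_def right_diff_distrib)
  have "(q * t^2 / a) * (q^2 * t^2 / a) * q / ((w / x) * (w / y) * (w / z) * (w ^ 3 / a)) = x * y * z / (a * q^2 * t^2)"
    using nz a0 q0 t by (simp add: w_def field_simps eval_nat_numeral)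
  also have "\<dots> = 1 / (c * q * t^2)"
    using e nz a0 q0 t by (simp add: field_simps power2_eq_square)
  finally have k: "(q * t^2 / a) * (q^2 * t^2 / a) * q / ((w / x) * (w / y) * (w / z) * (w ^ 3 / a)) = 1 / (c * q * t^2)" .
  have "cubic_ratio a c x y z t * (P1 * P2 * P3 * P4) =
      (1 - t) * (1 - c * t) * (M1 * M2) * ((q * t^2 / a) * (q^2 * t^2 / a) * q / ((w / x) * (w / y) * (w / z) * (w ^ 3 / a)))"
    unfolding cubic_ratio_def w_def [symmetric] d using nzP nzP4 w0 nz a0 by (simp add: mult_ac)
  then show ?thesis unfolding k prod M1_def M2_def by simp
qed

text \<open>
  Here the limit of the multiplier at the origin is visibly \<open>q\<close>, the argument of the \<open>6\<phi>5\<close> series.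
\<close>
lemma contracting_cubic:
  assumes dist: "distinct [x, y, z, s ^ 2, \<omega> * s ^ 2, \<omega> ^ 2 * s ^ 2]"
    and nz: "x \<noteq> 0" "y \<noteq> 0" "z \<noteq> 0" "s \<noteq> 0" "c \<noteq> 0" and h: "h \<noteq> 0"
    and a: "a = s ^ 6" and e: "x * y * z * c = q * a"
  shows "contracting (cubic_num q a h c) (cubic_bases s x y z) (cubic_ratio a c x y z)"
proof -
  let ?B = "cubic_bases s x y z"
  have B: "finite ?B" "0 \<notin> ?B" using nz by (auto simp: cubic_bases_def \<omega>_def)
  define \<delta> where "\<delta> = Min ({1, 1 / norm c} \<union> norm ` ?B)"
  have \<delta>: "\<delta> > 0" using B nz by (auto simp: \<delta>_def)
  have "cubic_num q a h c (q * t) = cubic_ratio a c x y z t * (\<Prod>Y\<in>?B. 1 - Y / (q * t)) * cubic_num q a h c t"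
    if t: "0 < norm t" "norm t < \<delta>" for t
  proof -
    have t1: "norm t < 1" "norm t < 1 / norm c" "\<And>X. X \<in> ?B \<Longrightarrow> norm t < norm X"
      using t(2) B by (auto simp: \<delta>_def)
    have "t \<in> regular_dom c" using t t1 nz by (intro regular_dom_small) (auto simp: norm_mult field_simps)
    then have dom: "t \<noteq> 0" "qpoch_inf t q \<noteq> 0" "qpoch_inf (c * t) q \<noteq> 0" by (auto simp: regular_dom_def)
    have "1 - X / (q * t) \<noteq> 0" if X: "X \<in> ?B" for X
    proof
      assume "1 - X / (q * t) = 0"
      then have "X = q * t" using dom q0 by (simp add: field_simps)
      moreover have "norm (q * t) \<le> 1 * norm t" unfolding norm_mult using q by (intro mult_right_mono) auto
      ultimately show False using t1(3)[OF X] by simp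
    qed
    from cubic_ratio_prod[OF dist nz dom(1) a e this]
    show ?thesis unfolding cubic_num_mult_q[OF h nz(5) dom] by (simp only:)
  qed
  moreover have "(cubic_ratio a c x y z \<longlongrightarrow> (1 - 0) * (1 - c * 0) * (1 - q * 0^2 / a) * (1 - q^2 * 0^2 / a) /
     ((1 - q * 0 / x) * (1 - q * 0 / y) * (1 - q * 0 / z) * (1 - (q * 0)^3 / a)) * q) (at 0)"
    unfolding cubic_ratio_def using nz a by (intro tendsto_intros) auto
  then have "(cubic_ratio a c x y z \<longlongrightarrow> q) (at 0)" by simp
  ultimately show ?thesis unfolding contracting_def using q \<delta> by blast
qed

lemma cubic_pole_term_Suc:
  assumes dist: "distinct [x, y, z, s ^ 2, \<omega> * s ^ 2, \<omega> ^ 2 * s ^ 2]"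
    and sep: "separated q (cubic_bases s x y z)"
    and nz: "s \<noteq> 0" "c \<noteq> 0" and h: "h \<noteq> 0"
    and a: "a = s ^ 6" and e: "x * y * z * c = q * a"
    and X: "X \<in> cubic_bases s x y z" "qpoch_inf X q \<noteq> 0" "qpoch_inf (c * X) q \<noteq> 0"
  shows "pole_term q (cubic_num q a h c) (cubic_bases s x y z) X (Suc k)
    = cubic_ratio a c x y z (X * q ^ k) * pole_term q (cubic_num q a h c) (cubic_bases s x y z) X k"
proof -
  let ?B = "cubic_bases s x y z"
  have B: "finite ?B" "0 \<notin> ?B" using sep by (auto simp: separated_def)
  have xyz: "x \<noteq> 0" "y \<noteq> 0" "z \<noteq> 0" using B by (auto simp: cubic_bases_def)
  define t where "t = X * q ^ k"
  have qt: "X * q ^ Suc k = q * t" by (simp add: t_def)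
  have t: "t \<noteq> 0" "qpoch_inf t q \<noteq> 0" "qpoch_inf (c * t) q \<noteq> 0"
    using X B q0 qpoch_inf_shift_nz[OF q X(2), of k] qpoch_inf_shift_nz[OF q X(3), of k] by (auto simp: t_def mult.assoc)
  have f0: "1 - Y / (q * t) \<noteq> 0" if "Y \<in> ?B" for Y
    using separated_diff_nz[OF sep X(1) that, of k] unfolding qt .
  have R: "cubic_ratio a c x y z t * (\<Prod>X\<in>?B. 1 - X / (q * t))
      = (1 - t) * (1 - c * t) / (c * q * t^2) * ((1 - a / (q * t^2)) * (1 - a / (q^2 * t^2)))"
    by (rule cubic_ratio_prod[OF dist xyz nz t(1) a e f0])
  have "cubic_num q a h c (X * q ^ Suc k) = (cubic_ratio a c x y z t * (\<Prod>Y\<in>?B. 1 - Y / (q * t))) * cubic_num q a h c (X * q ^ k)"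
    unfolding qt R cubic_num_mult_q[OF h nz(2) t] t_def [symmetric] ..
  from pole_term_Suc[OF sep X(1) this]
  have "pole_term q (cubic_num q a h c) ?B X (Suc k) * (\<Prod>Y\<in>?B. 1 - Y / (q * t))
     = (cubic_ratio a c x y z t * pole_term q (cubic_num q a h c) ?B X k) * (\<Prod>Y\<in>?B. 1 - Y / (q * t))"
    unfolding qt by (simp only: mult_ac)
  moreover have "(\<Prod>Y\<in>?B. 1 - Y / (q * t)) \<noteq> 0" using B f0 by auto
  ultimately show ?thesis unfolding t_def by (metis mult_right_cancel)
qed

text \<open>
  For each \<open>n\<close>, and again for the sum over \<open>n\<close>, \<open>inner_pole_sum\<close> writes the residue sum as a mean over one fixed circle plus residues at finitely
  many points. All of these are the same linear functional of the function \<open>V\<^sub>n\<close> respectively of its sum, and the sum converges uniformly on the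
  circle and pointwise at the exceptional points. The three new progressions lie inside the circle, so they add no exceptional points.
\<close>
lemma cubic_main_sum:
  assumes h: "h \<noteq> 0" and c: "c \<noteq> 0" and s: "s \<noteq> 0" and a: "a = s ^ 6" and e: "x * y * z * c = q * a"
    and ok: "saal_generic q c x y z" and sep: "separated q (cubic_bases s x y z)"
    and dist: "distinct [x, y, z, s ^ 2, \<omega> * s ^ 2, \<omega> ^ 2 * s ^ 2]"
    and anz: "qpoch_inf a q \<noteq> 0" and conv: "norm c * norm s ^ 2 < 1"
  shows "(\<lambda>n. \<Sum>X\<in>{x, y, z}. \<Sum>k. pole_term q (kernel_vwp q a h c n) {x, y, z} X k) sums
    (\<Sum>X\<in>cubic_bases s x y z. \<Sum>k. pole_term q (cubic_num q a h c) (cubic_bases s x y z) X k)"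
proof -
  define B where "B = cubic_bases s x y z"
  define B3 where "B3 = {x, y, z}"
  define Z where "Z = {s ^ 2, \<omega> * s ^ 2, \<omega> ^ 2 * s ^ 2}"
  have B_eq: "B = B3 \<union> Z" by (auto simp: B_def B3_def Z_def cubic_bases_def)
  have disj: "B3 \<inter> Z = {}" using dist by (auto simp: B3_def Z_def)
  have fin: "finite B" "finite B3" "finite Z" "0 \<notin> B" using sep by (auto simp: B_def B3_def Z_def separated_def)
  have sep3: "separated q B3" and ne: "x \<noteq> y" "x \<noteq> z" "y \<noteq> z"
    and nz3: "\<And>X. X \<in> B3 \<Longrightarrow> qpoch_inf X q \<noteq> 0" "\<And>X. X \<in> B3 \<Longrightarrow> qpoch_inf (c * X) q \<noteq> 0"
    using ok by (auto simp: saal_generic_def B3_def)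
  have xyz: "x \<noteq> 0" "y \<noteq> 0" "z \<noteq> 0" using fin by (auto simp: B_def cubic_bases_def)
  have a1: "a \<noteq> 1" using qpoch_inf_nz[OF q anz, of 0] by simp
  have w_norm: "norm \<omega> = 1" by (simp add: \<omega>_def norm_exp_eq_Re)
  have Zn: "norm X = norm s ^ 2" if "X \<in> Z" for X
    using that by (auto simp: Z_def norm_mult norm_power w_norm)
  have p3: "norm (q ^ 3) < 1" by (rule norm_cube_lt_1[OF q])
  have Zprod: "(\<Prod>X\<in>Z. qpoch_inf (X / t) q) = qpoch_inf (a / t ^ 3) (q ^ 3)" for t
  proof -
    have "(\<Prod>X\<in>Z. qpoch_inf (X / t) q) = qpoch_inf (s ^ 2 / t) q * qpoch_inf (\<omega> * (s ^ 2 / t)) q * qpoch_inf (\<omega> ^ 2 * (s ^ 2 / t)) q"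
      using dist unfolding Z_def by (subst prod3) auto
    also have "\<dots> = qpoch_inf ((s ^ 2 / t) ^ 3) (q ^ 3)" by (rule qpoch_inf_cube[OF q])
    also have "(s ^ 2 / t) ^ 3 = a / t ^ 3" by (simp add: a power_divide flip: power_mult)
    finally show ?thesis .
  qed
  have nzB: "qpoch_inf X q \<noteq> 0" if "X \<in> B" for X
  proof (cases "X \<in> B3")
    case False
    then have "X \<in> Z" using that B_eq by auto
    have "a * (q ^ 3) ^ j \<noteq> 1" for j using qpoch_inf_nz[OF q anz, of "3 * j"] by (simp add: power_mult)
    then have "(\<Prod>X\<in>Z. qpoch_inf (X / 1) q) \<noteq> 0" unfolding Zprod by (auto simp: qpoch_inf_eq_0_iff[OF p3])
    then show ?thesis using \<open>X \<in> Z\<close> fin by simp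
  qed (rule nz3)
  \<comment> \<open>Above \<open>|a|\<^bsup>1/3\<^esup>\<close> the series in \<open>n\<close> converges; below \<open>1 / |c|\<close> the factor \<open>(c t)\<^sub>\<infinity>\<close> has no zeros. The extra base \<open>1\<close> keeps
    the poles \<open>q\<^bsup>-k\<^esup>\<close> off the circle.\<close>
  have "norm s ^ 2 < 1 / norm c" using conv c by (simp add: field_simps)
  moreover have "finite (insert 1 B)" using fin by simp
  ultimately obtain r where r: "norm s ^ 2 < r" "r < 1 / norm c"
      "\<And>X k J. X \<in> insert 1 B \<Longrightarrow> norm (X * q ^ k) \<noteq> r * norm q ^ J"
    using exists_generic_radius[OF _ _ q0, of "insert 1 B" "norm s ^ 2" "1 / norm c"] by blast
  have r0: "0 < r" using r(1) by (smt (verit) zero_le_power2)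
  have rad: "\<And>X k J. X \<in> B \<Longrightarrow> norm (X * q ^ k) \<noteq> r * norm q ^ J" using r(3) by blast
  have rad3: "\<And>X k J. X \<in> B3 \<Longrightarrow> norm (X * q ^ k) \<noteq> r * norm q ^ J" using rad B_eq by blast
  have cr: "norm (c * t) < 1" if "norm t \<le> r" for t
  proof -
    have "norm c * norm t \<le> norm c * r" using that by (intro mult_left_mono) auto
    also have "\<dots> < 1" using r(2) c by (simp add: field_simps)
    finally show ?thesis by (simp add: norm_mult)
  qed
  have ar: "norm a * (1 / r) ^ 3 < 1"
  proof -
    have "(norm s ^ 2) ^ 3 < r ^ 3" using r(1) by (intro power_strict_mono) auto
    then show ?thesis using r0 by (simp add: a norm_power power_divide flip: power_mult)
  qed
  \<comment> \<open>If \<open>r > 1\<close>, finitely many zeros \<open>q\<^bsup>-k\<^esup>\<close> of \<open>(t)\<^sub>\<infinity>\<close> lie inside the circle. They do not belong to the residue sums and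
    are subtracted.\<close>
  define K where "K = {k. norm (1 / q ^ k) < r}"
  define Q where "Q = (\<lambda>k. 1 / q ^ k) ` K"
  have "finite K"
  proof -
    have "K \<subseteq> snd ` big_poles q {1} (1 / r)"
    proof
      fix k assume "k \<in> K"
      then have "norm (1 * q ^ k) > 1 / r" using r0 q0 by (simp add: K_def norm_divide norm_power field_simps)
      then have "(1, k) \<in> big_poles q {1} (1 / r)" by (simp add: big_poles_def)
      then show "k \<in> snd ` big_poles q {1} (1 / r)" by force
    qed
    moreover have "finite (big_poles q {1} (1 / r))" using r0 by (intro big_poles_finite) auto
    ultimately show ?thesis using finite_surj by blast
  qed
  then have finQ: "finite Q" by (simp add: Q_def)
  have Qr: "0 < norm p \<and> norm p < r" if "p \<in> Q" for p using that q0 by (auto simp: Q_def K_def)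
  have QB: "p \<noteq> X * q ^ k" if pQ: "p \<in> Q" and XB: "X \<in> B" for p X k
  proof
    assume "p = X * q ^ k"
    moreover obtain j where "p = 1 / q ^ j" using pQ by (auto simp: Q_def)
    ultimately have "X * q ^ (k + j) = 1" using q0 by (simp add: power_add field_simps)
    then show False using qpoch_inf_nz[OF q nzB[OF XB]] by blast
  qed
  have "\<exists>m. ((\<lambda>t. (t - p) * theta_kernel q h c t) \<longlongrightarrow> m) (at p)" if pQ: "p \<in> Q" for p
  proof -
    obtain k where k: "k \<in> K" "p = 1 / q ^ k" using pQ by (auto simp: Q_def)
    have "norm (c / q ^ k) < 1" using cr[of p] k by (simp add: K_def)
    then show ?thesis unfolding k by (rule theta_kernel_pole[OF h c])
  qed
  then obtain m where m: "\<And>p. p \<in> Q \<Longrightarrow> ((\<lambda>t. (t - p) * theta_kernel q h c t) \<longlongrightarrow> m p) (at p)" by metis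
  have sub: "{t. 0 < norm t \<and> norm t \<le> r} \<subseteq> regular_dom c \<union> Q"
  proof
    fix t :: complex assume t: "t \<in> {t. 0 < norm t \<and> norm t \<le> r}"
    show "t \<in> regular_dom c \<union> Q"
    proof (cases "qpoch_inf t q = 0")
      case True
      then obtain k where k: "t * q ^ k = 1" unfolding qpoch_inf_eq_0_iff[OF q] by blast
      then have tk: "t = 1 / q ^ k" using q0 by (simp add: field_simps)
      have "norm (1 * q ^ 0) \<noteq> r * norm q ^ k" using r(3) by blast
      moreover have "norm t * norm q ^ k = 1" using arg_cong[OF k, of norm] by (simp add: norm_mult norm_power)
      ultimately have "norm t \<noteq> r" by auto
      then show ?thesis using t tk by (auto simp: Q_def K_def)
    next
      case False
      then show ?thesis using t qpoch_inf_small_nz[OF q cr[of t]] by (auto simp: regular_dom_def)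
    qed
  qed
  have sph: "sphere 0 r \<subseteq> regular_dom c"
  proof
    fix t :: complex assume t: "t \<in> sphere 0 r"
    then have "t \<in> {t. 0 < norm t \<and> norm t \<le> r}" using r0 by auto
    moreover have "t \<notin> Q" using Qr t by force
    ultimately show "t \<in> regular_dom c" using sub by blast
  qed
  define W where "W u = qpoch_inf (a * q ^ 3) (q ^ 3) * qpoch_inf (a * u ^ 2) q / qpoch_inf (a * u ^ 3) (q ^ 3)" for u
  have Wsums: "(\<lambda>n. vwp6 a q n u) sums W u" if "vwp6_convergent q a u" for u
    unfolding W_def by (rule vwp6_sums[OF q a1 q0 anz that])
  have ok_outside: "vwp6_convergent q a (1 / t)" if "norm t \<ge> r" for t
  proof -
    have "norm a * (1 / norm t) ^ 3 \<le> norm a * (1 / r) ^ 3"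
      using that r0 by (intro mult_left_mono power_mono divide_left_mono mult_pos_pos) auto
    with ar show ?thesis unfolding vwp6_convergent_def[OF q a1] by (simp add: norm_divide)
  qed
  have ok_Q: "vwp6_convergent q a (1 / p)" if "p \<in> Q" for p
    using that by (auto simp: Q_def vwp6_convergent_def[OF q a1])
  have kv: "kernel_vwp q a h c n = (\<lambda>t. vwp6 a q n (1 / t) * theta_kernel q h c t)" for n
    by (simp add: kernel_vwp_def fun_eq_iff)
  have each: "(\<Sum>X\<in>B3. \<Sum>k. pole_term q (kernel_vwp q a h c n) B3 X k)
     = circle_mean r (\<lambda>t. vwp6 a q n (1 / t) * pole_quotient q (theta_kernel q h c) B3 t)
       + (\<Sum>(X,k)\<in>big_poles q B3 r. vwp6 a q n (1 / (X * q ^ k)) * pole_term q (theta_kernel q h c) B3 X k)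
       - (\<Sum>p\<in>Q. vwp6 a q n (1 / p) * (m p / (p * (\<Prod>X\<in>B3. qpoch_inf (X / p) q))))" for n
  proof -
    have rat: "\<exists>\<rho>. contracting (kernel_vwp q a h c n) B3 \<rho>"
      using contracting_kernel_vwp[OF h c xyz ne e] unfolding B3_def by blast
    then obtain \<rho> where \<rho>: "contracting (kernel_vwp q a h c n) B3 \<rho>" by blast
    have hol: "kernel_vwp q a h c n holomorphic_on regular_dom c"
      unfolding kv by (intro holomorphic_intros vwp6_holomorphic theta_kernel_holomorphic h c)
    have lim: "((\<lambda>t. (t - p) * kernel_vwp q a h c n t) \<longlongrightarrow> m p * vwp6 a q n (1 / p)) (at p)" if "p \<in> Q" for p
    proof -
      have "p \<noteq> 0" using Qr[OF that] by auto
      then have "((\<lambda>t. vwp6 a q n (1 / t)) \<longlongrightarrow> vwp6 a q n (1 / p)) (at p)"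
        unfolding vwp6_def rpoch_def by (intro tendsto_intros q) auto
      from tendsto_mult[OF m[OF that] this] show ?thesis by (simp add: kernel_vwp_def mult_ac)
    qed
    have "(\<Sum>X\<in>B3. \<Sum>k. pole_term q (kernel_vwp q a h c n) B3 X k)
     = circle_mean r (pole_quotient q (kernel_vwp q a h c n) B3) + (\<Sum>(X,k)\<in>big_poles q B3 r. pole_term q (kernel_vwp q a h c n) B3 X k)
       - (\<Sum>p\<in>Q. m p * vwp6 a q n (1 / p) / (p * (\<Prod>X\<in>B3. qpoch_inf (X / p) q)))"
      by (rule inner_pole_sum[OF sep3 open_regular_dom hol finQ lim r0 sub Qr _ rad3 \<rho>])
         (use QB B_eq in auto)
    then show ?thesis unfolding kv pole_quotient_mult[abs_def] pole_term_mult by (simp add: mult_ac)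
  qed
  have contC: "continuous_on (sphere 0 r) (pole_quotient q (theta_kernel q h c) B3)"
    using rad3[of _ _ 0]
    by (intro pole_quotient_continuous_sphere[OF open_regular_dom theta_kernel_holomorphic[OF h c] fin(2) r0 sph]) auto
  have circle: "(\<lambda>n. circle_mean r (\<lambda>t. vwp6 a q n (1 / t) * pole_quotient q (theta_kernel q h c) B3 t)) sums
      circle_mean r (\<lambda>t. W (1 / t) * pole_quotient q (theta_kernel q h c) B3 t)"
  proof -
    let ?C = "pole_quotient q (theta_kernel q h c) B3"
    have contV: "continuous_on (sphere 0 r) (\<lambda>t. vwp6 a q n (1 / t))" for n
      using r0 by (intro continuous_on_compose2[OF vwp6_continuous[OF q a1, of UNIV]] continuous_intros) auto
    have cn: "continuous_on (sphere 0 r) (\<lambda>t. vwp6 a q n (1 / t) * ?C t)" for n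
      by (intro continuous_on_mult contV contC)
    have "compact (?C ` sphere 0 r)" by (intro compact_continuous_image contC) auto
    from compact_imp_bounded[OF this] obtain M0 where "\<forall>v\<in>?C ` sphere 0 r. norm v \<le> M0" unfolding bounded_iff by blast
    then have M0: "norm (?C t) \<le> M0" if "t \<in> sphere 0 r" for t using that by auto
    define M where "M = \<bar>M0\<bar> + 1"
    have M: "M > 0" "norm (?C t) < M" if "t \<in> sphere 0 r" for t using M0[OF that] by (auto simp: M_def)
    have M_pos: "M > 0" by (simp add: M_def)
    have ul: "uniform_limit (cball 0 (1 / r)) (\<lambda>N u. \<Sum>n<N. vwp6 a q n u) (\<lambda>u. \<Sum>n. vwp6 a q n u) sequentially"
      using r0 ar by (intro vwp6_uniform(1)[OF q a1]) auto
    have "uniform_limit (sphere 0 r) (\<lambda>N t. \<Sum>n<N. vwp6 a q n (1 / t) * ?C t) (\<lambda>t. W (1 / t) * ?C t) sequentially"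
    proof (rule uniform_limitI)
      fix \<epsilon> :: real assume "\<epsilon> > 0"
      then have "\<forall>\<^sub>F N in sequentially. \<forall>u\<in>cball 0 (1 / r). dist (\<Sum>n<N. vwp6 a q n u) (\<Sum>n. vwp6 a q n u) < \<epsilon> / M"
        using M_pos by (intro uniform_limitD[OF ul]) auto
      then show "\<forall>\<^sub>F N in sequentially. \<forall>t\<in>sphere 0 r. dist (\<Sum>n<N. vwp6 a q n (1 / t) * ?C t) (W (1 / t) * ?C t) < \<epsilon>"
      proof eventually_elim
        case (elim N)
        show ?case
        proof
          fix t :: complex assume t: "t \<in> sphere 0 r"
          have tr: "norm t = r" using t by simp
          have "(\<Sum>n. vwp6 a q n (1 / t)) = W (1 / t)"
            using Wsums[OF ok_outside[of t]] tr by (simp add: sums_iff)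
          moreover have "1 / t \<in> cball 0 (1 / r)" using tr r0 by (simp add: norm_divide)
          ultimately have d: "norm ((\<Sum>n<N. vwp6 a q n (1 / t)) - W (1 / t)) < \<epsilon> / M"
            using elim by (metis dist_norm)
          have "dist (\<Sum>n<N. vwp6 a q n (1 / t) * ?C t) (W (1 / t) * ?C t) = norm ((\<Sum>n<N. vwp6 a q n (1 / t)) - W (1 / t)) * norm (?C t)"
            unfolding dist_norm sum_distrib_right [symmetric] left_diff_distrib [symmetric] norm_mult ..
          also have "\<dots> \<le> norm ((\<Sum>n<N. vwp6 a q n (1 / t)) - W (1 / t)) * M"
            using M(2)[OF t] by (intro mult_left_mono) auto
          also have "\<dots> < \<epsilon> / M * M" using d M_pos by (intro mult_strict_right_mono) auto
          also have "\<dots> = \<epsilon>" using M_pos by simp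
          finally show "dist (\<Sum>n<N. vwp6 a q n (1 / t) * ?C t) (W (1 / t) * ?C t) < \<epsilon>" .
        qed
      qed
    qed
    from circle_mean_uniform_limit[OF r0 _ this]
    have "(\<lambda>N. circle_mean r (\<lambda>t. \<Sum>n<N. vwp6 a q n (1 / t) * ?C t)) \<longlonglongrightarrow> circle_mean r (\<lambda>t. W (1 / t) * ?C t)"
      using cn by (simp add: continuous_on_sum)
    moreover have "circle_mean r (\<lambda>t. \<Sum>n<N. vwp6 a q n (1 / t) * ?C t) = (\<Sum>n<N. circle_mean r (\<lambda>t. vwp6 a q n (1 / t) * ?C t))" for N
      by (rule circle_mean_sum[OF r0 cn]) simp
    ultimately show ?thesis unfolding sums_def by simp
  qed
  have bigs: "(\<lambda>n. \<Sum>(X,k)\<in>big_poles q B3 r. vwp6 a q n (1 / (X * q ^ k)) * pole_term q (theta_kernel q h c) B3 X k) sums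
      (\<Sum>(X,k)\<in>big_poles q B3 r. W (1 / (X * q ^ k)) * pole_term q (theta_kernel q h c) B3 X k)"
    unfolding case_prod_unfold
    by (intro sums_sum sums_mult2 Wsums ok_outside) (auto simp: big_poles_def)
  have outs: "(\<lambda>n. \<Sum>p\<in>Q. vwp6 a q n (1 / p) * (m p / (p * (\<Prod>X\<in>B3. qpoch_inf (X / p) q)))) sums
      (\<Sum>p\<in>Q. W (1 / p) * (m p / (p * (\<Prod>X\<in>B3. qpoch_inf (X / p) q))))"
    by (intro sums_sum sums_mult2 Wsums ok_Q)
  \<comment> \<open>The denominator of the summed series supplies the three bases in \<open>Z\<close>, so multiplying by the sum \<open>W(1 / t)\<close> replaces the bases in
    \<open>B3\<close> by those in \<open>B\<close>.\<close>
  have Bprod: "(\<Prod>X\<in>B. qpoch_inf (X / t) q) = (\<Prod>X\<in>B3. qpoch_inf (X / t) q) * qpoch_inf (a / t ^ 3) (q ^ 3)" for t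
    unfolding B_eq prod.union_disjoint[OF fin(2,3) disj] Zprod ..
  have W_inv: "W (1 / t) = qpoch_inf (a * q ^ 3) (q ^ 3) * qpoch_inf (a / t ^ 2) q / qpoch_inf (a / t ^ 3) (q ^ 3)" for t
    by (simp add: W_def power_one_over divide_inverse power_inverse)
  have total: "(\<Sum>X\<in>B. \<Sum>k. pole_term q (cubic_num q a h c) B X k)
     = circle_mean r (\<lambda>t. W (1 / t) * pole_quotient q (theta_kernel q h c) B3 t)
       + (\<Sum>(X,k)\<in>big_poles q B3 r. W (1 / (X * q ^ k)) * pole_term q (theta_kernel q h c) B3 X k)
       - (\<Sum>p\<in>Q. W (1 / p) * (m p / (p * (\<Prod>X\<in>B3. qpoch_inf (X / p) q))))"
  proof -
    have \<rho>: "contracting (cubic_num q a h c) B (cubic_ratio a c x y z)"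
      unfolding B_def by (rule contracting_cubic[OF dist xyz s c h a e])
    have hol: "cubic_num q a h c holomorphic_on regular_dom c"
      unfolding cubic_num_def by (intro holomorphic_intros theta_kernel_holomorphic h c q) (auto simp: regular_dom_def)
    have lim: "((\<lambda>t. (t - p) * cubic_num q a h c t) \<longlongrightarrow> m p * (qpoch_inf (a * q ^ 3) (q ^ 3) * qpoch_inf (a / p ^ 2) q)) (at p)" if "p \<in> Q" for p
    proof -
      have "p \<noteq> 0" using Qr[OF that] by auto
      then have "((\<lambda>t. qpoch_inf (a * q ^ 3) (q ^ 3) * qpoch_inf (a / t ^ 2) q) \<longlongrightarrow> qpoch_inf (a * q ^ 3) (q ^ 3) * qpoch_inf (a / p ^ 2) q) (at p)"
        by (intro tendsto_intros q) auto
      from tendsto_mult[OF m[OF that] this] show ?thesis by (simp add: cubic_num_def mult_ac)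
    qed
    have bigB: "big_poles q B r = big_poles q B3 r"
    proof -
      have "\<not> norm (X * q ^ k) > r" if "X \<in> Z" for X k
      proof -
        have "norm (X * q ^ k) = norm s ^ 2 * norm q ^ k" by (simp add: norm_mult norm_power Zn[OF that])
        also have "\<dots> \<le> norm s ^ 2 * 1" using q by (intro mult_left_mono power_le_one) auto
        finally show ?thesis using r(1) by simp
      qed
      then show ?thesis unfolding big_poles_def B_eq by blast
    qed
    have poleB: "pole_term q (cubic_num q a h c) B X k = W (1 / (X * q ^ k)) * pole_term q (theta_kernel q h c) B3 X k" if "X \<in> B3" for X k
    proof -
      have "B - {X} = (B3 - {X}) \<union> Z" using that disj B_eq by auto
      moreover have "(\<Prod>Y\<in>(B3 - {X}) \<union> Z. qpoch_inf (Y / (X * q ^ k)) q)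
         = (\<Prod>Y\<in>B3 - {X}. qpoch_inf (Y / (X * q ^ k)) q) * (\<Prod>Y\<in>Z. qpoch_inf (Y / (X * q ^ k)) q)"
        using fin disj by (intro prod.union_disjoint) auto
      ultimately show ?thesis unfolding pole_term_def W_inv Zprod [symmetric] cubic_num_def by (simp add: mult_ac)
    qed
    have "(\<Sum>X\<in>B. \<Sum>k. pole_term q (cubic_num q a h c) B X k)
     = circle_mean r (pole_quotient q (cubic_num q a h c) B) + (\<Sum>(X,k)\<in>big_poles q B r. pole_term q (cubic_num q a h c) B X k)
       - (\<Sum>p\<in>Q. m p * (qpoch_inf (a * q ^ 3) (q ^ 3) * qpoch_inf (a / p ^ 2) q) / (p * (\<Prod>X\<in>B. qpoch_inf (X / p) q)))"
      by (rule inner_pole_sum[OF sep[folded B_def] open_regular_dom hol finQ lim r0 sub Qr QB rad \<rho>])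
    also have "pole_quotient q (cubic_num q a h c) B = (\<lambda>t. W (1 / t) * pole_quotient q (theta_kernel q h c) B3 t)"
      unfolding pole_quotient_def Bprod W_inv cubic_num_def by (simp add: fun_eq_iff mult_ac)
    also have "(\<Sum>(X,k)\<in>big_poles q B r. pole_term q (cubic_num q a h c) B X k)
       = (\<Sum>(X,k)\<in>big_poles q B3 r. W (1 / (X * q ^ k)) * pole_term q (theta_kernel q h c) B3 X k)"
      unfolding bigB by (intro sum.cong refl) (auto simp: big_poles_def poleB)
    also have "(\<Sum>p\<in>Q. m p * (qpoch_inf (a * q ^ 3) (q ^ 3) * qpoch_inf (a / p ^ 2) q) / (p * (\<Prod>X\<in>B. qpoch_inf (X / p) q)))
      = (\<Sum>p\<in>Q. W (1 / p) * (m p / (p * (\<Prod>X\<in>B3. qpoch_inf (X / p) q))))"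
      unfolding Bprod W_inv by (simp add: mult_ac)
    finally show ?thesis .
  qed
  show ?thesis
    unfolding B_def [symmetric] B3_def [symmetric] each total
    by (intro sums_diff sums_add circle bigs outs)
qed

section \<open>The six families of residues\<close>

text \<open>
  The conditions are symmetric in \<open>x, y, z\<close>, so the three terms \<open>F\<close> come from a single lemma.
\<close>
definition cubic_generic :: "complex \<Rightarrow> complex \<Rightarrow> complex \<Rightarrow> complex \<Rightarrow> complex \<Rightarrow> complex \<Rightarrow> bool" where
  "cubic_generic s h c x y z \<longleftrightarrow> s \<noteq> 0 \<and> h \<noteq> 0 \<and> c = q * s ^ 6 / (x * y * z) \<and>
     separated q (cubic_bases s x y z) \<and> distinct [x, y, z, s ^ 2, \<omega> * s ^ 2, \<omega> ^ 2 * s ^ 2] \<and>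
     (\<forall>X\<in>cubic_bases s x y z. qpoch_inf X q \<noteq> 0 \<and> qpoch_inf (c * X) q \<noteq> 0)"

lemma cubic_generic_swap: "cubic_generic s h c x y z \<Longrightarrow> cubic_generic s h c y x z" "cubic_generic s h c x y z \<Longrightarrow> cubic_generic s h c z y x"
  unfolding cubic_generic_def cubic_bases_def by (auto simp: insert_commute mult_ac)

lemma cubic_generic_nz:
  assumes "cubic_generic s h c x y z"
  shows "x \<noteq> 0" "y \<noteq> 0" "z \<noteq> 0" "c \<noteq> 0" "x * y * z * c = q * s ^ 6"
proof -
  have "0 \<notin> cubic_bases s x y z" using assms by (auto simp: cubic_generic_def separated_def)
  then show xyz: "x \<noteq> 0" "y \<noteq> 0" "z \<noteq> 0" by (auto simp: cubic_bases_def)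
  then show "c \<noteq> 0" "x * y * z * c = q * s ^ 6" using assms q0 by (auto simp: cubic_generic_def)
qed

lemma cubic_pole_sum:
  assumes ok: "cubic_generic s h c x y z" and X: "X \<in> cubic_bases s x y z"
    and ratio: "\<And>k. cubic_ratio (s ^ 6) c x y z (X * q ^ k) = (\<Prod>a\<leftarrow>as. 1 - a * q ^ k) / (\<Prod>b\<leftarrow>q # bs. 1 - b * q ^ k) * q"
  shows "(\<Sum>k. pole_term q (cubic_num q (s ^ 6) h c) (cubic_bases s x y z) X k)
     = pole_term q (cubic_num q (s ^ 6) h c) (cubic_bases s x y z) X 0 * qhyp as bs q q"
proof (rule suminf_eq_qhyp)
  note nz = cubic_generic_nz[OF ok]
  have *: "s \<noteq> 0" "h \<noteq> 0" "separated q (cubic_bases s x y z)" "distinct [x, y, z, s ^ 2, \<omega> * s ^ 2, \<omega> ^ 2 * s ^ 2]"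
    using ok by (auto simp: cubic_generic_def)
  show "pole_term q (cubic_num q (s ^ 6) h c) (cubic_bases s x y z) X (Suc k) =
     (\<Prod>a\<leftarrow>as. 1 - a * q ^ k) / (\<Prod>b\<leftarrow>q # bs. 1 - b * q ^ k) * q * pole_term q (cubic_num q (s ^ 6) h c) (cubic_bases s x y z) X k" for k
    unfolding ratio [symmetric] using ok X
    by (intro cubic_pole_term_Suc[OF *(4,3,1) nz(4) *(2) refl nz(5)]) (auto simp: cubic_generic_def)
  show "summable (pole_term q (cubic_num q (s ^ 6) h c) (cubic_bases s x y z) X)"
    by (rule pole_term_summable[OF *(3) X contracting_cubic[OF *(4) nz(1-3) *(1) nz(4) *(2) refl nz(5)]])
qed

text \<open>
  At \<open>t = x q\<^sup>k\<close> the factors \<open>1 - q t\<^sup>2 / a\<close> and \<open>1 - q\<^sup>2 t\<^sup>2 / a\<close> of the term ratio are differences of squares; they give the four parameters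
  that occur with both signs. The factor \<open>1 - (q t)\<^sup>3 / a\<close> splits over the cube roots of unity.
\<close>
lemma F_pole_sum:
  assumes ok: "cubic_generic s h c x y z" and r: "r ^ 2 = q"
  shows "(\<Sum>k. pole_term q (cubic_num q (s ^ 6) h c) (cubic_bases s x y z) x k)
     = qpoch_inf (s ^ 6 * q ^ 3) (q ^ 3) / qpoch_inf q q * F_term q r (s ^ 6) s h x y z"
proof -
  define a where "a = s ^ 6"
  note nz = cubic_generic_nz[OF ok]
  have s: "s \<noteq> 0" and dist: "distinct [x, y, z, s ^ 2, \<omega> * s ^ 2, \<omega> ^ 2 * s ^ 2]" and c: "c = q * a / (x * y * z)"
    using ok by (auto simp: cubic_generic_def a_def)
  have cx: "c * x = q * a / (y * z)" using nz by (simp add: c)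
  let ?B = "cubic_bases s x y z"
  have ratio: "cubic_ratio (s ^ 6) c x y z (x * q ^ k) =
     (\<Prod>b\<leftarrow>[x, q * a / (y * z), r * x / s ^ 3, - (r * x / s ^ 3), q * x / s ^ 3, - (q * x / s ^ 3)]. 1 - b * q ^ k)
      / (\<Prod>b\<leftarrow>q # F_lower q s x y z. 1 - b * q ^ k) * q" for k
  proof -
    define Q where "Q = q ^ k"
    define t where "t = x * Q"
    have n1: "(1 - r * x / s ^ 3 * Q) * (1 - - (r * x / s ^ 3) * Q) = 1 - q * t^2 / a"
    proof -
      have "(1 - v) * (1 - - v) = 1 - v ^ 2" for v :: complex by (simp add: algebra_simps power2_eq_square)
      from this[of "r * x / s ^ 3 * Q"] show ?thesis
        by (simp add: t_def a_def power_mult_distrib power_divide r flip: power_mult)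
    qed
    have n2: "(1 - q * x / s ^ 3 * Q) * (1 - - (q * x / s ^ 3) * Q) = 1 - q^2 * t^2 / a"
    proof -
      have "(1 - v) * (1 - - v) = 1 - v ^ 2" for v :: complex by (simp add: algebra_simps power2_eq_square)
      from this[of "q * x / s ^ 3 * Q"] show ?thesis
        by (simp add: t_def a_def power_mult_distrib power_divide flip: power_mult)
    qed
    have d: "(1 - q * x / s ^ 2 * Q) * (1 - \<omega> * q * x / s ^ 2 * Q) * (1 - \<omega> ^ 2 * q * x / s ^ 2 * Q) = 1 - (q * t) ^ 3 / a"
      using cube_root_factor[of "q * x / s ^ 2 * Q"]
      by (simp add: t_def a_def power_mult_distrib power_divide mult_ac flip: power_mult)
    have "cubic_ratio a c x y z t = (1 - x * Q) * (1 - q * a / (y * z) * Q) *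
        ((1 - r * x / s ^ 3 * Q) * (1 - - (r * x / s ^ 3) * Q)) * ((1 - q * x / s ^ 3 * Q) * (1 - - (q * x / s ^ 3) * Q))
       / ((1 - q * Q) * (1 - q * x / y * Q) * (1 - q * x / z * Q) *
          ((1 - q * x / s ^ 2 * Q) * (1 - \<omega> * q * x / s ^ 2 * Q) * (1 - \<omega> ^ 2 * q * x / s ^ 2 * Q))) * q"
    proof -
      have e1: "c * t = q * a / (y * z) * Q" unfolding t_def mult.assoc [symmetric] cx ..
      have e2: "q * t / x = q * Q" using nz by (simp add: t_def)
      have e3: "q * t / y = q * x / y * Q" "q * t / z = q * x / z * Q" by (simp_all add: t_def)
      show ?thesis unfolding cubic_ratio_def n1 n2 d e1 e2 e3 unfolding t_def by (simp only: mult_ac)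
    qed
    then show ?thesis unfolding F_lower_def Q_def [symmetric] t_def [symmetric] a_def [symmetric]
      by (simp add: mult.assoc) (simp add: t_def mult.assoc)
  qed
  have rem: "?B - {x} = set [y, z, s ^ 2, \<omega> * s ^ 2, \<omega> ^ 2 * s ^ 2]"
    using dist by (auto simp: cubic_bases_def)
  have "distinct [y, z, s ^ 2, \<omega> * s ^ 2, \<omega> ^ 2 * s ^ 2]" using dist by simp
  from prod.distinct_set_conv_list[OF this, of "\<lambda>Y. qpoch_inf (Y / x) q"]
  have pr: "(\<Prod>Y\<in>?B - {x}. qpoch_inf (Y / x) q) = qpoch_inf (y / x) q * qpoch_inf (z / x) q * (qpoch_inf (s ^ 2 / x) q *
     qpoch_inf (\<omega> * s ^ 2 / x) q * qpoch_inf (\<omega> ^ 2 * s ^ 2 / x) q)"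
    unfolding rem by (simp add: mult_ac)
  have hc: "h / (c * x) = h * (y * z / (q * a))" unfolding cx by simp
  have "pole_term q (cubic_num q a h c) ?B x 0 = theta (h * x) q * theta (h * (y * z / (q * a))) q / (qpoch_inf x q * qpoch_inf (q * a / (y * z)) q)
     * (qpoch_inf (a * q ^ 3) (q ^ 3) * qpoch_inf (a / x ^ 2) q) / (qpoch_inf q q * (qpoch_inf (y / x) q * qpoch_inf (z / x) q * (qpoch_inf (s ^ 2 / x) q *
     qpoch_inf (\<omega> * s ^ 2 / x) q * qpoch_inf (\<omega> ^ 2 * s ^ 2 / x) q)))"
    unfolding pole_term_def cubic_num_def theta_kernel_def power_0 mult_1_right pr hc cx by simp
  then have first: "pole_term q (cubic_num q (s ^ 6) h c) ?B x 0 = qpoch_inf (s ^ 6 * q ^ 3) (q ^ 3) / qpoch_inf q q *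
      (thetas [h * x, h * (y * z / (q * a))] q * qpoch_inf (a / x ^ 2) q / qpochs_inf (F_denom q a s x y z) q)"
    unfolding a_def [symmetric] thetas_def qpochs_inf_def F_denom_def by (simp add: mult_ac)
  have xB: "x \<in> ?B" by (simp add: cubic_bases_def)
  show ?thesis
    unfolding cubic_pole_sum[OF ok xB ratio] first F_term_def by (simp add: a_def)
qed

text \<open>
  At \<open>t = \<zeta> s\<^sup>2\<close> one has \<open>a / t\<^sup>2 = \<zeta> s\<^sup>2 = t\<close>, so the numerator factor \<open>(a / t\<^sup>2)\<^sub>\<infinity>\<close> cancels against \<open>(t)\<^sub>\<infinity>\<close>. The other two cube
  roots contribute \<open>(\<omega>, \<omega>\<^sup>2)\<^sub>\<infinity>\<close>, whichever \<open>\<zeta>\<close> is chosen.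
\<close>
lemma E_pole_sum:
  assumes ok: "cubic_generic s h c x y z" and r: "r ^ 2 = q" and \<zeta>: "\<zeta> \<in> {1, \<omega>, \<omega> ^ 2}"
  shows "(\<Sum>k. pole_term q (cubic_num q (s ^ 6) h c) (cubic_bases s x y z) (\<zeta> * s ^ 2) k)
     = qpoch_inf (s ^ 6 * q ^ 3) (q ^ 3) / qpoch_inf q q * (1 / qpochs_inf [\<omega>, \<omega> ^ 2] q * E_term q r s h x y z \<zeta>)"
proof -
  define a where "a = s ^ 6"
  define X where "X = \<zeta> * s ^ 2"
  note nz = cubic_generic_nz[OF ok]
  have s: "s \<noteq> 0" and dist: "distinct [x, y, z, s ^ 2, \<omega> * s ^ 2, \<omega> ^ 2 * s ^ 2]" and c: "c = q * a / (x * y * z)"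
    using ok by (auto simp: cubic_generic_def a_def)
  let ?B = "cubic_bases s x y z"
  have w4: "\<omega> ^ 2 * \<omega> ^ 2 = \<omega>" "\<omega> * \<omega> ^ 2 = 1" "\<omega> ^ 2 * \<omega> = 1" "\<omega> * \<omega> = \<omega> ^ 2"
    using omega_cube by (algebra, algebra, algebra, simp add: power2_eq_square)
  have w44: "\<omega> ^ 4 = \<omega>" using omega_cube by algebra
  have \<zeta>3: "\<zeta> ^ 3 = 1" 
  proof -
    have "(\<omega> ^ 2) ^ 3 = 1" using omega_cube by algebra
    then show ?thesis using \<zeta> omega_cube by auto
  qed
  have \<zeta>0: "\<zeta> \<noteq> 0" using \<zeta>3 by auto
  have inv: "1 / \<zeta> = \<zeta> ^ 2" using \<zeta>3 \<zeta>0 by (simp add: field_simps power2_eq_square power3_eq_cube)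
  have X0: "X \<noteq> 0" using \<zeta>0 s by (simp add: X_def)
  have XB: "X \<in> ?B" using \<zeta> by (auto simp: X_def cubic_bases_def)
  have cX: "c * X = q * \<zeta> * s ^ 8 / (x * y * z)"
    by (simp add: c X_def a_def flip: power_add)
  have ratio: "cubic_ratio (s ^ 6) c x y z (X * q ^ k) =
     (\<Prod>b\<leftarrow>[\<zeta> * s ^ 2, q * \<zeta> * s ^ 8 / (x * y * z), \<zeta> * r / s, - (\<zeta> * r / s), \<zeta> * q / s, - (\<zeta> * q / s)]. 1 - b * q ^ k)
      / (\<Prod>b\<leftarrow>q # E_lower q s x y z \<zeta>. 1 - b * q ^ k) * q" for k
  proof -
    define Q where "Q = q ^ k"
    define t where "t = X * Q"
    have ta: "t ^ 2 / a = (\<zeta> * Q / s) ^ 2"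
      using s by (simp add: t_def X_def a_def field_simps flip: power_mult power_add)
    have n: "(1 - v) * (1 - - v) = 1 - v ^ 2" for v :: complex by (simp add: algebra_simps power2_eq_square)
    have n1: "(1 - \<zeta> * r / s * Q) * (1 - - (\<zeta> * r / s) * Q) = 1 - q * t^2 / a"
    proof -
      have "(\<zeta> * r / s * Q) ^ 2 = q * (t^2 / a)" unfolding ta r [symmetric] by (simp add: power_mult_distrib power_divide)
      then show ?thesis using n[of "\<zeta> * r / s * Q"] by simp
    qed
    have n2: "(1 - \<zeta> * q / s * Q) * (1 - - (\<zeta> * q / s) * Q) = 1 - q^2 * t^2 / a"
    proof -
      have "(\<zeta> * q / s * Q) ^ 2 = q^2 * (t^2 / a)" unfolding ta by (simp add: power_mult_distrib power_divide)
      then show ?thesis using n[of "\<zeta> * q / s * Q"] by simp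
    qed
    have d: "(1 - q * Q) * (1 - q * \<omega> * Q) * (1 - q * \<omega> ^ 2 * Q) = 1 - (q * t) ^ 3 / a"
    proof -
      have "t ^ 3 = a * Q ^ 3" using \<zeta>3 by (simp add: t_def X_def a_def power_mult_distrib flip: power_mult)
      then have "(q * t) ^ 3 / a = (q * Q) ^ 3" using s by (simp add: a_def power_mult_distrib)
      then show ?thesis using cube_root_factor[of "q * Q"] by (simp add: mult_ac)
    qed
    have "cubic_ratio a c x y z t = (1 - \<zeta> * s ^ 2 * Q) * (1 - q * \<zeta> * s ^ 8 / (x * y * z) * Q) *
        ((1 - \<zeta> * r / s * Q) * (1 - - (\<zeta> * r / s) * Q)) * ((1 - \<zeta> * q / s * Q) * (1 - - (\<zeta> * q / s) * Q))
       / ((1 - q * \<zeta> * s ^ 2 / x * Q) * (1 - q * \<zeta> * s ^ 2 / y * Q) * (1 - q * \<zeta> * s ^ 2 / z * Q) *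
          ((1 - q * Q) * (1 - q * \<omega> * Q) * (1 - q * \<omega> ^ 2 * Q))) * q"
    proof -
      have e1: "c * t = q * \<zeta> * s ^ 8 / (x * y * z) * Q" unfolding t_def mult.assoc [symmetric] cX ..
      have e2: "q * t / y = q * \<zeta> * s ^ 2 / y * Q" for y by (simp add: t_def X_def)
      show ?thesis unfolding cubic_ratio_def n1 n2 d e1 e2 unfolding t_def X_def by (simp only: mult_ac)
    qed
    then show ?thesis unfolding E_lower_def Q_def [symmetric] t_def [symmetric] a_def [symmetric]
      by (simp add: mult_ac)
  qed
  have Bset: "?B = set [X, x, y, z, \<omega> * X, \<omega> ^ 2 * X]"
    using \<zeta> by (auto simp: cubic_bases_def X_def w4 w44 mult.assoc [symmetric])
  have "card (set [x, y, z, s ^ 2, \<omega> * s ^ 2, \<omega> ^ 2 * s ^ 2]) = 6"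
    using distinct_card[OF dist] by simp
  then have "card (set [X, x, y, z, \<omega> * X, \<omega> ^ 2 * X]) = length [X, x, y, z, \<omega> * X, \<omega> ^ 2 * X]"
    unfolding Bset [symmetric] by (simp add: cubic_bases_def)
  then have dist': "distinct [X, x, y, z, \<omega> * X, \<omega> ^ 2 * X]" by (rule card_distinct)
  have rem: "?B - {X} = set [x, y, z, \<omega> * X, \<omega> ^ 2 * X]"
    unfolding Bset using dist' by auto
  have "distinct [x, y, z, \<omega> * X, \<omega> ^ 2 * X]" using dist' by simp
  from prod.distinct_set_conv_list[OF this, of "\<lambda>Y. qpoch_inf (Y / X) q"]
  have pr: "(\<Prod>Y\<in>?B - {X}. qpoch_inf (Y / X) q) = qpoch_inf (x / X) q * qpoch_inf (y / X) q * qpoch_inf (z / X) q * (qpoch_inf \<omega> q * qpoch_inf (\<omega> ^ 2) q)"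
    unfolding rem using X0 by (simp add: mult_ac)
  have yX: "Y / X = \<zeta> ^ 2 * Y / s ^ 2" for Y

  proof -
    have "Y / X = 1 / \<zeta> * Y / s ^ 2" by (simp add: X_def)
    then show ?thesis unfolding inv .
  qed
  have aX: "a / X ^ 2 = X"
  proof -
    have "X ^ 3 = a" using \<zeta>3 by (simp add: X_def a_def power_mult_distrib flip: power_mult)
    then show ?thesis using X0 by (simp add: field_simps power2_eq_square power3_eq_cube)
  qed
  have hc: "h / (c * X) = h * (\<zeta> ^ 2 * x * y * z / (q * s ^ 8))"
    unfolding cX inv [symmetric] by simp
  have Xnz: "qpoch_inf X q \<noteq> 0" using ok XB by (auto simp: cubic_generic_def)
  have "pole_term q (cubic_num q a h c) ?B X 0 = theta (h * X) q * theta (h * (\<zeta> ^ 2 * x * y * z / (q * s ^ 8))) q / (qpoch_inf X q * qpoch_inf (q * \<zeta> * s ^ 8 / (x * y * z)) q)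
     * (qpoch_inf (a * q ^ 3) (q ^ 3) * qpoch_inf X q) / (qpoch_inf q q * (qpoch_inf (\<zeta> ^ 2 * x / s ^ 2) q * qpoch_inf (\<zeta> ^ 2 * y / s ^ 2) q * qpoch_inf (\<zeta> ^ 2 * z / s ^ 2) q * (qpoch_inf \<omega> q * qpoch_inf (\<omega> ^ 2) q)))"
    unfolding pole_term_def cubic_num_def theta_kernel_def power_0 mult_1_right
    unfolding pr hc unfolding cX aX yX by simp
  then have first: "pole_term q (cubic_num q (s ^ 6) h c) ?B X 0 = qpoch_inf (s ^ 6 * q ^ 3) (q ^ 3) / qpoch_inf q q * (1 / qpochs_inf [\<omega>, \<omega> ^ 2] q *
      (thetas [h * \<zeta> * s ^ 2, h * (\<zeta> ^ 2 * x * y * z / (q * s ^ 8))] q / qpochs_inf (E_denom q s x y z \<zeta>) q))"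
    unfolding a_def [symmetric] thetas_def qpochs_inf_def E_denom_def using Xnz by (simp add: X_def mult_ac)
  show ?thesis
    unfolding X_def [symmetric] cubic_pole_sum[OF ok XB ratio] first E_term_def by simp
qed

section \<open>Coefficients and nonvanishing conditions\<close>

lemma qpoch_ratio: "qpoch (p * b) p n * (1 - b) = qpoch b p n * (1 - b * p ^ n)"
  using qpoch_Suc[of b p n] qpoch_Suc_left[of b p n] by (simp add: mult_ac)

text \<open>
  The parameters in base \<open>q\<^sup>3\<close> come in triples that merge into base \<open>q\<close>, also in the denominator, since \<open>q\<^sup>3 a / (q\<^sup>j x) = q\<^bsup>3 - j\<^esup> a / x\<close>
  for \<open>j = 0, 1, 2\<close>. The parameters with \<open>s\<^sup>3\<close>, the square root of \<open>a\<close>, give the very-well-poised factor.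
\<close>
lemma vwp_cubic_term:
  assumes s: "s \<noteq> 0" and xyz: "x \<noteq> 0" "y \<noteq> 0" "z \<noteq> 0" and anz: "qpoch_inf (s ^ 6) q \<noteq> 0"
  defines "a \<equiv> s ^ 6"
  shows "qpochs ([a, q ^ 3 * s ^ 3, - (q ^ 3 * s ^ 3)] @ W_params q x y z) (q ^ 3) n
      / qpochs (q ^ 3 # vwp_lower a (s ^ 3) (W_params q x y z) (q ^ 3)) (q ^ 3) n
    = (1 - a * q ^ (6 * n)) / (1 - a) * qpoch a (q^3) n / qpoch (q^3) (q^3) n
     * (qpoch x q (3 * n) * qpoch y q (3 * n) * qpoch z q (3 * n))
     / (qpoch (q * a / x) q (3 * n) * qpoch (q * a / y) q (3 * n) * qpoch (q * a / z) q (3 * n))"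
proof -
  define p where "p = q ^ 3"
  have lower: "qpoch (p * a / X) p n * qpoch (p * a / (q * X)) p n * qpoch (p * a / (q ^ 2 * X)) p n = qpoch (q * a / X) q (3 * n)" if "X \<noteq> 0" for X
  proof -
    have "p * a / X = q ^ 2 * (q * a / X)" "p * a / (q * X) = q * (q * a / X)" "p * a / (q ^ 2 * X) = q * a / X"
      using q0 by (simp_all add: p_def power2_eq_square power3_eq_cube)
    then show ?thesis unfolding qpoch_mult3 p_def [symmetric] by (simp only: mult_ac)
  qed
  have upper: "qpoch X p n * qpoch (q * X) p n * qpoch (q ^ 2 * X) p n = qpoch X q (3 * n)" for X
    unfolding p_def by (rule qpoch_mult3 [symmetric])
  have sq: "v ^ 2 \<noteq> 1 \<Longrightarrow> 1 - v \<noteq> 0 \<and> 1 + v \<noteq> 0" for v :: complex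
    by (metis add.inverse_inverse diff_eq_diff_eq diff_minus_eq_add diff_self power2_minus power_one right_minus_eq)
  have pw: "(s ^ 3 * p ^ j) ^ 2 = a * q ^ (6 * j)" for j
    by (simp add: a_def p_def power_mult_distrib flip: power_mult)
  have s1: "1 - s ^ 3 * p ^ j \<noteq> 0 \<and> 1 + s ^ 3 * p ^ j \<noteq> 0" for j
    using sq[of "s ^ 3 * p ^ j"] qpoch_inf_nz[OF q anz, of "6 * j"] unfolding pw a_def by blast
  have nz1: "qpoch (s ^ 3) p n \<noteq> 0" "qpoch (- (s ^ 3)) p n \<noteq> 0"
    unfolding qpoch_def using s1 by auto
  have u1: "qpoch (p * s ^ 3) p n / qpoch (s ^ 3) p n = (1 - s ^ 3 * p ^ n) / (1 - s ^ 3)"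
    using qpoch_ratio[of p "s ^ 3" n] nz1 s1[of 0] by (simp add: field_simps)
  have u2: "qpoch (- (p * s ^ 3)) p n / qpoch (- (s ^ 3)) p n = (1 + s ^ 3 * p ^ n) / (1 + s ^ 3)"
    using qpoch_ratio[of p "- (s ^ 3)" n] nz1 s1[of 0] by (simp add: field_simps)
  have m: "(1 - v) * (1 + v) = 1 - v ^ 2" for v :: complex by (simp add: algebra_simps power2_eq_square)
  have "qpoch (p * s ^ 3) p n * qpoch (- (p * s ^ 3)) p n / (qpoch (s ^ 3) p n * qpoch (- (s ^ 3)) p n)
     = ((1 - s ^ 3 * p ^ n) * (1 + s ^ 3 * p ^ n)) / ((1 - s ^ 3) * (1 + s ^ 3))"
    using u1 u2 by (metis times_divide_times_eq)
  also have "\<dots> = (1 - a * q ^ (6 * n)) / (1 - a)"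
    unfolding m pw using pw[of 0] by simp
  finally have u: "qpoch (p * s ^ 3) p n * qpoch (- (p * s ^ 3)) p n / (qpoch (s ^ 3) p n * qpoch (- (s ^ 3)) p n) = (1 - a * q ^ (6 * n)) / (1 - a)" .
  have "qpochs ([a, p * s ^ 3, - (p * s ^ 3)] @ W_params q x y z) p n
     = qpoch a p n * (qpoch (p * s ^ 3) p n * qpoch (- (p * s ^ 3)) p n) * (qpoch x q (3 * n) * qpoch y q (3 * n) * qpoch z q (3 * n))"
    unfolding upper [symmetric] qpochs_def W_params_def by simp
  moreover have "qpochs (p # vwp_lower a (s ^ 3) (W_params q x y z) p) p n
     = qpoch p p n * (qpoch (s ^ 3) p n * qpoch (- (s ^ 3)) p n) * (qpoch (q * a / x) q (3 * n) * qpoch (q * a / y) q (3 * n) * qpoch (q * a / z) q (3 * n))"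
    unfolding lower[OF xyz(1), symmetric] lower[OF xyz(2), symmetric] lower[OF xyz(3), symmetric] qpochs_def W_params_def vwp_lower_def by simp
  ultimately show ?thesis
    unfolding p_def [symmetric] u [symmetric] by (simp add: mult_ac)
qed

lemma separatedI_pair:
  assumes "\<And>j. X * q ^ j \<noteq> Y" "\<And>j. Y * q ^ j \<noteq> X"
  shows "X * q ^ k \<noteq> Y * q ^ l"
proof
  assume eq: "X * q ^ k = Y * q ^ l"
  show False
  proof (cases "k \<le> l")
    case True
    then have "X * q ^ k = Y * q ^ (l - k) * q ^ k" using eq by (simp add: power_add [symmetric] mult.assoc)
    then show False using assms(2)[of "l - k"] q0 by simp
  next
    case False
    then have "Y * q ^ l = X * q ^ (k - l) * q ^ l" using eq by (simp add: power_add [symmetric] mult.assoc)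
    then show False using assms(1)[of "k - l"] q0 by simp
  qed
qed

text \<open>
  For each ordered pair of bases \<open>X, Y\<close>, the denominators contain \<open>(Y / X)\<^sub>\<infinity>\<close> as a prefactor or \<open>q X / Y\<close> as a lower parameter, and these exclude
  that one base lies in the progression of the other. That \<open>(\<zeta> a\<^bsup>1/3\<^esup>)\<^sub>\<infinity> \<noteq> 0\<close> follows from \<open>(a)\<^sub>\<infinity> \<noteq> 0\<close> by taking cubes.
\<close>
lemma cubic_generic_if_no_vanishing_denominators:
  assumes "s \<noteq> 0" "h \<noteq> 0" "x \<noteq> 0" "y \<noteq> 0" "z \<noteq> 0"
    and nv: "no_vanishing_denominators q (s ^ 6) s h x y z"
  shows "cubic_generic s h (q * s ^ 6 / (x * y * z)) x y z"
proof -
  define a where "a = s ^ 6"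
  define c where "c = q * a / (x * y * z)"
  define Z where "Z = {s ^ 2, \<omega> * s ^ 2, \<omega> ^ 2 * s ^ 2}"
  have w0: "\<omega> \<noteq> 0" by (simp add: \<omega>_def)
  have w_norm: "norm \<omega> = 1" by (simp add: \<omega>_def norm_exp_eq_Re)
  have anz: "qpoch_inf a q \<noteq> 0"
    using nv unfolding no_vanishing_denominators_def qpochs_inf_def a_def by simp
  have F: "qpochs_inf (F_denom q a s x y z) q \<noteq> 0" "qpochs_inf (F_denom q a s y x z) q \<noteq> 0" "qpochs_inf (F_denom q a s z y x) q \<noteq> 0"
    and L: "lower_ok (F_lower q s x y z) q" "lower_ok (F_lower q s y x z) q" "lower_ok (F_lower q s z y x) q"
    using nv unfolding no_vanishing_denominators_def a_def by auto
  have E: "qpochs_inf (E_denom q s x y z \<zeta>) q \<noteq> 0" if "\<zeta> \<in> {1, \<omega>, \<omega> ^ 2}" for \<zeta>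
    using nv that unfolding no_vanishing_denominators_def by blast
  have Fd: "qpoch_inf u q \<noteq> 0" "qpoch_inf (v / u) q \<noteq> 0" "qpoch_inf (w / u) q \<noteq> 0" "qpoch_inf (q * a / (v * w)) q \<noteq> 0"
      "Y \<in> Z \<Longrightarrow> qpoch_inf (Y / u) q \<noteq> 0"
    if "qpochs_inf (F_denom q a s u v w) q \<noteq> 0" for u v w Y
    using that unfolding qpochs_inf_def F_denom_def Z_def by auto
  have not_pow: "X * q ^ j \<noteq> Y" if "qpoch_inf (X / Y) q \<noteq> 0" "Y \<noteq> 0" for X Y j
    using qpoch_inf_nz[OF q that(1), of j] that(2) by (simp add: field_simps)
  have "X * q ^ j \<noteq> Y" if Y: "Y \<in> Z" and X: "qpoch_inf (Y / X) q \<noteq> 0" and Lw: "lower_ok (F_lower q s X v w) q" and X0: "X \<noteq> 0" for X Y v w j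
  proof (cases j)
    case 0
    then show ?thesis using not_pow[OF X X0, of 0] by auto
  next
    case (Suc i)
    show ?thesis
    proof
      assume eq: "X * q ^ j = Y"
      have qX: "q * X * q ^ i = Y" using eq Suc by (simp add: mult_ac)
      have "\<omega> ^ 2 * (\<omega> * s ^ 2) = s ^ 2" "\<omega> * (\<omega> ^ 2 * s ^ 2) = s ^ 2" using omega_cube by algebra+
      then have "\<exists>\<xi>\<in>{1, \<omega>, \<omega> ^ 2}. \<xi> * Y = s ^ 2" using Y unfolding Z_def by auto
      then obtain \<xi> where \<xi>: "\<xi> \<in> {1, \<omega>, \<omega> ^ 2}" "\<xi> * Y = s ^ 2" by blast
      have "\<xi> * q * X / s ^ 2 \<in> set (F_lower q s X v w)" using \<xi>(1) by (auto simp: F_lower_def)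
      then have "1 - \<xi> * q * X / s ^ 2 * q ^ i \<noteq> 0" using Lw unfolding lower_ok_def by blast
      moreover have "\<xi> * q * X / s ^ 2 * q ^ i = \<xi> * Y / s ^ 2" unfolding qX [symmetric] by simp
      ultimately show False using \<xi>(2) assms(1) by simp
    qed
  qed
  note not_powZ = this
  have sepR: "X * q ^ k \<noteq> Y * q ^ l" if "qpoch_inf (X / Y) q \<noteq> 0" "qpoch_inf (Y / X) q \<noteq> 0" "X \<noteq> 0" "Y \<noteq> 0" for X Y k l
    using separatedI_pair[of X Y k l] not_pow[OF that(1,4)] not_pow[OF that(2,3)] by blast
  have xyz: "X * q ^ k \<noteq> Y * q ^ l" if "X \<in> {x, y, z}" "Y \<in> {x, y, z}" "X \<noteq> Y" for X Y k l
  proof -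
    have "qpoch_inf (X / Y) q \<noteq> 0 \<and> qpoch_inf (Y / X) q \<noteq> 0"
      using that Fd(2,3)[OF F(1)] Fd(2,3)[OF F(2)] Fd(2,3)[OF F(3)] by auto
    then show ?thesis using that assms by (intro sepR) auto
  qed
  have xZ: "X * q ^ k \<noteq> Y * q ^ l" if X: "X \<in> {x, y, z}" and Y: "Y \<in> Z" for X Y k l
  proof (rule separatedI_pair)
    have X0: "X \<noteq> 0" using X assms by auto
    have nz: "qpoch_inf (Y / X) q \<noteq> 0"
      using X Fd(5)[OF F(1) Y] Fd(5)[OF F(2) Y] Fd(5)[OF F(3) Y] by auto
    show "Y * q ^ j \<noteq> X" for j by (rule not_pow[OF nz X0])
    have "\<exists>v w. lower_ok (F_lower q s X v w) q" using X L by auto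
    then obtain v w where "lower_ok (F_lower q s X v w) q" by blast
    then show "X * q ^ j \<noteq> Y" for j by (rule not_powZ[OF Y nz _ X0])
  qed
  have Zn: "norm Y = norm s ^ 2" if "Y \<in> Z" for Y
    using that by (auto simp: Z_def norm_mult norm_power w_norm)
  have ZZ: "X * q ^ k \<noteq> Y * q ^ l" if "X \<in> Z" "Y \<in> Z" "X \<noteq> Y" for X Y k l
  proof
    assume eq: "X * q ^ k = Y * q ^ l"
    have "norm s ^ 2 * norm q ^ k = norm s ^ 2 * norm q ^ l"
      using arg_cong[OF eq, of norm] by (simp add: norm_mult norm_power Zn[OF that(1)] Zn[OF that(2)])
    then have "norm q ^ k = norm q ^ l" using assms(1) by simp
    then have "k = l" using q q0 power_inject_exp'[of "norm q" k l] by simp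
    then show False using eq that(3) q0 by simp
  qed
  have B: "cubic_bases s x y z = {x, y, z} \<union> Z" by (auto simp: cubic_bases_def Z_def)
  have sep: "separated q (cubic_bases s x y z)"
    unfolding separated_def
  proof (intro conjI ballI impI allI)
    show "finite (cubic_bases s x y z)" by (simp add: cubic_bases_def)
    show "0 \<notin> cubic_bases s x y z" using assms w0 by (auto simp: cubic_bases_def)
    fix X Y k l assume "X \<in> cubic_bases s x y z" "Y \<in> cubic_bases s x y z" "X \<noteq> Y"
    then consider "X \<in> {x, y, z}" "Y \<in> {x, y, z}" | "X \<in> {x, y, z}" "Y \<in> Z" | "X \<in> Z" "Y \<in> {x, y, z}" | "X \<in> Z" "Y \<in> Z"
      unfolding B by blast
    then show "X * q ^ k \<noteq> Y * q ^ l"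
    proof cases
      case 1 then show ?thesis using \<open>X \<noteq> Y\<close> by (rule xyz)
    next
      case 2 then show ?thesis by (rule xZ)
    next
      case 3 then show ?thesis using xZ[of Y X l k] by simp
    next
      case 4 then show ?thesis using \<open>X \<noteq> Y\<close> by (rule ZZ)
    qed
  qed
  have d1: "X \<noteq> Y" if "X \<in> {x, y, z}" "Y \<in> Z" for X Y using xZ[OF that, of 0 0] by simp
  have d2: "x \<noteq> y" "x \<noteq> z" "y \<noteq> z"
  proof -
    have "X / Y \<noteq> 1" if "qpoch_inf (X / Y) q \<noteq> 0" for X Y using qpoch_inf_nz[OF q that, of 0] by simp
    from this[OF Fd(2)[OF F(1)]] this[OF Fd(3)[OF F(1)]] this[OF Fd(3)[OF F(2)]]
    show "x \<noteq> y" "x \<noteq> z" "y \<noteq> z" using assms by auto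
  qed
  have d3: "\<omega> ^ 2 \<noteq> 1" "\<omega> ^ 2 \<noteq> \<omega>"
    using omega_cube omega_neq_1 by (auto simp: power2_eq_square power3_eq_cube w0)
  have dist: "distinct [x, y, z, s ^ 2, \<omega> * s ^ 2, \<omega> ^ 2 * s ^ 2]"
  proof -
    have "X \<noteq> s ^ 2 \<and> X \<noteq> \<omega> * s ^ 2 \<and> X \<noteq> \<omega> ^ 2 * s ^ 2" if "X \<in> {x, y, z}" for X
      using d1[OF that, of "s ^ 2"] d1[OF that, of "\<omega> * s ^ 2"] d1[OF that, of "\<omega> ^ 2 * s ^ 2"] by (simp add: Z_def)
    from this[of x] this[of y] this[of z] show ?thesis
      using d2 d3 omega_neq_1 assms(1) by auto
  qed
  have nz: "qpoch_inf X q \<noteq> 0 \<and> qpoch_inf (c * X) q \<noteq> 0" if "X \<in> cubic_bases s x y z" for X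
  proof (cases "X \<in> {x, y, z}")
    case True
    have "c * x = q * a / (y * z)" "c * y = q * a / (x * z)" "c * z = q * a / (y * x)"
      using assms by (simp_all add: c_def)
    then show ?thesis using True Fd(1,4)[OF F(1)] Fd(1,4)[OF F(2)] Fd(1,4)[OF F(3)] by auto
  next
    case False
    then have XZ: "X \<in> Z" using that B by auto
    then have "\<exists>\<zeta>\<in>{1, \<omega>, \<omega> ^ 2}. X = \<zeta> * s ^ 2" by (auto simp: Z_def)
    then obtain \<zeta> where z: "\<zeta> \<in> {1, \<omega>, \<omega> ^ 2}" "X = \<zeta> * s ^ 2" by blast
    have "c * X = q * \<zeta> * s ^ 8 / (x * y * z)" by (simp add: c_def a_def z flip: power_add)
    then have 1: "qpoch_inf (c * X) q \<noteq> 0"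
      using E[OF z(1)] unfolding qpochs_inf_def E_denom_def by auto
    have "X ^ 3 = a"
    proof -
      have "(\<omega> ^ 2) ^ 3 = 1" using omega_cube by algebra
      then have "\<zeta> ^ 3 = 1" using z omega_cube by auto
      then show ?thesis by (simp add: z a_def power_mult_distrib flip: power_mult)
    qed
    moreover have "X * q ^ j \<noteq> 1" for j
    proof
      assume "X * q ^ j = 1"
      then have "X ^ 3 * (q ^ j) ^ 3 = 1" by (simp add: power_mult_distrib [symmetric])
      then have "a * q ^ (j * 3) = 1" using \<open>X ^ 3 = a\<close> by (simp add: power_mult)
      then show False using qpoch_inf_nz[OF q anz] by blast
    qed
    ultimately show ?thesis using 1 by (simp add: qpoch_inf_eq_0_iff[OF q])
  qed
  show ?thesis
    unfolding cubic_generic_def using assms sep dist nz by (simp add: c_def a_def)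
qed

end

section \<open>The cubic transformation\<close>

theorem theorem9p2:
  fixes q r a s x y z h :: complex
  assumes "q \<noteq> 0" "a \<noteq> 0" "x \<noteq> 0" "y \<noteq> 0" "z \<noteq> 0" "h \<noteq> 0"
    and "r ^ 2 = q" and "s ^ 6 = a"
    and "norm q < 1"
    and "norm (q ^ 3 * a ^ 4) < norm (x * y * z) ^ 3"
    and "no_vanishing_denominators q a s h x y z"
  shows
    "vwp a (s ^ 3) (W_params q x y z) (q ^ 3) (q ^ 3 * a ^ 4 / (x * y * z) ^ 3) =
       qpochs_inf [q * a, x, y, z, q * a / (x * y), q * a / (x * z), q * a / (y * z),
                   s ^ 2, \<omega> * s ^ 2, \<omega> ^ 2 * s ^ 2] q
       / (thetas [h, h * (x * y * z / (q * a))] q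
          * qpochs_inf [q * a / x, q * a / y, q * a / z, a] q)
       * (F_term q r a s h x y z + F_term q r a s h y x z + F_term q r a s h z y x
          + 1 / qpochs_inf [\<omega>, \<omega> ^ 2] q * (\<Sum>\<zeta>\<in>{1, \<omega>, \<omega> ^ 2}. E_term q r s h x y z \<zeta>))"
proof -
  interpret nome q using assms(1,9) by unfold_locales
  note q0 = assms(1) and a0 = assms(2) and xyz = assms(3-5) and h = assms(6) and r = assms(7) and q = assms(9) and nv = assms(11)
  have as: "a = s ^ 6" using assms(8) by simp
  have s: "s \<noteq> 0" using a0 as by auto
  define c where "c = q * a / (x * y * z)"
  define B where "B = cubic_bases s x y z"
  define N where "N = cubic_num q a h c"
  have c0: "c \<noteq> 0" and e: "x * y * z * c = q * a" using xyz q0 a0 by (auto simp: c_def)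
  have ok: "cubic_generic s h c x y z"
    unfolding c_def as by (rule cubic_generic_if_no_vanishing_denominators[OF s h xyz nv[unfolded as]])
  have sep: "separated q B" and dist: "distinct [x, y, z, s ^ 2, \<omega> * s ^ 2, \<omega> ^ 2 * s ^ 2]"
    and nzB: "\<And>X. X \<in> B \<Longrightarrow> qpoch_inf X q \<noteq> 0" "\<And>X. X \<in> B \<Longrightarrow> qpoch_inf (c * X) q \<noteq> 0"
    using ok unfolding cubic_generic_def B_def by blast+
  have inB: "x \<in> B" "y \<in> B" "z \<in> B" by (auto simp: B_def cubic_bases_def)
  have sok: "saal_generic q c x y z"
    using sep dist nzB inB unfolding saal_generic_def separated_def by auto
  have anz: "qpoch_inf a q \<noteq> 0" and qax: "qpoch_inf (q * a / x) q \<noteq> 0" "qpoch_inf (q * a / y) q \<noteq> 0" "qpoch_inf (q * a / z) q \<noteq> 0"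
    and th: "theta h q \<noteq> 0" "theta (h * (x * y * z / (q * a))) q \<noteq> 0"
    using nv unfolding no_vanishing_denominators_def qpochs_inf_def thetas_def by auto
  have p: "norm (q ^ 3) < 1" by (rule norm_cube_lt_1[OF q])
  \<comment> \<open>The cube of this inequality is the hypothesis on \<open>|q\<^sup>3 a\<^sup>4|\<close>, because \<open>c\<^sup>3 a = q\<^sup>3 a\<^sup>4 / (x y z)\<^sup>3\<close>.\<close>
  have conv: "norm c * norm s ^ 2 < 1"
  proof (rule ccontr)
    assume "\<not> ?thesis"
    then have "1 \<le> (norm c * norm s ^ 2) ^ 3" by (intro one_le_power) auto
    also have "\<dots> = norm (c ^ 3 * s ^ 6)" by (simp add: norm_mult norm_power power_mult_distrib flip: power_mult)
    also have "c ^ 3 * s ^ 6 = q ^ 3 * a ^ 4 / (x * y * z) ^ 3"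
      unfolding as [symmetric] by (simp add: c_def power_divide power_mult_distrib eval_nat_numeral)
    also have "norm \<dots> = norm (q ^ 3 * a ^ 4) / norm (x * y * z) ^ 3" by (simp add: norm_divide norm_power)
    also have "\<dots> < 1" using assms(10) xyz by (simp add: divide_less_eq)
    finally show False by simp
  qed
  have xyc: "x * y * c = q * a / z" "x * z * c = q * a / y" "y * z * c = q * a / x"
    "c * x = q * a / (y * z)" "c * y = q * a / (x * z)" "c * z = q * a / (x * y)" "h / c = h * (x * y * z / (q * a))"
    "a * c ^ 3 = q ^ 3 * a ^ 4 / (x * y * z) ^ 3"
    using xyz by (simp_all add: c_def power_divide power_mult_distrib eval_nat_numeral)
  define \<Theta> where "\<Theta> = theta h q * theta (h * (x * y * z / (q * a))) q"
  \<comment> \<open>The value of the Saalschuetz sum without its dependence on \<open>n\<close>.\<close>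
  define K0 where "K0 = \<Theta> * (qpoch_inf (q * a / x) q * qpoch_inf (q * a / y) q * qpoch_inf (q * a / z) q)
     / (qpoch_inf q q * (qpoch_inf x q * qpoch_inf y q * qpoch_inf z q)
        * (qpoch_inf (q * a / (y * z)) q * qpoch_inf (q * a / (x * z)) q * qpoch_inf (q * a / (x * y)) q))"
  have cnz: "qpoch_inf (q * a / (y * z)) q \<noteq> 0" "qpoch_inf (q * a / (x * z)) q \<noteq> 0" "qpoch_inf (q * a / (x * y)) q \<noteq> 0"
    using nzB(2) inB unfolding xyc(4-6) [symmetric] by blast+
  have K0: "K0 \<noteq> 0"
    unfolding K0_def \<Theta>_def using th qax nzB(1) inB cnz qpoch_inf_q_nz[OF q] by simp
  define w where "w n = qpochs ([a, q ^ 3 * s ^ 3, - (q ^ 3 * s ^ 3)] @ W_params q x y z) (q ^ 3) n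
      / qpochs (q ^ 3 # vwp_lower a (s ^ 3) (W_params q x y z) (q ^ 3)) (q ^ 3) n * (q ^ 3 * a ^ 4 / (x * y * z) ^ 3) ^ n" for n
  have summand: "(\<Sum>X\<in>{x, y, z}. \<Sum>k. pole_term q (kernel_vwp q a h c n) {x, y, z} X k) = w n * K0" for n
  proof -
    have 1: "qpochs ([a, q ^ 3 * s ^ 3, - (q ^ 3 * s ^ 3)] @ W_params q x y z) (q ^ 3) n
      / qpochs (q ^ 3 # vwp_lower a (s ^ 3) (W_params q x y z) (q ^ 3)) (q ^ 3) n
    = (1 - a * q ^ (6 * n)) / (1 - a) * qpoch a (q^3) n / qpoch (q^3) (q^3) n
     * (qpoch x q (3 * n) * qpoch y q (3 * n) * qpoch z q (3 * n))
     / (qpoch (q * a / x) q (3 * n) * qpoch (q * a / y) q (3 * n) * qpoch (q * a / z) q (3 * n))"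
      using vwp_cubic_term[OF s xyz anz[unfolded as], of n] unfolding as [symmetric] .
    have nzl: "qpoch_inf (x * y * c) q \<noteq> 0" "qpoch_inf (x * z * c) q \<noteq> 0" "qpoch_inf (y * z * c) q \<noteq> 0"
      unfolding xyc using qax by auto
    show ?thesis
      unfolding kernel_vwp_sum[OF h c0 sok e nzl] w_def 1 K0_def \<Theta>_def xyc
      by (simp add: mult_ac)
  qed
  define K where "K = qpoch_inf (a * q ^ 3) (q ^ 3)"
  define S where "S X = (\<Sum>k. pole_term q N B X k)" for X
  have "(\<lambda>n. w n * K0) sums (\<Sum>X\<in>B. S X)"
    using cubic_main_sum[OF h c0 s as e sok sep[unfolded B_def] dist anz conv]
    unfolding summand B_def [symmetric] N_def [symmetric] S_def .
  then have "w sums ((\<Sum>X\<in>B. S X) / K0)"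
    using sums_divide[of "\<lambda>n. w n * K0" _ K0] K0 by simp
  then have lhs: "vwp a (s ^ 3) (W_params q x y z) (q ^ 3) (q ^ 3 * a ^ 4 / (x * y * z) ^ 3) = (\<Sum>X\<in>B. S X) / K0"
    unfolding vwp_def qhyp_def w_def by (simp add: sums_iff)
  have Bperm: "cubic_bases s y x z = B" "cubic_bases s z y x = B"
    by (auto simp: B_def cubic_bases_def)
  have F1: "S x = K / qpoch_inf q q * F_term q r a s h x y z"
    using F_pole_sum[OF ok r] unfolding S_def K_def N_def B_def as .
  have F2: "S y = K / qpoch_inf q q * F_term q r a s h y x z"
    using F_pole_sum[OF cubic_generic_swap(1)[OF ok] r] unfolding Bperm S_def K_def N_def as .
  have F3: "S z = K / qpoch_inf q q * F_term q r a s h z y x"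
    using F_pole_sum[OF cubic_generic_swap(2)[OF ok] r] unfolding Bperm S_def K_def N_def as .
  have E: "S (\<zeta> * s ^ 2) = K / qpoch_inf q q * (1 / qpochs_inf [\<omega>, \<omega> ^ 2] q * E_term q r s h x y z \<zeta>)" if "\<zeta> \<in> {1, \<omega>, \<omega> ^ 2}" for \<zeta>
    using E_pole_sum[OF ok r that] unfolding S_def K_def N_def B_def as .
  have sum6: "(\<Sum>X\<in>B. S X) = S x + S y + S z + (\<Sum>\<zeta>\<in>{1, \<omega>, \<omega> ^ 2}. S (\<zeta> * s ^ 2))"
  proof -
    have "distinct [1, \<omega>, \<omega> ^ 2]" using dist by auto
    then have "(\<Sum>\<zeta>\<in>{1, \<omega>, \<omega> ^ 2}. S (\<zeta> * s ^ 2)) = S (s ^ 2) + S (\<omega> * s ^ 2) + S (\<omega> ^ 2 * s ^ 2)"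
      by (simp add: add.assoc)
    moreover have "B = set [x, y, z, s ^ 2, \<omega> * s ^ 2, \<omega> ^ 2 * s ^ 2]" by (simp add: B_def cubic_bases_def)
    ultimately show ?thesis using sum.distinct_set_conv_list[OF dist, of S] by (simp add: add_ac)
  qed
  define R where "R = F_term q r a s h x y z + F_term q r a s h y x z + F_term q r a s h z y x
          + 1 / qpochs_inf [\<omega>, \<omega> ^ 2] q * (\<Sum>\<zeta>\<in>{1, \<omega>, \<omega> ^ 2}. E_term q r s h x y z \<zeta>)"
  have "(\<Sum>\<zeta>\<in>{1, \<omega>, \<omega> ^ 2}. S (\<zeta> * s ^ 2)) = (\<Sum>\<zeta>\<in>{1, \<omega>, \<omega> ^ 2}. K / qpoch_inf q q * (1 / qpochs_inf [\<omega>, \<omega> ^ 2] q * E_term q r s h x y z \<zeta>))"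
    by (intro sum.cong refl E)
  also have "\<dots> = K / qpoch_inf q q * (1 / qpochs_inf [\<omega>, \<omega> ^ 2] q * (\<Sum>\<zeta>\<in>{1, \<omega>, \<omega> ^ 2}. E_term q r s h x y z \<zeta>))"
    by (simp only: sum_distrib_left)
  finally have rhs: "(\<Sum>X\<in>B. S X) = K / qpoch_inf q q * R"
    unfolding sum6 F1 F2 F3 R_def by (simp only: distrib_left)
  \<comment> \<open>Up to \<open>1 - a\<close>, the cube-root factors of the stated prefactor combine to the constant \<open>K\<close> that all six residue families carry.\<close>
  have P1: "qpoch_inf (s ^ 2) q * qpoch_inf (\<omega> * s ^ 2) q * qpoch_inf (\<omega> ^ 2 * s ^ 2) q = (1 - a) * K"
    using qpoch_inf_cube[OF q, of "s ^ 2"] qpoch_inf_Suc[OF p, of a] by (simp add: as K_def flip: power_mult)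
  have P2: "qpoch_inf a q = (1 - a) * qpoch_inf (q * a) q"
    using qpoch_inf_Suc[OF q, of a] by (simp add: mult.commute)
  have P2': "1 - a \<noteq> 0" "qpoch_inf (q * a) q \<noteq> 0" using anz unfolding P2 by auto
  have "qpochs_inf [q * a, x, y, z, q * a / (x * y), q * a / (x * z), q * a / (y * z), s ^ 2, \<omega> * s ^ 2, \<omega> ^ 2 * s ^ 2] q
     = qpoch_inf (q * a) q * (qpoch_inf x q * qpoch_inf y q * qpoch_inf z q)
        * (qpoch_inf (q * a / (y * z)) q * qpoch_inf (q * a / (x * z)) q * qpoch_inf (q * a / (x * y)) q)
        * ((1 - a) * K)"
    unfolding P1 [symmetric] qpochs_inf_def by (simp add: mult_ac)
  moreover have "thetas [h, h * (x * y * z / (q * a))] q * qpochs_inf [q * a / x, q * a / y, q * a / z, a] q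
     = \<Theta> * (qpoch_inf (q * a / x) q * qpoch_inf (q * a / y) q * qpoch_inf (q * a / z) q) * ((1 - a) * qpoch_inf (q * a) q)"
    unfolding P2 [symmetric] thetas_def qpochs_inf_def \<Theta>_def by (simp add: mult_ac)
  ultimately have pre: "qpochs_inf [q * a, x, y, z, q * a / (x * y), q * a / (x * z), q * a / (y * z), s ^ 2, \<omega> * s ^ 2, \<omega> ^ 2 * s ^ 2] q
       / (thetas [h, h * (x * y * z / (q * a))] q * qpochs_inf [q * a / x, q * a / y, q * a / z, a] q)
     = K / (qpoch_inf q q * K0)"
    unfolding K0_def using P2' qpoch_inf_q_nz[OF q] by (simp add: mult_ac)
  show ?thesis unfolding lhs rhs pre R_def [symmetric] by simp
qed

end
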